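(* Let $Y,Z$ be rearrangement invariant Banach function spaces whose upper Boyd indices are both smaller than $1$, let $j,k$ be integers with $1\leq j<k$, and let $X=Y^{j/k}Z^{1-j/k}$ be the Calderón–Lozanovskii space. Then there is a constant $C>0$ such that $$\|\nabla^j u\|_{X}\leq C\,\|\nabla^k u\|_Y^{\frac{j}{k}}\|u\|_Z^{1-\frac{j}{k}}$$ for all $u\in W^{k,1}_{\mathrm{loc}}(\mathbb{R}^d)\cap Z$.
   Context: A Banach function space (B.f. space) over $(0,\infty)$ with Lebesgue measure is a Banach space $X$ of a.e. finite measurable functions with the ideal property ($|f|\le g$, $g\in X$ implies $f\in X$, $\|f\|_X\le\|g\|_X$) and the Fatou property ($0\le f_n\uparrow f$ a.e., $\sup_n\|f_n\|_X<\infty$ implies $f\in X$, $\|f\|_X=\sup_n\|f_n\|_X$). It is rearrangement invariant (r.i.B.f. space) if equimeasurable functions have equal norms. For a measurable $f$ on $\mathbb{R}^d$, $f^*$ denotes its nonincreasing rearrangement on $(0,\infty)$, and $\|f\|_X:=\|f^*\|_X$; $f\in X$ means $f^*\in X$. For $|\alpha|=k$ derivatives are distributional, $|\nabla^k u|:=\sum_{|\alpha|=k}|\partial^\alpha u|$ and $\|\nabla^k u\|_X:=\||\nabla^k u|\|_X$. The dilation operator is $D_sf(t)=f(st)$, $s>0$; the upper Boyd index of $X$ is $\lim_{s\to\infty}\log\|D_{1/s}\|_{X\to X}/\log s$ (e.g. it equals $1/p$ for $L^p$). For $0<\theta<1$ the Calderón–Lozanovskii space $X^\theta Y^{1-\theta}$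 consists of all $f$ with $|f|\le g^\theta h^{1-\theta}$ for some $0\le g\in X$, $0\le h\in Y$, with norm $\inf\max\{\|g\|_X,\|h\|_Y\}$ over all such representations. *)

theory Defs
  imports "HOL-Analysis.Analysis"
begin

text \<open>A Banach function space over (0,\<infinity>) (Lebesgue measure) is represented by its
  function norm rho acting on nonnegative (extended-valued) Lebesgue measurable functions:
  f belongs to the space iff rho |f| < \<infinity>, and the norm of f is rho |f|.
  Values of functions at t \<le> 0 are irrelevant.\<close>

definition ae_pos :: "(real \<Rightarrow> bool) \<Rightarrow> bool" where
  "ae_pos P \<longleftrightarrow> (AE t in lebesgue. 0 < t \<longrightarrow> P t)"

definition BFS :: "((real \<Rightarrow> ennreal) \<Rightarrow> ennreal) \<Rightarrow> bool" where
  "BFS \<rho> \<longleftrightarrow>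
     (\<forall>f \<in> borel_measurable lebesgue. \<rho> f = 0 \<longleftrightarrow> ae_pos (\<lambda>t. f t = 0)) \<and>
     (\<forall>f \<in> borel_measurable lebesgue. \<forall>c::real. c \<ge> 0 \<longrightarrow>
         \<rho> (\<lambda>t. ennreal c * f t) = ennreal c * \<rho> f) \<and>
     (\<forall>f \<in> borel_measurable lebesgue. \<forall>g \<in> borel_measurable lebesgue.
         \<rho> (\<lambda>t. f t + g t) \<le> \<rho> f + \<rho> g) \<and>
     (\<forall>f \<in> borel_measurable lebesgue. \<forall>g \<in> borel_measurable lebesgue.
         ae_pos (\<lambda>t. f t \<le> g t) \<longrightarrow> \<rho> f \<le> \<rho> g) \<and>
     (\<forall>F f. (\<forall>n. F n \<in> borel_measurable lebesgue) \<longrightarrow> f \<in> borel_measurable lebesgue \<longrightarrow>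
         ae_pos (\<lambda>t. incseq (\<lambda>n. F n t) \<and> (\<lambda>n. F n t) \<longlonglongrightarrow> f t) \<longrightarrow>
         \<rho> f = (SUP n. \<rho> (F n))) \<and>
     (\<forall>f \<in> borel_measurable lebesgue. \<rho> f < \<infinity> \<longrightarrow> ae_pos (\<lambda>t. f t < \<infinity>))"

definition distr0 :: "(real \<Rightarrow> ennreal) \<Rightarrow> ennreal \<Rightarrow> ennreal" where
  "distr0 f c = emeasure lebesgue {t. 0 < t \<and> c < f t}"

definition RIBFS :: "((real \<Rightarrow> ennreal) \<Rightarrow> ennreal) \<Rightarrow> bool" where
  "RIBFS \<rho> \<longleftrightarrow> BFS \<rho> \<and>
     (\<forall>f \<in> borel_measurable lebesgue. \<forall>g \<in> borel_measurable lebesgue.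
        (\<forall>c. distr0 f c = distr0 g c) \<longrightarrow> \<rho> f = \<rho> g)"

definition dil_norm :: "((real \<Rightarrow> ennreal) \<Rightarrow> ennreal) \<Rightarrow> real \<Rightarrow> ennreal" where
  "dil_norm \<rho> s = (SUP f \<in> {f \<in> borel_measurable lebesgue. \<rho> f \<le> 1}. \<rho> (\<lambda>t. f (s * t)))"

definition upper_boyd :: "((real \<Rightarrow> ennreal) \<Rightarrow> ennreal) \<Rightarrow> real" where
  "upper_boyd \<rho> = Lim at_top (\<lambda>s. ln (enn2real (dil_norm \<rho> (1 / s))) / ln s)"

text \<open>Powers of extended nonnegative reals (exponent in (0,1)): \<infinity>^a = \<infinity>.\<close>

definition epowr :: "ennreal \<Rightarrow> real \<Rightarrow> ennreal" where
  "epowr x a = (if x = top then top else ennreal (enn2real x powr a))"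

definition CL_space :: "((real \<Rightarrow> ennreal) \<Rightarrow> ennreal) \<Rightarrow> ((real \<Rightarrow> ennreal) \<Rightarrow> ennreal)
    \<Rightarrow> real \<Rightarrow> (real \<Rightarrow> ennreal) \<Rightarrow> ennreal" where
  "CL_space \<rho>Y \<rho>Z \<theta> f = (INF gh \<in> {(g, h). g \<in> borel_measurable lebesgue \<and> h \<in> borel_measurable lebesgue \<and>
        ae_pos (\<lambda>t. f t \<le> epowr (g t) \<theta> * epowr (h t) (1 - \<theta>))}.
        max (\<rho>Y (fst gh)) (\<rho>Z (snd gh)))"

definition rearr :: "(real^'d::finite \<Rightarrow> real) \<Rightarrow> real \<Rightarrow> ennreal" where
  "rearr u t = Inf {c::ennreal. emeasure lebesgue {x. c < ennreal \<bar>u x\<bar>} \<le> ennreal t}"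

definition normR :: "((real \<Rightarrow> ennreal) \<Rightarrow> ennreal) \<Rightarrow> (real^'d::finite \<Rightarrow> real) \<Rightarrow> ennreal" where
  "normR \<rho> u = \<rho> (rearr u)"

definition memR :: "((real \<Rightarrow> ennreal) \<Rightarrow> ennreal) \<Rightarrow> (real^'d::finite \<Rightarrow> real) \<Rightarrow> bool" where
  "memR \<rho> u \<longleftrightarrow> u \<in> borel_measurable lebesgue \<and> \<rho> (rearr u) < \<infinity>"

definition pd :: "'d::finite \<Rightarrow> (real^'d \<Rightarrow> real) \<Rightarrow> real^'d \<Rightarrow> real" where
  "pd i f x = deriv (\<lambda>h. f (x + h *\<^sub>R axis i 1)) 0"

definition pds :: "'d::finite list \<Rightarrow> (real^'d \<Rightarrow> real) \<Rightarrow> real^'d \<Rightarrow> real" where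
  "pds ds f = foldr pd ds f"

definition test_fun :: "(real^'d::finite \<Rightarrow> real) \<Rightarrow> bool" where
  "test_fun \<phi> \<longleftrightarrow> (\<forall>ds x. pds ds \<phi> differentiable (at x)) \<and> bounded {x. \<phi> x \<noteq> 0}"

definition locint :: "(real^'d::finite \<Rightarrow> real) \<Rightarrow> bool" where
  "locint u \<longleftrightarrow> (\<forall>K. compact K \<longrightarrow> set_integrable lebesgue K u)"

text \<open>v is the weak derivative \<partial>^\<alpha> u for the multi-index \<alpha>; for a smooth \<phi> the classical
  \<partial>^\<alpha> \<phi> is computed along any ordering of the directions.\<close>

definition weak_deriv :: "('d::finite \<Rightarrow> nat) \<Rightarrow> (real^'d \<Rightarrow> real) \<Rightarrow> (real^'d \<Rightarrow> real) \<Rightarrow> bool" where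
  "weak_deriv \<alpha> u v \<longleftrightarrow> locint u \<and> locint v \<and>
     (\<forall>\<phi>. test_fun \<phi> \<longrightarrow> (\<forall>ds. (\<forall>i. count_list ds i = \<alpha> i) \<longrightarrow>
        (\<integral>x. u x * pds ds \<phi> x \<partial>lebesgue) = (-1) ^ (sum \<alpha> UNIV) * (\<integral>x. v x * \<phi> x \<partial>lebesgue)))"

definition W_loc :: "nat \<Rightarrow> (real^'d::finite \<Rightarrow> real) \<Rightarrow> bool" where
  "W_loc k u \<longleftrightarrow> locint u \<and> (\<forall>\<alpha>. sum \<alpha> UNIV \<le> k \<longrightarrow> (\<exists>v. weak_deriv \<alpha> u v))"

definition wd :: "('d::finite \<Rightarrow> nat) \<Rightarrow> (real^'d \<Rightarrow> real) \<Rightarrow> real^'d \<Rightarrow> real" where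
  "wd \<alpha> u = (SOME v. weak_deriv \<alpha> u v)"

definition grad_abs :: "nat \<Rightarrow> (real^'d::finite \<Rightarrow> real) \<Rightarrow> real^'d \<Rightarrow> real" where
  "grad_abs k u x = (\<Sum>\<alpha> \<in> {\<alpha>::'d \<Rightarrow> nat. sum \<alpha> UNIV = k}. \<bar>wd \<alpha> u x\<bar>)"

end

theory Submission
  imports Defs
begin

text \<open>
  For \<open>|\<alpha>| = j\<close> and a kernel \<open>\<psi>\<close> whose two-scale difference has \<open>k - j\<close> vanishing moments, the convolutions of
  \<open>\<partial>\<^sup>\<alpha> u\<close> with \<open>\<psi>\<close> at the scales \<open>R, R/2, R/4, \<dots>\<close> telescope; each difference is an average of derivatives of
  order \<open>k\<close>, and the term of scale \<open>R\<close> is an average of \<open>u\<close>. At Lebesgue points this gives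
  \<open>|\<partial>\<^sup>\<alpha> u| \<le> C (R\<^sup>k\<^sup>-\<^sup>j M|\<nabla>\<^sup>k u| + R\<^sup>-\<^sup>j M u)\<close> with the Hardy-Littlewood maximal operator \<open>M\<close>, and one optimises
  over \<open>R\<close>. By Herz's estimate \<open>(M f)\<^sup>*\<close> is bounded by a sum of dilates of \<open>f\<^sup>*\<close>, whose norm converges because the
  upper Boyd indices are smaller than 1.
\<close>

section \<open>Rearrangements and dilations\<close>

text \<open>\<open>upper_boyd\<close> is a \<open>Lim\<close>, which carries no information unless
  the limit exists. So a single consequence is drawn from the hypothesis: for some q > 1 the
  dilation f(t) to f(t/q) has norm below q. This makes the norms of the dilates in the estimate of
  the maximal function a geometric series. The kernel is a tensor product of one-variable kernels,
  and its scale is halved in one coordinate at a time. Each change produces a pure derivative of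
  order k - j in one direction, so only derivatives of u of order exactly k appear. For fixed t the
  two maximal functions are controlled outside sets of measure t/2 each; hence the bounds involve
  t/2, and this extra dilation costs a factor 2 in the norm. The norm of X is an infimum of maxima,
  whereas a product is to be bounded. The two factors are rescaled to bridge this, which means
  dividing by the norms, so norms 0 and infinity are treated apart. Since 0 times infinity is 0,
  this includes showing that u = 0 almost everywhere forces the k-th gradient to vanish.\<close>

definition nrearr :: "('a::euclidean_space \<Rightarrow> ennreal) \<Rightarrow> real \<Rightarrow> ennreal" where
  "nrearr f t = Inf {c. emeasure lebesgue {x. c < f x} \<le> ennreal t}"

lemma rearr_eq_nrearr: "rearr u = nrearr (\<lambda>x. ennreal \<bar>u x\<bar>)"
  by (rule ext) (simp add: rearr_def nrearr_def)

lemma sets_lebesgue_superlevel [measurable]: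
  fixes f :: "'a::euclidean_space \<Rightarrow> ennreal"
  assumes "f \<in> borel_measurable lebesgue"
  shows "{x. c < f x} \<in> sets lebesgue"
proof -
  have "{x \<in> space lebesgue. c < f x} \<in> sets lebesgue"
    using assms by measurable
  then show ?thesis by simp
qed

text \<open>The infimum in \<open>nrearr\<close> is attained: along admissible levels decreasing to
  it the superlevel sets increase to the one in question, and continuity from below applies.\<close>

lemma emeasure_nrearr_level:
  fixes f :: "'a::euclidean_space \<Rightarrow> ennreal"
  assumes f: "f \<in> borel_measurable lebesgue"
  shows "emeasure lebesgue {x. nrearr f t < f x} \<le> ennreal t"
proof -
  let ?S = "{c. emeasure lebesgue {x. c < f x} \<le> ennreal t}"
  have "top \<in> ?S" by simp
  then have "?S \<noteq> {}" by blast
  from ennreal_Inf_countable_INF[OF this] obtain c where c: "decseq c" "range c \<subseteq> ?S" "Inf ?S = (INF i. c i)"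
    by blast
  have eq: "{x. nrearr f t < f x} = (\<Union>i. {x. c i < f x})"
    unfolding nrearr_def c(3) by (auto simp: INF_less_iff)
  have "(SUP i. emeasure lebesgue {x. c i < f x}) = emeasure lebesgue (\<Union>i. {x. c i < f x})"
  proof (rule SUP_emeasure_incseq)
    show "incseq (\<lambda>i. {x. c i < f x})"
      using c(1) by (force simp: incseq_def decseq_def intro: le_less_trans)
  qed (use f in auto)
  then have "emeasure lebesgue {x. nrearr f t < f x} = (SUP i. emeasure lebesgue {x. c i < f x})"
    by (simp add: eq)
  also have "\<dots> \<le> ennreal t"
    using c(2) by (intro SUP_least) auto
  finally show ?thesis .
qed

lemma less_nrearr_iff:
  fixes f :: "'a::euclidean_space \<Rightarrow> ennreal"
  assumes f: "f \<in> borel_measurable lebesgue"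
  shows "c < nrearr f t \<longleftrightarrow> ennreal t < emeasure lebesgue {x. c < f x}"
proof
  assume "c < nrearr f t"
  then show "ennreal t < emeasure lebesgue {x. c < f x}"
    unfolding nrearr_def by (metis (mono_tags, lifting) Inf_lower leD mem_Collect_eq not_le)
next
  assume *: "ennreal t < emeasure lebesgue {x. c < f x}"
  show "c < nrearr f t"
  proof (rule ccontr)
    assume "\<not> c < nrearr f t"
    then have "{x. c < f x} \<subseteq> {x. nrearr f t < f x}" by auto
    then have "emeasure lebesgue {x. c < f x} \<le> emeasure lebesgue {x. nrearr f t < f x}"
      by (intro emeasure_mono) (use f in auto)
    also have "\<dots> \<le> ennreal t" by (rule emeasure_nrearr_level[OF f])
    finally show False using * by simp
  qed
qed

lemma nrearr_antimono: "s \<le> t \<Longrightarrow> nrearr f t \<le> nrearr f s"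
  unfolding nrearr_def by (intro Inf_superset_mono) (auto intro: order_trans ennreal_leI)

lemma nrearr_leI:
  "emeasure lebesgue {x. c < f x} \<le> ennreal t \<Longrightarrow> nrearr f t \<le> c"
  unfolding nrearr_def by (rule Inf_lower) simp

lemma borel_measurable_antimono_ennreal:
  fixes g :: "real \<Rightarrow> ennreal"
  assumes "\<And>s t. s \<le> t \<Longrightarrow> g t \<le> g s"
  shows "g \<in> borel_measurable borel"
proof (rule borel_measurableI_greater)
  fix y
  have "is_interval {x. y < g x}"
    unfolding is_interval_1 using assms by (auto intro: less_le_trans)
  then have "{x. y < g x} \<in> sets borel"
    by (rule is_real_interval[THEN exE]) (elim exE disjE, simp_all)
  then show "{x \<in> space borel. y < g x} \<in> sets borel" by simp
qed

lemma borel_measurable_nrearr [measurable]: "nrearr f \<in> borel_measurable borel"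
  by (rule borel_measurable_antimono_ennreal) (rule nrearr_antimono)

lemma measurable_lebesgue_if_borel:
  fixes f :: "'a::euclidean_space \<Rightarrow> 'b::topological_space"
  shows "f \<in> borel_measurable borel \<Longrightarrow> f \<in> borel_measurable lebesgue"
  by (simp add: measurable_completion)

lemma measurable_lebesgue_scale:
  fixes f :: "real \<Rightarrow> 'b::topological_space"
  assumes "f \<in> borel_measurable lebesgue" "s > 0"
  shows "(\<lambda>t. f (s * t)) \<in> borel_measurable lebesgue"
  using measurable_compose[OF lebesgue_measurable_scaling[of s] assms(1)] by simp

text \<open>By \<open>less_nrearr_iff\<close> the superlevel set of the rearrangement is the
  interval of all t with 0 < t < m, where m is the measure of the superlevel set of f. This allows
  replacing f by a nonincreasing Borel function of equal norm. The cut-off is there because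
  \<open>nrearr\<close> measures the whole line and \<open>distr0\<close> only t > 0.\<close>

lemma distr0_nrearr_half_line:
  assumes f: "f \<in> borel_measurable lebesgue"
  shows "distr0 (nrearr (\<lambda>t. f t * indicator {0<..} t)) c = distr0 f c"
proof -
  let ?g = "\<lambda>t::real. f t * indicator {0<..} t"
  let ?m = "emeasure lebesgue {x. c < ?g x}"
  have g: "?g \<in> borel_measurable lebesgue"
    using f by (intro borel_measurable_times_ennreal borel_measurable_indicator) auto
  have eq: "{x. c < ?g x} = {t. 0 < t \<and> c < f t}"
    by (auto simp: indicator_def split: if_splits)
  have "{t. 0 < t \<and> c < nrearr ?g t} = {t. 0 < t \<and> ennreal t < ?m}"
    by (simp only: less_nrearr_iff[OF g])
  moreover have "emeasure lebesgue {t. 0 < t \<and> ennreal t < ?m} = ?m"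
  proof (cases ?m)
    case (real r)
    have "{t. 0 < t \<and> ennreal t < ?m} = {0<..<r}"
      using real by (auto simp: ennreal_less_iff)
    then show ?thesis using real by simp
  next
    case top
    have "{t::real. 0 < t \<and> ennreal t < ?m} = {0<..}"
      using top by auto
    moreover have "emeasure lborel {0::real<..} = \<infinity>"
    proof -
      have "ennreal (real n) \<le> emeasure lborel {0::real<..}" for n
        using emeasure_mono[of "{0<..real n}" "{0<..}" lborel] by (simp add: subset_iff)
      then have "of_nat n \<le> emeasure lborel {0::real<..}" for n
        by (simp add: ennreal_of_nat_eq_real_of_nat)
      then have "(SUP n. of_nat n) \<le> emeasure lborel {0::real<..}" by (rule SUP_least)
      then show ?thesis by (simp add: ennreal_SUP_of_nat_eq_top top_unique)
    qed
    ultimately show ?thesis using top by simp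
  qed
  ultimately show ?thesis unfolding distr0_def eq by simp
qed

section \<open>Function norms: infinite sums and dilations\<close>

lemma BFSD:
  assumes "BFS \<rho>"
  shows BFS_zero_iff: "f \<in> borel_measurable lebesgue \<Longrightarrow> \<rho> f = 0 \<longleftrightarrow> ae_pos (\<lambda>t. f t = 0)"
    and BFS_scale: "f \<in> borel_measurable lebesgue \<Longrightarrow> c \<ge> 0 \<Longrightarrow> \<rho> (\<lambda>t. ennreal c * f t) = ennreal c * \<rho> f"
    and BFS_add: "f \<in> borel_measurable lebesgue \<Longrightarrow> g \<in> borel_measurable lebesgue \<Longrightarrow> \<rho> (\<lambda>t. f t + g t) \<le> \<rho> f + \<rho> g"
    and BFS_mono: "f \<in> borel_measurable lebesgue \<Longrightarrow> g \<in> borel_measurable lebesgue \<Longrightarrow> ae_pos (\<lambda>t. f t \<le> g t) \<Longrightarrow> \<rho> f \<le> \<rho> g"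
    and BFS_Fatou: "(\<And>n. F n \<in> borel_measurable lebesgue) \<Longrightarrow> f \<in> borel_measurable lebesgue \<Longrightarrow>
         ae_pos (\<lambda>t. incseq (\<lambda>n. F n t) \<and> (\<lambda>n. F n t) \<longlonglongrightarrow> f t) \<Longrightarrow> \<rho> f = (SUP n. \<rho> (F n))"
    and BFS_finite: "f \<in> borel_measurable lebesgue \<Longrightarrow> \<rho> f < \<infinity> \<Longrightarrow> ae_pos (\<lambda>t. f t < \<infinity>)"
  using assms unfolding BFS_def by blast+

lemma ae_posI: "(\<And>t. 0 < t \<Longrightarrow> P t) \<Longrightarrow> ae_pos P"
  unfolding ae_pos_def by simp

lemma BFS_sum:
  fixes F :: "nat \<Rightarrow> real \<Rightarrow> ennreal"
  assumes \<rho>: "BFS \<rho>" and F: "\<And>n. F n \<in> borel_measurable lebesgue"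
  shows "\<rho> (\<lambda>t. \<Sum>i<n. F i t) \<le> (\<Sum>i<n. \<rho> (F i))"
proof (induction n)
  case 0
  show ?case using BFS_zero_iff[OF \<rho>, of "\<lambda>_. 0"] by (simp add: ae_pos_def)
next
  case (Suc n)
  have "\<rho> (\<lambda>t. (\<Sum>i<n. F i t) + F n t) \<le> \<rho> (\<lambda>t. \<Sum>i<n. F i t) + \<rho> (F n)"
    by (rule BFS_add[OF \<rho>]) (use F in auto)
  also have "\<dots> \<le> (\<Sum>i<n. \<rho> (F i)) + \<rho> (F n)"
    using Suc by (intro add_right_mono)
  finally show ?case by simp
qed

text \<open>Finite subadditivity combined with the Fatou property for the partial sums.\<close>

lemma BFS_suminf:
  fixes F :: "nat \<Rightarrow> real \<Rightarrow> ennreal"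
  assumes \<rho>: "BFS \<rho>" and F: "\<And>n. F n \<in> borel_measurable lebesgue"
  shows "\<rho> (\<lambda>t. \<Sum>i. F i t) \<le> (\<Sum>i. \<rho> (F i))"
proof -
  have "\<rho> (\<lambda>t. \<Sum>i. F i t) = (SUP n. \<rho> (\<lambda>t. \<Sum>i<n. F i t))"
  proof (rule BFS_Fatou[OF \<rho>])
    show "ae_pos (\<lambda>t. incseq (\<lambda>n. \<Sum>i<n. F i t) \<and> (\<lambda>n. \<Sum>i<n. F i t) \<longlonglongrightarrow> (\<Sum>i. F i t))"
      by (intro ae_posI conjI incseq_SucI summable_LIMSEQ) auto
  qed (use F in auto)
  also have "\<dots> \<le> (\<Sum>i. \<rho> (F i))"
    by (intro SUP_least order_trans[OF BFS_sum[OF \<rho> F]] sum_le_suminf) auto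
  finally show ?thesis .
qed

lemma RIBFS_BFS: "RIBFS \<rho> \<Longrightarrow> BFS \<rho>"
  by (simp add: RIBFS_def)

lemma RIBFS_cong:
  "RIBFS \<rho> \<Longrightarrow> f \<in> borel_measurable lebesgue \<Longrightarrow> g \<in> borel_measurable lebesgue \<Longrightarrow>
    (\<And>c. distr0 f c = distr0 g c) \<Longrightarrow> \<rho> f = \<rho> g"
  unfolding RIBFS_def by blast

lemma distr0_scale:
  assumes s: "s > 0"
  shows "distr0 (\<lambda>t. f (s * t)) c = ennreal (1 / s) * distr0 f c"
proof -
  have "{t. 0 < t \<and> c < f (s * t)} = (\<lambda>x. (1/s) *\<^sub>R x + 0) ` {t. 0 < t \<and> c < f t}"
  proof (intro subset_antisym subsetI)
    fix t assume "t \<in> {t. 0 < t \<and> c < f (s * t)}"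
    then show "t \<in> (\<lambda>x. (1/s) *\<^sub>R x + 0) ` {t. 0 < t \<and> c < f t}"
      using s by (intro image_eqI[of _ _ "s * t"]) auto
  qed (use s in auto)
  then show ?thesis
    unfolding distr0_def using s by (simp only: emeasure_lebesgue_affine) simp
qed

lemma emeasure_lebesgue_shift:
  fixes S :: "real set"
  shows "emeasure lebesgue {t. t - a \<in> S} = emeasure lebesgue S"
proof -
  have "{t. t - a \<in> S} = (\<lambda>x. 1 *\<^sub>R x + a) ` S"
    by (auto simp: image_iff intro!: bexI[where x="_ - a"])
  then show ?thesis
    by (simp only: emeasure_lebesgue_affine) simp
qed

text \<open>Serves to compare distribution functions block by block, so that moving blocks by
  translations preserves them. The blocks are closed on the right to match the ceiling
  function.\<close>

lemma emeasure_half_line_split: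
  fixes S :: "real set"
  assumes S: "S \<in> sets lebesgue" and a: "a > 0"
  shows "emeasure lebesgue (S \<inter> {0<..}) = (\<Sum>k::nat. emeasure lebesgue (S \<inter> {real k * a<..real (Suc k) * a}))"
proof -
  have "S \<inter> {0<..} = (\<Union>k. S \<inter> {real k * a<..real (Suc k) * a})"
  proof (intro subset_antisym subsetI)
    fix x assume x: "x \<in> S \<inter> {0<..}"
    define k where "k = nat (\<lceil>x / a\<rceil> - 1)"
    have "x / a > 0" using x a by simp
    then have "\<lceil>x / a\<rceil> \<ge> 1" by linarith
    then have k: "real k = of_int \<lceil>x / a\<rceil> - 1" unfolding k_def by simp
    have "real k < x / a" "x / a \<le> real (Suc k)" unfolding of_nat_Suc k by linarith+
    then show "x \<in> (\<Union>k. S \<inter> {real k * a<..real (Suc k) * a})"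
      using x a by (auto simp: field_simps)
  next
    fix x assume "x \<in> (\<Union>k. S \<inter> {real k * a<..real (Suc k) * a})"
    then obtain k where "x \<in> S" "real k * a < x" by auto
    moreover have "0 \<le> real k * a" using a by simp
    ultimately show "x \<in> S \<inter> {0<..}" by auto
  qed
  moreover have "disjoint_family (\<lambda>k. S \<inter> {real k * a<..real (Suc k) * a})"
    unfolding disjoint_family_on_def
  proof (intro ballI impI, rule ccontr)
    fix m n :: nat assume "m \<noteq> n" and "S \<inter> {real m * a<..real (Suc m) * a} \<inter> (S \<inter> {real n * a<..real (Suc n) * a}) \<noteq> {}"
    then obtain x where "real m * a < x" "x \<le> real (Suc m) * a" "real n * a < x" "x \<le> real (Suc n) * a"
      by auto
    then have "real m * a < real (Suc n) * a" "real n * a < real (Suc m) * a" by linarith+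
    then have "m < Suc n" "n < Suc m" using a by (simp_all only: mult_less_cancel_right_pos of_nat_less_iff)
    with \<open>m \<noteq> n\<close> show False by simp
  qed
  moreover have "range (\<lambda>k. S \<inter> {real k * a<..real (Suc k) * a}) \<subseteq> sets lebesgue"
    using S by auto
  ultimately show ?thesis
    using suminf_emeasure[of "\<lambda>k. S \<inter> {real k * a<..real (Suc k) * a}" lebesgue] by simp
qed

text \<open>Cutting \<open>(0,\<infinity>)\<close> into unit intervals and putting two copies of \<open>f\<close> alternately on the odd and the
  even ones gives a function equimeasurable with \<open>f(t/2)\<close> that is a sum of two copies of \<open>f\<close>.\<close>

lemma RIBFS_double_borel:
  assumes \<rho>: "RIBFS \<rho>" and f: "f \<in> borel_measurable borel"
  shows "\<rho> (\<lambda>t. f (1/2 * t)) \<le> 2 * \<rho> f"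
proof -
  \<comment> \<open>If \<lceil>t\<rceil> is 2k+1 or 2k+2, the argument of f lies in (k,k+1]: the
    block of f over (k,k+1] is moved by k to (2k,2k+1] for \<open>G False\<close> and by k+1 to
    (2k+1,2k+2] for \<open>G True\<close>.\<close>
  define G where "G b t = (if even \<lceil>t\<rceil> = b then f (t - of_int (\<lceil>t\<rceil> div 2)) else 0)" for b and t :: real
  have G [measurable]: "G b \<in> borel_measurable borel" for b
    unfolding G_def using f by measurable
  have dG: "distr0 (G b) c = distr0 f c" for b c
  proof -
    let ?S = "{t. c < G b t}" and ?A = "{x. c < f x}"
    have S: "?S \<in> sets lebesgue" and A: "?A \<in> sets lebesgue"
      by (auto intro!: sets_lebesgue_superlevel measurable_lebesgue_if_borel f)
    let ?e = "if b then 1 else 0::nat"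
    have "?S \<inter> {real k * 2<..real (Suc k) * 2} = {t. t - (real k + real ?e) \<in> ?A \<inter> {real k * 1<..real (Suc k) * 1}}" for k :: nat
    proof (intro subset_antisym subsetI)
      fix t assume t: "t \<in> ?S \<inter> {real k * 2<..real (Suc k) * 2}"
      then have e: "even \<lceil>t\<rceil> = b" and c: "c < f (t - of_int (\<lceil>t\<rceil> div 2))"
        by (auto simp: G_def split: if_splits)
      have "2 * int k + 1 \<le> \<lceil>t\<rceil>" "\<lceil>t\<rceil> \<le> 2 * int k + 2" using t by (simp_all, linarith+)
      then have ct: "\<lceil>t\<rceil> = 2 * int k + 1 + int ?e" using e by (auto; presburger)
      then have d: "\<lceil>t\<rceil> div 2 = int k + int ?e" by auto
      have "t \<le> 2 * real k + 1 + real ?e" "2 * real k + real ?e < t"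
        using ct by linarith+
      then show "t \<in> {t. t - (real k + real ?e) \<in> ?A \<inter> {real k * 1<..real (Suc k) * 1}}"
        using c unfolding d by auto
    next
      fix t :: real assume t: "t \<in> {t. t - (real k + real ?e) \<in> ?A \<inter> {real k * 1<..real (Suc k) * 1}}"
      then have "t \<le> 2 * real k + 1 + real ?e" "2 * real k + real ?e < t" by auto
      then have ct: "\<lceil>t\<rceil> = 2 * int k + 1 + int ?e" by linarith
      then have d: "\<lceil>t\<rceil> div 2 = int k + int ?e" by auto
      have "even \<lceil>t\<rceil> = b" unfolding ct by auto
      then have "c < G b t" using t unfolding G_def d by auto
      then show "t \<in> ?S \<inter> {real k * 2<..real (Suc k) * 2}"
        using t by (auto split: if_splits)
    qed
    then have *: "emeasure lebesgue (?S \<inter> {real k * 2<..real (Suc k) * 2}) = emeasure lebesgue (?A \<inter> {real k * 1<..real (Suc k) * 1})" for k :: nat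
      by (simp only: emeasure_lebesgue_shift)
    have "distr0 (G b) c = emeasure lebesgue (?S \<inter> {0<..})" "distr0 f c = emeasure lebesgue (?A \<inter> {0<..})"
      unfolding distr0_def Int_def by (simp_all add: conj_commute)
    then show ?thesis
      using emeasure_half_line_split[OF S, of 2] emeasure_half_line_split[OF A, of 1] by (simp only: *)
  qed
  have "distr0 (\<lambda>t. G True t + G False t) c = distr0 (\<lambda>t. f (1/2 * t)) c" for c
  proof -
    have "{t. 0 < t \<and> c < G True t + G False t} = {t. 0 < t \<and> c < G True t} \<union> {t. 0 < t \<and> c < G False t}"
      by (auto simp: G_def split: if_splits)
    moreover have "{t. 0 < t \<and> c < G True t} \<inter> {t. 0 < t \<and> c < G False t} = {}"
      by (auto simp: G_def split: if_splits)
    moreover have "{t. 0 < t \<and> c < G b t} \<in> sets lebesgue" for b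
    proof -
      have "{t \<in> space borel. 0 < t \<and> c < G b t} \<in> sets borel" by measurable
      then show ?thesis by simp
    qed
    ultimately have "distr0 (\<lambda>t. G True t + G False t) c = distr0 (G True) c + distr0 (G False) c"
      unfolding distr0_def by (simp add: plus_emeasure)
    also have "\<dots> = 2 * distr0 f c" by (simp add: dG mult_2)
    also have "\<dots> = distr0 (\<lambda>t. f (1/2 * t)) c" by (subst distr0_scale) auto
    finally show ?thesis .
  qed
  then have "\<rho> (\<lambda>t. f (1/2 * t)) = \<rho> (\<lambda>t. G True t + G False t)"
    by (intro RIBFS_cong[OF \<rho>] measurable_lebesgue_if_borel) (use f in auto)
  also have "\<dots> \<le> \<rho> (G True) + \<rho> (G False)"
    by (intro BFS_add RIBFS_BFS \<rho> measurable_lebesgue_if_borel G)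
  also have "\<dots> = \<rho> f + \<rho> f"
    by (intro arg_cong2[where f="(+)"] RIBFS_cong[OF \<rho>] measurable_lebesgue_if_borel dG G f)
  finally show ?thesis by (simp add: mult_2)
qed

text \<open>Iterate \<open>RIBFS_double_borel\<close> n times, with 2^n between s and 2 s. The
  rearrangement g supplies the Borel measurability required there and the monotonicity behind g(t/s)
  \<le> g(2^(-n) t). The constant 2 s is crude, but log(2 s)/log s tends to 1, which is what
  \<open>upper_boyd_less_one\<close> uses.\<close>

lemma RIBFS_dilate_le:
  assumes \<rho>: "RIBFS \<rho>" and f: "f \<in> borel_measurable lebesgue" and s: "s \<ge> 1"
  shows "\<rho> (\<lambda>t. f (1 / s * t)) \<le> ennreal (2 * s) * \<rho> f"
proof -
  define g where "g = nrearr (\<lambda>t. f t * indicator {0<..} t)"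
  have g: "g \<in> borel_measurable borel" unfolding g_def by simp
  have dg: "distr0 g c = distr0 f c" for c
    unfolding g_def by (rule distr0_nrearr_half_line[OF f])
  have pow: "\<rho> (\<lambda>t. g ((1/2)^n * t)) \<le> 2 ^ n * \<rho> g" for n
  proof (induction n)
    case (Suc n)
    have "\<rho> (\<lambda>t. g ((1/2)^n * (1/2 * t))) \<le> 2 * \<rho> (\<lambda>t. g ((1/2)^n * t))"
      by (rule RIBFS_double_borel[OF \<rho>]) (use g in measurable)
    also have "\<dots> \<le> 2 * (2 ^ n * \<rho> g)" by (intro mult_left_mono Suc) simp
    finally show ?case by (simp add: mult.assoc mult.left_commute)
  qed simp
  define n where "n = nat \<lceil>log 2 s\<rceil>"
  have ls: "0 \<le> log 2 s" using s by simp
  have "log 2 s \<le> real n" "real n \<le> log 2 s + 1" unfolding n_def using ls by linarith+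
  then have "2 powr (log 2 s) \<le> 2 powr real n" "2 powr real n \<le> 2 powr (log 2 s + 1)" by simp_all
  then have n: "s \<le> 2 ^ n" "2 ^ n \<le> 2 * s" using s by (simp_all add: powr_realpow powr_add mult.commute)
  have "\<rho> (\<lambda>t. f (1 / s * t)) = \<rho> (\<lambda>t. g (1 / s * t))"
    by (rule RIBFS_cong[OF \<rho>])
      (use s in \<open>simp_all add: distr0_scale dg del: times_divide_eq_left
        add: measurable_lebesgue_scale[OF f] measurable_lebesgue_scale[OF measurable_lebesgue_if_borel[OF g]]\<close>)
  also have "\<dots> \<le> \<rho> (\<lambda>t. g ((1/2)^n * t))"
  proof (rule BFS_mono[OF RIBFS_BFS[OF \<rho>]])
    show "ae_pos (\<lambda>t. g (1 / s * t) \<le> g ((1/2) ^ n * t))"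
    proof (rule ae_posI)
      fix t :: real assume "0 < t"
      then have "(1/2) ^ n * t \<le> 1 / s * t"
        using n(1) s by (intro mult_right_mono) (auto simp: field_simps)
      then show "g (1 / s * t) \<le> g ((1/2) ^ n * t)" unfolding g_def by (rule nrearr_antimono)
    qed
  qed (use g s in \<open>auto intro!: measurable_lebesgue_scale measurable_lebesgue_if_borel\<close>)
  also have "\<dots> \<le> 2 ^ n * \<rho> g" by (rule pow)
  also have "\<rho> g = \<rho> f"
    by (intro RIBFS_cong[OF \<rho>] measurable_lebesgue_if_borel g f dg)
  also have "(2::ennreal) ^ n = ennreal (2 ^ n)" by (simp flip: ennreal_power)
  also have "ennreal (2 ^ n) * \<rho> f \<le> ennreal (2 * s) * \<rho> f"
    using n by (intro mult_right_mono ennreal_leI) auto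
  finally show ?thesis .
qed

text \<open>Otherwise s \<le> \<open>dil_norm \<rho> (1 / s)\<close> \<le> 2 s for all s > 1, and
  the quotient of logarithms is squeezed to 1. Existence of the limit is thus derived inside the
  contradiction and never presupposed.\<close>

lemma upper_boyd_less_one:
  assumes \<rho>: "RIBFS \<rho>" and ub: "upper_boyd \<rho> < 1"
  obtains q where "q > 1" "dil_norm \<rho> (1 / q) < ennreal q"
proof (rule ccontr)
  assume *: "\<not> thesis"
  have lo: "ennreal s \<le> dil_norm \<rho> (1 / s)" if "s > 1" for s
    using * that \<open>\<And>q. q > 1 \<Longrightarrow> dil_norm \<rho> (1 / q) < ennreal q \<Longrightarrow> thesis\<close> by (meson not_le)
  have hi: "dil_norm \<rho> (1 / s) \<le> ennreal (2 * s)" if "s > 1" for s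
    unfolding dil_norm_def
  proof (rule SUP_least)
    fix f assume f: "f \<in> {f \<in> borel_measurable lebesgue. \<rho> f \<le> 1}"
    have "\<rho> (\<lambda>t. f (1 / s * t)) \<le> ennreal (2 * s) * \<rho> f"
      using RIBFS_dilate_le[OF \<rho>] f that by auto
    also have "\<dots> \<le> ennreal (2 * s) * 1" using f by (intro mult_left_mono) auto
    finally show "\<rho> (\<lambda>t. f (1 / s * t)) \<le> ennreal (2 * s)" by simp
  qed
  have "((\<lambda>s. ln (enn2real (dil_norm \<rho> (1 / s))) / ln s) \<longlongrightarrow> 1) at_top"
  proof (rule tendsto_sandwich[of "\<lambda>s. 1" _ _ "\<lambda>s. (ln 2 + ln s) / ln s"])
    show "eventually (\<lambda>s. 1 \<le> ln (enn2real (dil_norm \<rho> (1 / s))) / ln s) at_top"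
      using eventually_gt_at_top[of 1]
    proof eventually_elim
      case (elim s)
      have "dil_norm \<rho> (1 / s) < top" using hi[OF elim] by (rule le_less_trans) simp
      then have "s \<le> enn2real (dil_norm \<rho> (1 / s))"
        using lo[OF elim] enn2real_mono[of "ennreal s" "dil_norm \<rho> (1 / s)"] elim by simp
      then show ?case using elim by (simp add: field_simps)
    qed
    show "eventually (\<lambda>s. ln (enn2real (dil_norm \<rho> (1 / s))) / ln s \<le> (ln 2 + ln s) / ln s) at_top"
      using eventually_gt_at_top[of 1]
    proof eventually_elim
      case (elim s)
      have fin: "dil_norm \<rho> (1 / s) < top" using hi[OF elim] by (rule le_less_trans) simp
      then have 1: "s \<le> enn2real (dil_norm \<rho> (1 / s))"
        using lo[OF elim] enn2real_mono[of "ennreal s" "dil_norm \<rho> (1 / s)"] elim by simp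
      have "enn2real (dil_norm \<rho> (1 / s)) \<le> 2 * s"
        using hi[OF elim] elim by (intro enn2real_leI) auto
      then have "ln (enn2real (dil_norm \<rho> (1 / s))) \<le> ln (2 * s)"
        using elim 1 by (subst ln_le_cancel_iff) auto
      also have "\<dots> = ln 2 + ln s" using elim by (simp add: ln_mult)
      finally show ?case using elim by (intro divide_right_mono) auto
    qed
    have "((\<lambda>s. ln 2 / ln s + 1) \<longlongrightarrow> 0 + 1) (at_top :: real filter)"
      by (intro tendsto_intros tendsto_divide_0[OF tendsto_const] filterlim_at_top_imp_at_infinity ln_at_top)
    moreover have "eventually (\<lambda>s::real. ln 2 / ln s + 1 = (ln 2 + ln s) / ln s) at_top"
      using eventually_gt_at_top[of 1] by eventually_elim (simp add: add_divide_distrib)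
    ultimately show "((\<lambda>s. (ln 2 + ln s) / ln s) \<longlongrightarrow> 1) (at_top :: real filter)"
      using Lim_transform_eventually by fastforce
  qed auto
  then have "upper_boyd \<rho> = 1"
    unfolding upper_boyd_def by (intro tendsto_Lim) auto
  with ub show False by simp
qed

lemma AE_scale:
  fixes s :: real
  assumes s: "s > 0" and P: "AE t in lebesgue. P t"
  shows "AE t in lebesgue. P (s * t)"
proof -
  from P obtain N where N: "N \<in> null_sets lebesgue" "{t. \<not> P t} \<subseteq> N"
    by (auto simp: eventually_ae_filter)
  have "{t. s * t \<in> N} = (\<lambda>x. (1/s) *\<^sub>R x + 0) ` N"
  proof (intro subset_antisym subsetI)
    fix t assume "t \<in> {t. s * t \<in> N}"
    then show "t \<in> (\<lambda>x. (1/s) *\<^sub>R x + 0) ` N" using s by (intro image_eqI[of _ _ "s * t"]) auto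
  qed (use s in auto)
  then have "emeasure lebesgue {t. s * t \<in> N} = 0"
    by (simp only: emeasure_lebesgue_affine) (use N in auto)
  moreover have "{t. s * t \<in> N} \<in> sets lebesgue"
    using measurable_sets[OF lebesgue_measurable_scaling[of s], of N] N by (auto simp: vimage_def)
  ultimately have "{t. s * t \<in> N} \<in> null_sets lebesgue" by blast
  then show ?thesis by (rule AE_I') (use N in auto)
qed

text \<open>Normalise f and use homogeneity. When \<rho> f = 0 this is impossible, but then f and
  its dilate are null functions and both sides vanish, even if the dilation norm is
  infinite.\<close>

lemma BFS_dil_norm:
  assumes \<rho>: "BFS \<rho>" and f: "f \<in> borel_measurable lebesgue" and s: "s > 0" and fin: "\<rho> f < \<infinity>"
  shows "\<rho> (\<lambda>t. f (s * t)) \<le> dil_norm \<rho> s * \<rho> f"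
proof (cases "\<rho> f = 0")
  case True
  then have "AE t in lebesgue. 0 < t \<longrightarrow> f t = 0"
    using BFS_zero_iff[OF \<rho> f] by (simp add: ae_pos_def)
  from AE_scale[OF s this] have "ae_pos (\<lambda>t. f (s * t) = 0)"
    unfolding ae_pos_def by eventually_elim (use s in auto)
  then show ?thesis
    using BFS_zero_iff[OF \<rho> measurable_lebesgue_scale[OF f s]] by simp
next
  case False
  with fin obtain r where r: "\<rho> f = ennreal r" "r > 0"
    by (cases "\<rho> f") (auto simp: less_le)
  let ?g = "\<lambda>t. ennreal (1/r) * f t"
  have g: "?g \<in> borel_measurable lebesgue" using f by measurable
  have "\<rho> ?g = ennreal (1/r) * \<rho> f" using r by (intro BFS_scale[OF \<rho> f]) auto
  also have "\<dots> = 1" using r by (simp flip: ennreal_mult)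
  finally have "\<rho> (\<lambda>t. ?g (s * t)) \<le> dil_norm \<rho> s"
    unfolding dil_norm_def using g by (intro SUP_upper2[of ?g]) auto
  then have le: "ennreal (1/r) * \<rho> (\<lambda>t. f (s * t)) \<le> dil_norm \<rho> s"
    using BFS_scale[OF \<rho> measurable_lebesgue_scale[OF f s], of "1/r"] r by simp
  have "\<rho> (\<lambda>t. f (s * t)) = ennreal r * (ennreal (1/r) * \<rho> (\<lambda>t. f (s * t)))"
    using r by (simp add: mult.assoc[symmetric] flip: ennreal_mult)
  also have "\<dots> \<le> ennreal r * dil_norm \<rho> s" by (intro mult_left_mono le) simp
  finally show ?thesis using r by (simp add: mult.commute)
qed

text \<open>For nonincreasing \<phi> this dominates the mean of \<phi> over (0,t): split at the
  points q^(-n) t and bound \<phi> on each piece by its value at the left end. Only iterates of the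
  single dilation by 1/q occur, so one bound on its norm suffices.\<close>

definition hardy_sum :: "real \<Rightarrow> (real \<Rightarrow> ennreal) \<Rightarrow> real \<Rightarrow> ennreal" where
  "hardy_sum q \<phi> t = (\<Sum>n. ennreal ((1/q)^n) * \<phi> ((1/q)^Suc n * t))"

lemma measurable_hardy_sum [measurable]:
  assumes "\<phi> \<in> borel_measurable borel"
  shows "hardy_sum q \<phi> \<in> borel_measurable borel"
  unfolding hardy_sum_def[abs_def] using assms by measurable

text \<open>With D0 the norm of the dilation, the n-th summand has norm at most q^(-n) D0^(n+1)
  times that of \<phi>: a geometric series of ratio D0/q < 1. The summand 1 in C keeps it positive
  when D0 = 0.\<close>

lemma BFS_hardy_sum:
  assumes \<rho>: "BFS \<rho>" and q: "q > 1" and D: "dil_norm \<rho> (1 / q) < ennreal q"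
  obtains C where "C > 0" "\<And>\<phi>. \<phi> \<in> borel_measurable borel \<Longrightarrow> \<rho> (hardy_sum q \<phi>) \<le> ennreal C * \<rho> \<phi>"
proof -
  from D obtain D0 where D0: "dil_norm \<rho> (1 / q) = ennreal D0" "0 \<le> D0" "D0 < q"
    by (cases "dil_norm \<rho> (1 / q)") (auto simp: ennreal_less_iff)
  define C where "C = D0 / (1 - D0 / q) + 1"
  have pos: "0 \<le> D0 / q" "D0 / q < 1" using D0 q by auto
  then have C: "C > 0" unfolding C_def using D0 by (intro add_nonneg_pos divide_nonneg_pos) auto
  show thesis
  proof (rule that[OF C])
    fix \<phi> :: "real \<Rightarrow> ennreal" assume \<phi>: "\<phi> \<in> borel_measurable borel"
    have dil: "(\<lambda>t. \<phi> (s * t)) \<in> borel_measurable lebesgue" for s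
      by (rule measurable_lebesgue_if_borel) (use \<phi> in measurable)
    show "\<rho> (hardy_sum q \<phi>) \<le> ennreal C * \<rho> \<phi>"
    proof (cases "\<rho> \<phi> < \<infinity>")
      case False
      then show ?thesis using C by (simp add: ennreal_mult_top less_top[symmetric])
    next
      case True
      have pow: "\<rho> (\<lambda>t. \<phi> ((1/q)^n * t)) \<le> ennreal (D0 ^ n) * \<rho> \<phi>" for n
      proof (induction n)
        case (Suc n)
        have "\<rho> (\<lambda>t. \<phi> ((1/q)^n * t)) < \<infinity>"
          using Suc True by (auto intro: le_less_trans simp: ennreal_mult_less_top)
        then have "\<rho> (\<lambda>t. \<phi> ((1/q)^n * (1 / q * t))) \<le> ennreal D0 * \<rho> (\<lambda>t. \<phi> ((1/q)^n * t))"
          using BFS_dil_norm[OF \<rho> dil, of "1/q" "(1/q)^n"] q D0 by simp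
        also have "\<dots> \<le> ennreal D0 * (ennreal (D0 ^ n) * \<rho> \<phi>)" by (intro mult_left_mono Suc) simp
        also have "\<dots> = ennreal (D0 ^ Suc n) * \<rho> \<phi>"
          using D0 by (simp add: mult.assoc ennreal_mult)
        finally show ?case by (simp add: mult.assoc mult.left_commute)
      qed simp
      have "\<rho> (hardy_sum q \<phi>) \<le> (\<Sum>n. \<rho> (\<lambda>t. ennreal ((1/q)^n) * \<phi> ((1/q)^Suc n * t)))"
        unfolding hardy_sum_def[abs_def]
        by (intro BFS_suminf[OF \<rho>] borel_measurable_times_ennreal dil) auto
      also have "\<dots> \<le> (\<Sum>n. ennreal (D0 * (D0 / q) ^ n) * \<rho> \<phi>)"
      proof (intro suminf_le)
        fix n
        have "\<rho> (\<lambda>t. ennreal ((1/q)^n) * \<phi> ((1/q)^Suc n * t)) = ennreal ((1/q)^n) * \<rho> (\<lambda>t. \<phi> ((1/q)^Suc n * t))"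
          using q by (intro BFS_scale[OF \<rho> dil]) auto
        also have "\<dots> \<le> ennreal ((1/q)^n) * (ennreal (D0 ^ Suc n) * \<rho> \<phi>)"
          by (intro mult_left_mono pow) simp
        also have "\<dots> = ennreal (D0 * (D0 / q) ^ n) * \<rho> \<phi>"
        proof -
          have "(1/q)^n * D0 ^ Suc n = D0 * (D0 / q) ^ n" by (simp add: power_divide)
          then show ?thesis using D0 q by (simp add: mult.assoc[symmetric] del: power_Suc flip: ennreal_mult)
        qed
        finally show "\<rho> (\<lambda>t. ennreal ((1/q)^n) * \<phi> ((1/q)^Suc n * t)) \<le> ennreal (D0 * (D0 / q) ^ n) * \<rho> \<phi>" .
      qed auto
      also have "\<dots> = (\<Sum>n. ennreal (D0 * (D0 / q) ^ n)) * \<rho> \<phi>" by simp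
      also have "(\<Sum>n. ennreal (D0 * (D0 / q) ^ n)) = ennreal (\<Sum>n. D0 * (D0 / q) ^ n)"
        using pos D0 by (intro suminf_ennreal2 summable_mult summable_geometric) auto
      also have "(\<Sum>n. D0 * (D0 / q) ^ n) = D0 / (1 - D0 / q)"
        using pos by (subst suminf_mult) (auto intro: summable_geometric simp: suminf_geometric)
      also have "ennreal (D0 / (1 - D0 / q)) * \<rho> \<phi> \<le> ennreal C * \<rho> \<phi>"
        unfolding C_def by (intro mult_right_mono ennreal_leI) auto
      finally show ?thesis .
    qed
  qed
qed

section \<open>The Hardy-Littlewood maximal function and Lebesgue points\<close>

text \<open>The averages are normalised by r^d, not by the volume of the ball, so a constant
  function c has maximal function \<open>unit_ball_vol\<close> times c.\<close>

definition HLmax :: "('a::euclidean_space \<Rightarrow> ennreal) \<Rightarrow> 'a \<Rightarrow> ennreal" where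
  "HLmax f x = (SUP r\<in>{0<..}. ennreal ((1/r) ^ DIM('a)) * (\<integral>\<^sup>+y\<in>cball x r. f y \<partial>lebesgue))"

lemma HLmax_upper:
  fixes x :: "'a::euclidean_space"
  assumes "r > 0"
  shows "(\<integral>\<^sup>+y\<in>cball x r. f y \<partial>lebesgue) \<le> ennreal (r ^ DIM('a)) * HLmax f x"
proof -
  have "ennreal ((1/r) ^ DIM('a)) * (\<integral>\<^sup>+y\<in>cball x r. f y \<partial>lebesgue) \<le> HLmax f x"
    unfolding HLmax_def by (rule SUP_upper) (use assms in auto)
  from mult_left_mono[OF this, of "ennreal (r ^ DIM('a))"] show ?thesis
    using assms by (simp add: mult.assoc[symmetric] power_divide flip: ennreal_mult)
qed

text \<open>Vitali covering: each point of the level set is the centre of a ball over which f has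
  integral at least l r^d. Disjoint balls are selected whose 5-fold enlargements cover the level
  set, whence the factor 5^d in W. Bounding a measurable superset N spares the question whether
  \<open>HLmax f\<close> is measurable.\<close>

lemma HLmax_weak_type:
  fixes f :: "'a::euclidean_space \<Rightarrow> ennreal"
  assumes f: "f \<in> borel_measurable lebesgue" and lam: "l > 0"
  defines "W \<equiv> 5 ^ DIM('a) * unit_ball_vol (DIM('a))"
  obtains N where "N \<in> sets lebesgue" "{x. ennreal l < HLmax f x} \<subseteq> N"
    "emeasure lebesgue N \<le> ennreal (W / l) * (\<integral>\<^sup>+y. f y \<partial>lebesgue)"
proof (cases "(\<integral>\<^sup>+y. f y \<partial>lebesgue) = top")
  case True
  have "W / l > 0" using lam by (simp add: W_def)
  then show ?thesis using True by (intro that[of UNIV]) (auto simp: ennreal_mult_top)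
next
  case False
  then obtain I where I: "(\<integral>\<^sup>+y. f y \<partial>lebesgue) = ennreal I" "I \<ge> 0"
    by (cases "\<integral>\<^sup>+y. f y \<partial>lebesgue") auto
  define S where "S = {x. ennreal l < HLmax f x}"
  have "\<exists>r>0. ennreal (l * r ^ DIM('a)) \<le> (\<integral>\<^sup>+y\<in>cball x r. f y \<partial>lebesgue)" if "x \<in> S" for x
  proof -
    from that obtain r where r: "r > 0" "ennreal l < ennreal ((1/r) ^ DIM('a)) * (\<integral>\<^sup>+y\<in>cball x r. f y \<partial>lebesgue)"
      unfolding S_def HLmax_def by (auto simp: less_SUP_iff)
    have "ennreal (r ^ DIM('a)) * ennreal l \<le> ennreal (r ^ DIM('a)) * (ennreal ((1/r) ^ DIM('a)) * (\<integral>\<^sup>+y\<in>cball x r. f y \<partial>lebesgue))"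
      using r by (intro mult_left_mono) auto
    also have "\<dots> = (\<integral>\<^sup>+y\<in>cball x r. f y \<partial>lebesgue)"
      using r(1) by (simp add: mult.assoc[symmetric] power_divide flip: ennreal_mult)
    finally show ?thesis using r lam by (auto simp: ennreal_mult mult.commute)
  qed
  then obtain r where r: "\<And>x. x \<in> S \<Longrightarrow> r x > 0"
    "\<And>x. x \<in> S \<Longrightarrow> ennreal (l * r x ^ DIM('a)) \<le> (\<integral>\<^sup>+y\<in>cball x (r x). f y \<partial>lebesgue)"
    by metis
  \<comment> \<open>Vitali's lemma asks for bounded radii. For r > 1 one has l r \<le> l r^d \<le>
    I; here the finiteness of the integral enters.\<close>
  have bound: "r x \<le> max 1 (I / l)" if x: "x \<in> S" for x
  proof (cases "r x \<le> 1")
    case rx: False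
    have "ennreal (l * r x ^ DIM('a)) \<le> (\<integral>\<^sup>+y\<in>cball x (r x). f y \<partial>lebesgue)" by (rule r(2)[OF x])
    also have "\<dots> \<le> ennreal I"
      unfolding I(1)[symmetric] by (intro nn_integral_mono) (auto simp: indicator_def)
    finally have "l * r x ^ DIM('a) \<le> I" using I by simp
    moreover have "r x ^ 1 \<le> r x ^ DIM('a)" using rx by (intro power_increasing) auto
    ultimately have "l * r x \<le> I" using lam by (smt (verit) mult_left_mono power_one_right)
    then show ?thesis using lam by (simp add: field_simps le_max_iff_disj)
  qed simp
  have "S \<subseteq> (\<Union>x\<in>S. cball x (r x))" using r(1) by (meson UN_I centre_in_cball less_imp_le subsetI)
  from Vitali_covering_lemma_cballs[OF this, of "max 1 (I / l)"]
  obtain C where C: "countable C" "C \<subseteq> S" "pairwise (\<lambda>i j. disjnt (cball i (r i)) (cball j (r j))) C"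
      "S \<subseteq> (\<Union>i\<in>C. cball i (5 * r i))"
    using r(1) bound by (metis (lifting))
  \<comment> \<open>C is countable, possibly finite. Each \<open>C' n\<close> is empty or a
    singleton, so sums over all natural numbers cover both cases.\<close>
  define C' where "C' n = {i\<in>C. to_nat_on C i = n}" for n
  define A where "A n = (\<Union>i\<in>C' n. cball i (5 * r i))" for n
  define B where "B n = (\<Union>i\<in>C' n. cball i (r i))" for n
  have C'_cases: "C' n = {} \<or> (\<exists>i\<in>C. C' n = {i})" for n
    using inj_on_to_nat_on[OF C(1)] unfolding C'_def inj_on_def by blast
  have B_sets: "B n \<in> sets lebesgue" and A_sets: "A n \<in> sets lebesgue" for n
    using C'_cases[of n] by (auto simp: A_def B_def)
  have AB: "emeasure lebesgue (A n) \<le> ennreal (W / l) * (\<integral>\<^sup>+y\<in>B n. f y \<partial>lebesgue)" for n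
  proof (cases "C' n = {}")
    case True
    then show ?thesis by (simp add: A_def)
  next
    case False
    with C'_cases obtain i where i: "i \<in> C" "C' n = {i}" by blast
    then have ri: "r i > 0" using C(2) r(1) by auto
    have "emeasure lebesgue (A n) = ennreal (unit_ball_vol (DIM('a)) * (5 * r i) ^ DIM('a))"
      unfolding A_def i(2) using ri by (simp add: emeasure_cball)
    also have "\<dots> = ennreal (W / l) * ennreal (l * r i ^ DIM('a))"
      using ri lam by (simp add: W_def power_mult_distrib flip: ennreal_mult)
    also have "\<dots> \<le> ennreal (W / l) * (\<integral>\<^sup>+y\<in>B n. f y \<partial>lebesgue)"
      using r(2)[of i] i C(2) by (intro mult_left_mono) (auto simp: B_def)
    finally show ?thesis .
  qed
  have disj: "disjoint_family B"
    unfolding disjoint_family_on_def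
  proof (intro ballI impI)
    fix m n :: nat assume "m \<noteq> n"
    show "B m \<inter> B n = {}"
    proof (rule ccontr)
      assume "B m \<inter> B n \<noteq> {}"
      then obtain i j y where ij: "i \<in> C" "to_nat_on C i = m" "y \<in> cball i (r i)" "j \<in> C" "to_nat_on C j = n" "y \<in> cball j (r j)"
        unfolding B_def C'_def by blast
      with \<open>m \<noteq> n\<close> have "i \<noteq> j" by auto
      then show False using C(3) ij unfolding pairwise_def disjnt_def by blast
    qed
  qed
  show ?thesis
  proof (rule that[of "\<Union>n. A n"])
    show "{x. ennreal l < HLmax f x} \<subseteq> (\<Union>n. A n)"
      using C(4) unfolding S_def A_def C'_def by blast
    have "emeasure lebesgue (\<Union>n. A n) \<le> (\<Sum>n. emeasure lebesgue (A n))"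
      using A_sets by (intro emeasure_subadditive_countably) auto
    also have "\<dots> \<le> (\<Sum>n. ennreal (W / l) * (\<integral>\<^sup>+y\<in>B n. f y \<partial>lebesgue))"
      by (intro suminf_le AB) auto
    also have "\<dots> = ennreal (W / l) * (\<Sum>n. \<integral>\<^sup>+y\<in>B n. f y \<partial>lebesgue)" by simp
    also have "(\<Sum>n. \<integral>\<^sup>+y\<in>B n. f y \<partial>lebesgue) = (\<integral>\<^sup>+y. (\<Sum>n. f y * indicator (B n) y) \<partial>lebesgue)"
      using f B_sets by (intro nn_integral_suminf[symmetric] borel_measurable_times_ennreal borel_measurable_indicator) auto
    also have "\<dots> = (\<integral>\<^sup>+y. f y * indicator (\<Union>n. B n) y \<partial>lebesgue)"
      by (simp add: suminf_indicator[OF disj])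
    also have "\<dots> \<le> (\<integral>\<^sup>+y. f y \<partial>lebesgue)"
      by (intro nn_integral_mono) (auto simp: indicator_def)
    finally show "emeasure lebesgue (\<Union>n. A n) \<le> ennreal (W / l) * (\<integral>\<^sup>+y. f y \<partial>lebesgue)"
      by (simp add: mult_left_mono)
  qed (use A_sets in auto)
qed

lemma nn_integral_cball_const:
  fixes x :: "'a::euclidean_space"
  assumes "r > 0"
  shows "ennreal ((1/r) ^ DIM('a)) * (\<integral>\<^sup>+y\<in>cball x r. c \<partial>lebesgue) = ennreal (unit_ball_vol (DIM('a))) * c"
proof -
  have "ennreal ((1/r) ^ DIM('a)) * (\<integral>\<^sup>+y\<in>cball x r. c \<partial>lebesgue) =
      ennreal ((1/r) ^ DIM('a)) * (c * ennreal (unit_ball_vol (DIM('a)) * r ^ DIM('a)))"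
    using assms by (simp add: nn_integral_cmult_indicator emeasure_cball)
  also have "\<dots> = (ennreal ((1/r) ^ DIM('a)) * ennreal (unit_ball_vol (DIM('a)) * r ^ DIM('a))) * c"
    by (simp add: mult_ac)
  also have "ennreal ((1/r) ^ DIM('a)) * ennreal (unit_ball_vol (DIM('a)) * r ^ DIM('a)) = ennreal (unit_ball_vol (DIM('a)))"
    using assms by (simp add: power_divide flip: ennreal_mult)
  finally show ?thesis .
qed

lemma HLmax_le_add_const:
  fixes f g :: "'a::euclidean_space \<Rightarrow> ennreal"
  assumes g: "g \<in> borel_measurable lebesgue" and le: "\<And>y. f y \<le> g y + c"
  shows "HLmax f x \<le> HLmax g x + ennreal (unit_ball_vol (DIM('a))) * c"
  unfolding HLmax_def[of f]
proof (rule SUP_least)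
  fix r :: real assume r: "r \<in> {0<..}"
  have "(\<integral>\<^sup>+y\<in>cball x r. f y \<partial>lebesgue) \<le> (\<integral>\<^sup>+y. g y * indicator (cball x r) y + c * indicator (cball x r) y \<partial>lebesgue)"
    by (intro nn_integral_mono) (auto simp: indicator_def le)
  also have "\<dots> = (\<integral>\<^sup>+y\<in>cball x r. g y \<partial>lebesgue) + (\<integral>\<^sup>+y\<in>cball x r. c \<partial>lebesgue)"
    by (intro nn_integral_add borel_measurable_times_ennreal borel_measurable_indicator g) auto
  finally have "ennreal ((1/r) ^ DIM('a)) * (\<integral>\<^sup>+y\<in>cball x r. f y \<partial>lebesgue) \<le>
     ennreal ((1/r) ^ DIM('a)) * ((\<integral>\<^sup>+y\<in>cball x r. g y \<partial>lebesgue) + (\<integral>\<^sup>+y\<in>cball x r. c \<partial>lebesgue))"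
    by (rule mult_left_mono) simp
  also have "\<dots> = ennreal ((1/r) ^ DIM('a)) * (\<integral>\<^sup>+y\<in>cball x r. g y \<partial>lebesgue) + ennreal (unit_ball_vol (DIM('a))) * c"
    using r by (simp only: distrib_left nn_integral_cball_const greaterThan_iff)
  also have "\<dots> \<le> HLmax g x + ennreal (unit_ball_vol (DIM('a))) * c"
    unfolding HLmax_def by (intro add_right_mono SUP_upper r)
  finally show "ennreal ((1/r) ^ DIM('a)) * (\<integral>\<^sup>+y\<in>cball x r. f y \<partial>lebesgue) \<le> HLmax g x + ennreal (unit_ball_vol (DIM('a))) * c" .
qed

lemma le_suminf_ennreal: "f k \<le> (\<Sum>n. f n)" for f :: "nat \<Rightarrow> ennreal"
  using sum_le_suminf[of f "{k}"] by simp

text \<open>A decomposition into layers: E n has measure at most q^(-n) t, and outside E (n+1) the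
  function f is at most \<open>nrearr f\<close> at q^(-n-1) t. Up to the null set common to all E n,
  the differences of consecutive layers exhaust E 0 and give the terms of the Hardy sum.\<close>

lemma nn_integral_above_nrearr:
  fixes f :: "'a::euclidean_space \<Rightarrow> ennreal"
  assumes f: "f \<in> borel_measurable lebesgue" and q: "q > 1" and t: "t \<ge> 0"
  shows "(\<integral>\<^sup>+y\<in>{y. nrearr f t < f y}. f y \<partial>lebesgue) \<le> ennreal t * hardy_sum q (nrearr f) t"
proof -
  define E where "E n = {y. nrearr f ((1/q)^n * t) < f y}" for n
  have E_sets [measurable]: "E n \<in> sets lebesgue" for n
    unfolding E_def by (rule sets_lebesgue_superlevel[OF f])
  have E_meas: "emeasure lebesgue (E n) \<le> ennreal ((1/q)^n * t)" for n
    unfolding E_def by (rule emeasure_nrearr_level[OF f])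
  have "emeasure lebesgue (\<Inter>n. E n) \<le> ennreal 0"
  proof (rule tendsto_lowerbound)
    have "(\<lambda>n. (1/q)^n * t) \<longlonglongrightarrow> 0 * t"
      using q by (intro tendsto_intros LIMSEQ_realpow_zero) auto
    then show "(\<lambda>n. ennreal ((1/q)^n * t)) \<longlonglongrightarrow> ennreal 0" by (intro tendsto_ennrealI) simp
    show "\<forall>\<^sub>F n in sequentially. emeasure lebesgue (\<Inter>n. E n) \<le> ennreal ((1/q)^n * t)"
    proof (intro always_eventually allI)
      fix n
      have "emeasure lebesgue (\<Inter>n. E n) \<le> emeasure lebesgue (E n)"
        by (intro emeasure_mono) auto
      then show "emeasure lebesgue (\<Inter>n. E n) \<le> ennreal ((1/q)^n * t)" using E_meas[of n] by simp
    qed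
  qed simp
  then have "(\<Inter>n. E n) \<in> null_sets lebesgue" by auto
  then have AE: "AE y in lebesgue. y \<notin> (\<Inter>n. E n)" by (rule AE_not_in)
  have "(\<integral>\<^sup>+y\<in>{y. nrearr f t < f y}. f y \<partial>lebesgue) \<le> (\<integral>\<^sup>+y. (\<Sum>n. nrearr f ((1/q)^Suc n * t) * indicator (E n) y) \<partial>lebesgue)"
  proof (rule nn_integral_mono_AE, use AE in eventually_elim)
    fix y assume y: "y \<notin> (\<Inter>n. E n)"
    show "f y * indicator {y. nrearr f t < f y} y \<le> (\<Sum>n. nrearr f ((1/q)^Suc n * t) * indicator (E n) y)"
    proof (cases "y \<in> E 0")
      case True
      \<comment> \<open>The first layer that misses y. Since y lies in E 0, m is a successor and y
        belongs to the layer before it.\<close>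
      define m where "m = (LEAST n. y \<notin> E n)"
      have m: "y \<notin> E m" unfolding m_def by (rule LeastI_ex) (use y in auto)
      then obtain k where k: "m = Suc k" using True by (cases m) auto
      then have "y \<in> E k" unfolding m_def using not_less_Least by (metis lessI)
      moreover have "f y \<le> nrearr f ((1/q)^Suc k * t)" using m unfolding k E_def by simp
      ultimately have "f y \<le> nrearr f ((1/q)^Suc k * t) * indicator (E k) y" by simp
      also have "\<dots> \<le> (\<Sum>n. nrearr f ((1/q)^Suc n * t) * indicator (E n) y)"
        by (rule le_suminf_ennreal)
      finally show ?thesis by (auto simp: indicator_def)
    qed (simp add: E_def)
  qed
  also have "\<dots> = (\<Sum>n. nrearr f ((1/q)^Suc n * t) * emeasure lebesgue (E n))"
    by (subst nn_integral_suminf) (auto simp: nn_integral_cmult_indicator)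
  also have "\<dots> \<le> (\<Sum>n. ennreal t * (ennreal ((1/q)^n) * nrearr f ((1/q)^Suc n * t)))"
  proof (intro suminf_le)
    fix n
    have "nrearr f ((1/q)^Suc n * t) * emeasure lebesgue (E n) \<le> nrearr f ((1/q)^Suc n * t) * ennreal ((1/q)^n * t)"
      by (intro mult_left_mono E_meas) simp
    also have "\<dots> = ennreal t * (ennreal ((1/q)^n) * nrearr f ((1/q)^Suc n * t))"
      using q t by (simp add: ennreal_mult mult_ac)
    finally show "nrearr f ((1/q)^Suc n * t) * emeasure lebesgue (E n) \<le> \<dots>" .
  qed auto
  also have "\<dots> = ennreal t * hardy_sum q (nrearr f) t"
    by (simp add: hardy_sum_def)
  finally show ?thesis .
qed

text \<open>The power 5^d belongs to the weak type inequality for the part of f above the splitting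
  level, the summand 1 to the bounded part below it.\<close>

definition HLconst :: "'a::euclidean_space itself \<Rightarrow> real" where
  "HLconst _ = (5 ^ DIM('a) + 1) * unit_ball_vol (DIM('a))"

lemma HLconst_pos: "HLconst TYPE('a::euclidean_space) > 0"
  unfolding HLconst_def by (intro mult_pos_pos) (auto intro: add_pos_pos)

text \<open>Herz's estimate of the rearrangement of the maximal function: split \<open>f\<close> at the level
  \<open>f\<^sup>*(t)\<close> and apply the weak type inequality to the upper part.\<close>

lemma HLmax_nrearr:
  fixes f :: "'a::euclidean_space \<Rightarrow> ennreal"
  assumes f: "f \<in> borel_measurable lebesgue" and q: "q > 1" and t: "t > 0"
    and a: "hardy_sum q (nrearr f) t < ennreal a"
  obtains N where "N \<in> sets lebesgue" "{x. ennreal (HLconst TYPE('a) * a) < HLmax f x} \<subseteq> N"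
    "emeasure lebesgue N \<le> ennreal t"
proof -
  let ?v = "unit_ball_vol (DIM('a))"
  define W where "W = 5 ^ DIM('a) * ?v"
  have a0: "a > 0" using a by (metis ennreal_neg leI not_less_zero)
  have W: "W > 0" unfolding W_def by simp
  have "(1/q) ^ Suc 0 * t \<le> t" using q t by (simp add: field_simps)
  then have "nrearr f t \<le> nrearr f ((1/q) ^ Suc 0 * t)" by (rule nrearr_antimono)
  also have "\<dots> \<le> hardy_sum q (nrearr f) t"
    unfolding hardy_sum_def
    using le_suminf_ennreal[of "\<lambda>n. ennreal ((1/q)^n) * nrearr f ((1/q)^Suc n * t)" 0] by simp
  finally have phi: "nrearr f t \<le> ennreal a" using a by simp
  define g where "g y = f y * indicator {y. nrearr f t < f y} y" for y
  have g: "g \<in> borel_measurable lebesgue"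
    unfolding g_def[abs_def] by (intro borel_measurable_times_ennreal borel_measurable_indicator sets_lebesgue_superlevel f)
  have le: "HLmax f x \<le> HLmax g x + ennreal ?v * nrearr f t" for x
    by (rule HLmax_le_add_const[OF g]) (auto simp: g_def indicator_def not_less)
  \<comment> \<open>At level W a the weak type bound is 1/a times the integral of g, which is at
    most t a; so the exceptional set has measure at most t. The remaining part of the level,
    \<open>?v\<close> times a, absorbs the values of f below the splitting level.\<close>
  have "W * a > 0" using W a0 by simp
  from HLmax_weak_type[OF g this] obtain N where N: "N \<in> sets lebesgue" "{x. ennreal (W * a) < HLmax g x} \<subseteq> N"
    "emeasure lebesgue N \<le> ennreal (W / (W * a)) * (\<integral>\<^sup>+y. g y \<partial>lebesgue)"
    unfolding W_def by blast
  show thesis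
  proof (rule that[OF N(1)])
    show "{x. ennreal (HLconst TYPE('a) * a) < HLmax f x} \<subseteq> N"
    proof
      fix x assume "x \<in> {x. ennreal (HLconst TYPE('a) * a) < HLmax f x}"
      then have "ennreal (HLconst TYPE('a) * a) < HLmax g x + ennreal ?v * ennreal a"
        using le[of x] add_left_mono[OF mult_left_mono[OF phi, of "ennreal ?v"], of "HLmax g x"]
        by (auto elim!: less_le_trans intro: order_trans)
      also have "ennreal (HLconst TYPE('a) * a) = ennreal (W * a) + ennreal ?v * ennreal a"
        using a0 W by (simp add: HLconst_def W_def algebra_simps flip: ennreal_mult ennreal_plus)
      finally have "ennreal (W * a) < HLmax g x"
        by (metis add_right_mono linorder_not_less)
      then show "x \<in> N" using N(2) by auto
    qed
    have "(\<integral>\<^sup>+y. g y \<partial>lebesgue) \<le> ennreal t * ennreal a"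
      using nn_integral_above_nrearr[OF f q, of t] t a unfolding g_def
      by (auto elim!: order_trans intro!: mult_left_mono)
    then have "ennreal (W / (W * a)) * (\<integral>\<^sup>+y. g y \<partial>lebesgue) \<le> ennreal (W / (W * a)) * (ennreal t * ennreal a)"
      by (intro mult_left_mono) auto
    also have "\<dots> = ennreal t" using W a0 t by (simp flip: ennreal_mult)
    finally show "emeasure lebesgue N \<le> ennreal t" using N(3) by simp
  qed
qed

section \<open>The Lebesgue differentiation theorem\<close>

definition osc :: "('a::euclidean_space \<Rightarrow> real) \<Rightarrow> 'a \<Rightarrow> real \<Rightarrow> ennreal" where
  "osc f x r = ennreal ((1/r) ^ DIM('a)) * (\<integral>\<^sup>+y\<in>cball x r. ennreal \<bar>f y - f x\<bar> \<partial>lebesgue)"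

definition lebesgue_point :: "('a::euclidean_space \<Rightarrow> real) \<Rightarrow> 'a \<Rightarrow> bool" where
  "lebesgue_point f x \<longleftrightarrow> (\<forall>e>0. \<exists>\<delta>>0. \<forall>r. 0 < r \<and> r < \<delta> \<longrightarrow> osc f x r \<le> ennreal e)"

lemma osc_triangle:
  fixes f g h :: "'a::euclidean_space \<Rightarrow> real"
  assumes g: "g \<in> borel_measurable lebesgue" and h: "h \<in> borel_measurable lebesgue"
    and le: "\<And>y. \<bar>f y - f x\<bar> \<le> \<bar>g y - g x\<bar> + \<bar>h y - h x\<bar>"
  shows "osc f x r \<le> osc g x r + osc h x r"
proof -
  have "(\<integral>\<^sup>+y\<in>cball x r. ennreal \<bar>f y - f x\<bar> \<partial>lebesgue) \<le>
      (\<integral>\<^sup>+y. ennreal \<bar>g y - g x\<bar> * indicator (cball x r) y + ennreal \<bar>h y - h x\<bar> * indicator (cball x r) y \<partial>lebesgue)"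
    by (intro nn_integral_mono) (auto simp: indicator_def le ennreal_leI simp flip: ennreal_plus)
  also have "\<dots> = (\<integral>\<^sup>+y\<in>cball x r. ennreal \<bar>g y - g x\<bar> \<partial>lebesgue) + (\<integral>\<^sup>+y\<in>cball x r. ennreal \<bar>h y - h x\<bar> \<partial>lebesgue)"
    using g h by (intro nn_integral_add borel_measurable_times_ennreal borel_measurable_indicator) auto
  finally show ?thesis
    unfolding osc_def distrib_left[symmetric] by (intro mult_left_mono) auto
qed

lemma lebesgue_point_add:
  assumes "f \<in> borel_measurable lebesgue" "g \<in> borel_measurable lebesgue" "lebesgue_point f x" "lebesgue_point g x"
  shows "lebesgue_point (\<lambda>y. f y + g y) x"
  unfolding lebesgue_point_def
proof (intro allI impI)
  fix e :: real assume e: "e > 0"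
  from assms(3) e obtain d1 where d1: "d1 > 0" "\<And>r. 0 < r \<Longrightarrow> r < d1 \<Longrightarrow> osc f x r \<le> ennreal (e/2)"
    unfolding lebesgue_point_def by (metis half_gt_zero)
  from assms(4) e obtain d2 where d2: "d2 > 0" "\<And>r. 0 < r \<Longrightarrow> r < d2 \<Longrightarrow> osc g x r \<le> ennreal (e/2)"
    unfolding lebesgue_point_def by (metis half_gt_zero)
  have "osc (\<lambda>y. f y + g y) x r \<le> ennreal e" if "0 < r" "r < min d1 d2" for r
  proof -
    have "osc (\<lambda>y. f y + g y) x r \<le> osc f x r + osc g x r"
      by (rule osc_triangle[OF assms(1,2)]) linarith
    also have "\<dots> \<le> ennreal (e/2) + ennreal (e/2)"
      using that by (intro add_mono d1 d2) auto
    also have "\<dots> = ennreal e" using e by (simp flip: ennreal_plus)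
    finally show ?thesis .
  qed
  then show "\<exists>\<delta>>0. \<forall>r. 0 < r \<and> r < \<delta> \<longrightarrow> osc (\<lambda>y. f y + g y) x r \<le> ennreal e"
    using d1(1) d2(1) by (intro exI[of _ "min d1 d2"]) auto
qed

lemma lebesgue_point_continuous:
  fixes f :: "'a::euclidean_space \<Rightarrow> real"
  assumes "continuous_on UNIV f"
  shows "lebesgue_point f x"
  unfolding lebesgue_point_def
proof (intro allI impI)
  fix e :: real assume e: "e > 0"
  let ?v = "unit_ball_vol (DIM('a))"
  have v: "?v > 0" by simp
  have "isCont f x" using assms by (simp add: continuous_on_eq_continuous_at)
  then obtain \<delta> where \<delta>: "\<delta> > 0" "\<And>y. dist y x < \<delta> \<Longrightarrow> dist (f y) (f x) < e / ?v"
    unfolding continuous_at_eps_delta using e v by (metis divide_pos_pos)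
  have "osc f x r \<le> ennreal e" if r: "0 < r" "r < \<delta>" for r
  proof -
    have "(\<integral>\<^sup>+y\<in>cball x r. ennreal \<bar>f y - f x\<bar> \<partial>lebesgue) \<le> (\<integral>\<^sup>+y\<in>cball x r. ennreal (e / ?v) \<partial>lebesgue)"
    proof (intro nn_integral_mono)
      fix y
      show "ennreal \<bar>f y - f x\<bar> * indicator (cball x r) y \<le> ennreal (e / ?v) * indicator (cball x r) y"
        using \<delta>(2)[of y] r by (cases "y \<in> cball x r") (auto simp: dist_real_def dist_commute intro!: ennreal_leI)
    qed
    then have "osc f x r \<le> ennreal ((1/r) ^ DIM('a)) * (\<integral>\<^sup>+y\<in>cball x r. ennreal (e / ?v) \<partial>lebesgue)"
      unfolding osc_def by (intro mult_left_mono) auto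
    also have "\<dots> = ennreal ?v * ennreal (e / ?v)" by (rule nn_integral_cball_const[OF r(1)])
    also have "\<dots> = ennreal e" using less_imp_neq[OF v] e by (simp flip: ennreal_mult)
    finally show ?thesis .
  qed
  then show "\<exists>\<delta>>0. \<forall>r. 0 < r \<and> r < \<delta> \<longrightarrow> osc f x r \<le> ennreal e" using \<delta>(1) by blast
qed

text \<open>A density argument: the oscillation of f is at most that of g plus the maximal function
  of f - g plus a multiple of |f - g| at x. The last two are small off a set of small measure, by
  the weak type inequality and by Markov's inequality. Of g only Lebesgue points almost everywhere
  are asked, so the lemma also carries the property through limits of simple functions.\<close>

lemma AE_lebesgue_point_approx:
  fixes f :: "'a::euclidean_space \<Rightarrow> real"
  assumes f: "f \<in> borel_measurable lebesgue"
    and approx: "\<And>e. e > 0 \<Longrightarrow> \<exists>g. g \<in> borel_measurable lebesgue \<and> (AE x in lebesgue. lebesgue_point g x) \<and>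
      (\<integral>\<^sup>+y. ennreal \<bar>f y - g y\<bar> \<partial>lebesgue) \<le> ennreal e"
  shows "AE x in lebesgue. lebesgue_point f x"
proof -
  let ?v = "unit_ball_vol (DIM('a))"
  define W where "W = 5 ^ DIM('a) * ?v"
  have W: "W > 0" unfolding W_def by simp
  have v: "?v > 0" by simp
  define P where "P e x \<longleftrightarrow> (\<exists>\<delta>>0. \<forall>r. 0 < r \<and> r < \<delta> \<longrightarrow> osc f x r \<le> ennreal e)" for e x
  \<comment> \<open>The three contributions, from g, from the maximal function of f - g and from the
    value of f - g at x, are at most e each.\<close>
  have key: "AE x in lebesgue. P (3 * e) x" if e: "e > 0" for e
  proof -
    have "negligible {x. \<not> P (3 * e) x}"
      unfolding negligible_outer_le
    proof (intro allI impI)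
      fix \<eta> :: real assume eta: "\<eta> > 0"
      \<comment> \<open>Chosen so that the bounds for the measures of N1 and N2 add up to exactly
        \<eta>.\<close>
      define \<epsilon> where "\<epsilon> = \<eta> / (W / e + ?v / e)"
      have We: "W / e + ?v / e > 0" using W v e by (intro add_pos_pos) auto
      then have eps: "\<epsilon> > 0" unfolding \<epsilon>_def using eta by simp
      from approx[OF this] obtain g where g: "g \<in> borel_measurable lebesgue" "AE x in lebesgue. lebesgue_point g x"
        and fg: "(\<integral>\<^sup>+y. ennreal \<bar>f y - g y\<bar> \<partial>lebesgue) \<le> ennreal \<epsilon>" by blast
      let ?h = "\<lambda>y. f y - g y"
      have h: "?h \<in> borel_measurable lebesgue" using f g(1) by simp
      have h': "(\<lambda>y. ennreal \<bar>?h y\<bar>) \<in> borel_measurable lebesgue" using h by simp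
      from g(2) obtain N0 where N0: "N0 \<in> null_sets lebesgue" "{x. \<not> lebesgue_point g x} \<subseteq> N0"
        by (auto simp: eventually_ae_filter)
      from HLmax_weak_type[OF h' e] obtain N1 where N1: "N1 \<in> sets lebesgue"
        "{x. ennreal e < HLmax (\<lambda>y. ennreal \<bar>?h y\<bar>) x} \<subseteq> N1"
        "emeasure lebesgue N1 \<le> ennreal (W / e) * (\<integral>\<^sup>+y. ennreal \<bar>?h y\<bar> \<partial>lebesgue)"
        unfolding W_def by blast
      define N2 where "N2 = {x. 1 \<le> ennreal (?v / e) * ennreal \<bar>?h x\<bar>}"
      have "N2 \<in> sets lebesgue"
      proof -
        have "{x \<in> space lebesgue. 1 \<le> ennreal (?v / e) * ennreal \<bar>?h x\<bar>} \<in> sets lebesgue"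
          using h' by measurable
        then show ?thesis by (simp add: N2_def)
      qed
      note N2s = this
      have N2: "emeasure lebesgue N2 \<le> ennreal (?v / e) * (\<integral>\<^sup>+y. ennreal \<bar>?h y\<bar> \<partial>lebesgue)"
        using nn_integral_Markov_inequality[of "\<lambda>y. ennreal \<bar>?h y\<bar>" UNIV lebesgue "ennreal (?v / e)"] h'
        by (simp add: N2_def)
      let ?T = "N0 \<union> (N1 \<union> N2)"
      have "emeasure lebesgue ?T \<le> emeasure lebesgue N0 + (emeasure lebesgue N1 + emeasure lebesgue N2)"
        using N0 N1(1) N2s
        by (intro order_trans[OF emeasure_subadditive] add_left_mono emeasure_subadditive) auto
      also have "\<dots> \<le> 0 + (ennreal (W / e) * ennreal \<epsilon> + ennreal (?v / e) * ennreal \<epsilon>)"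
      proof (intro add_mono)
        show "emeasure lebesgue N0 \<le> 0" using N0 by auto
        show "emeasure lebesgue N1 \<le> ennreal (W / e) * ennreal \<epsilon>"
          using N1(3) mult_left_mono[OF fg, of "ennreal (W / e)"] by (auto elim: order_trans)
        show "emeasure lebesgue N2 \<le> ennreal (?v / e) * ennreal \<epsilon>"
          using N2 mult_left_mono[OF fg, of "ennreal (?v / e)"] by (auto elim: order_trans)
      qed
      also have "\<dots> = ennreal ((W / e + ?v / e) * \<epsilon>)"
        using W v e eps by (simp add: distrib_right flip: ennreal_mult ennreal_plus)
      also have "\<dots> = ennreal \<eta>" unfolding \<epsilon>_def using We by simp
      finally have T: "emeasure lebesgue ?T \<le> ennreal \<eta>" .
      have "{x. \<not> P (3 * e) x} \<subseteq> ?T"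
      proof (rule subsetI, rule ccontr)
        fix x assume x: "x \<in> {x. \<not> P (3 * e) x}" "x \<notin> ?T"
        then have lp: "lebesgue_point g x" and M: "HLmax (\<lambda>y. ennreal \<bar>?h y\<bar>) x \<le> ennreal e"
          using N0(2) N1(2) by (force simp: not_less)+
        from x have "ennreal (?v / e) * ennreal \<bar>?h x\<bar> < 1" by (auto simp: N2_def)
        moreover have "ennreal (?v / e) * ennreal \<bar>?h x\<bar> = ennreal (?v / e * \<bar>?h x\<bar>)"
          using v e by (intro ennreal_mult[symmetric]) auto
        ultimately have "?v / e * \<bar>?h x\<bar> < 1" 
          by (metis ennreal_1 ennreal_leI not_le)
        then have hx: "?v * \<bar>?h x\<bar> \<le> e" using e by (simp add: field_simps)
        from lp e obtain \<delta> where \<delta>: "\<delta> > 0" "\<And>r. 0 < r \<Longrightarrow> r < \<delta> \<Longrightarrow> osc g x r \<le> ennreal e"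
          unfolding lebesgue_point_def by blast
        have "osc f x r \<le> ennreal (3 * e)" if r: "0 < r" "r < \<delta>" for r
        proof -
          have "osc f x r \<le> osc g x r + osc ?h x r"
            by (rule osc_triangle[OF g(1) h]) linarith
          also have "osc ?h x r \<le> HLmax (\<lambda>y. ennreal \<bar>?h y - ?h x\<bar>) x"
            unfolding osc_def HLmax_def using r by (intro SUP_upper) auto
          also have "\<dots> \<le> HLmax (\<lambda>y. ennreal \<bar>?h y\<bar>) x + ennreal ?v * ennreal \<bar>?h x\<bar>"
            by (rule HLmax_le_add_const[OF h']) (simp flip: ennreal_plus)
          also have "\<dots> \<le> ennreal e + ennreal e"
            using hx by (intro add_mono M) (auto simp: ennreal_leI simp flip: ennreal_mult)
          also have "osc g x r \<le> ennreal e" using \<delta>(2) r by blast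
          finally show ?thesis using e by (simp flip: ennreal_plus)
        qed
        then have "P (3 * e) x" unfolding P_def using \<delta>(1) by blast
        with x show False by simp
      qed
      moreover have Ts: "?T \<in> sets lebesgue" using N0 N1(1) N2s by auto
      moreover have "?T \<in> lmeasurable" "measure lebesgue ?T \<le> \<eta>"
        using T Ts eta by (auto simp: fmeasurable_def measure_def enn2real_leI intro: le_less_trans)
      ultimately show "\<exists>T. {x. \<not> P (3 * e) x} \<subseteq> T \<and> T \<in> lmeasurable \<and> measure lebesgue T \<le> \<eta>"
        by blast
    qed
    then have "{x. \<not> P (3 * e) x} \<in> null_sets lebesgue" by (simp add: negligible_iff_null_sets)
    then show ?thesis by (rule AE_I') auto
  qed
  have "AE x in lebesgue. \<forall>n::nat. P (3 * (1 / real (Suc n))) x"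
    by (subst AE_all_countable) (intro allI key, simp)
  then show ?thesis
  proof eventually_elim
    fix x assume x: "\<forall>n::nat. P (3 * (1 / real (Suc n))) x"
    show "lebesgue_point f x"
      unfolding lebesgue_point_def
    proof (intro allI impI)
      fix e :: real assume e: "e > 0"
      then obtain n where "1 / real (Suc n) < e / 3"
        using nat_approx_posE[of "e/3"] by auto
      then have le: "3 * (1 / real (Suc n)) \<le> e" by simp
      from x obtain \<delta> where "\<delta> > 0" "\<And>r. 0 < r \<and> r < \<delta> \<Longrightarrow> osc f x r \<le> ennreal (3 * (1 / real (Suc n)))"
        unfolding P_def by blast
      then show "\<exists>\<delta>>0. \<forall>r. 0 < r \<and> r < \<delta> \<longrightarrow> osc f x r \<le> ennreal e"
        using ennreal_leI[OF le] by (meson order_trans)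
    qed
  qed
qed

text \<open>Regularity puts A between a closed T and an open U with U - A and A - T of measure below
  d. A Urysohn function equal to 1 on T and 0 off U differs from the indicator only on these two
  sets, and by at most 1.\<close>

lemma AE_lebesgue_point_indicator:
  fixes A :: "'a::euclidean_space set" and c :: real
  assumes A: "A \<in> sets lebesgue"
  shows "AE x in lebesgue. lebesgue_point (\<lambda>x. indicator A x *\<^sub>R c) x"
proof (rule AE_lebesgue_point_approx)
  show "(\<lambda>x. indicator A x *\<^sub>R c) \<in> borel_measurable lebesgue"
    using A by (intro borel_measurable_scaleR borel_measurable_indicator) auto
  fix e :: real assume e: "e > 0"
  define d where "d = e / (2 * (\<bar>c\<bar> + 1))"
  have d: "d > 0" unfolding d_def using e by (simp add: field_simps)
  have dc: "\<bar>c\<bar> * (2 * d) \<le> e" unfolding d_def using e by (simp add: field_simps)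
  obtain U where U: "open U" "A \<subseteq> U" "emeasure lebesgue (U - A) < ennreal d" "U - A \<in> sets lebesgue"
    using sets_lebesgue_outer_open[OF A d] by (metis fmeasurableD)
  obtain T where T: "closed T" "T \<subseteq> A" "emeasure lebesgue (A - T) < ennreal d" "A - T \<in> sets lebesgue"
    using sets_lebesgue_inner_closed[OF A d] by (metis fmeasurableD)
  obtain g :: "'a \<Rightarrow> real" where g: "continuous_on UNIV g" "\<And>x. g x \<in> closed_segment 1 0"
    "\<And>x. x \<in> T \<Longrightarrow> g x = 1" "\<And>x. x \<in> - U \<Longrightarrow> g x = 0"
    using Urysohn[of T "- U" 1 "0::real"] T U by blast
  have gc: "continuous_on UNIV (\<lambda>x. g x * c)" by (intro continuous_intros g)
  have "(\<integral>\<^sup>+y. ennreal \<bar>indicator A y *\<^sub>R c - g y * c\<bar> \<partial>lebesgue) \<le>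
     (\<integral>\<^sup>+y. ennreal \<bar>c\<bar> * indicator (U - A) y + ennreal \<bar>c\<bar> * indicator (A - T) y \<partial>lebesgue)"
  proof (intro nn_integral_mono)
    fix y
    have "g y \<in> {0..1}" using g(2)[of y] by (simp add: closed_segment_eq_real_ivl)
    then have "\<bar>c\<bar> * g y \<le> \<bar>c\<bar>" "\<bar>c\<bar> * (1 - g y) \<le> \<bar>c\<bar>" "0 \<le> g y" "g y \<le> 1" by (auto simp: mult_left_le)
    moreover have "\<bar>c - g y * c\<bar> = \<bar>c\<bar> * (1 - g y)" if "g y \<le> 1"
      using that abs_mult[of c "1 - g y"] by (simp add: algebra_simps)
    ultimately show "ennreal \<bar>indicator A y *\<^sub>R c - g y * c\<bar> \<le> ennreal \<bar>c\<bar> * indicator (U - A) y + ennreal \<bar>c\<bar> * indicator (A - T) y"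
      using g(3)[of y] g(4)[of y] U(2) T(2)
      by (cases "y \<in> A"; cases "y \<in> U"; cases "y \<in> T") (auto simp: abs_mult mult.commute intro!: ennreal_leI)
  qed
  also have "\<dots> = ennreal \<bar>c\<bar> * emeasure lebesgue (U - A) + ennreal \<bar>c\<bar> * emeasure lebesgue (A - T)"
    using U(4) T(4) by (subst nn_integral_add)
      (auto simp: nn_integral_cmult_indicator intro!: borel_measurable_times_ennreal borel_measurable_indicator)
  also have "\<dots> \<le> ennreal \<bar>c\<bar> * ennreal d + ennreal \<bar>c\<bar> * ennreal d"
    using U(3) T(3) by (intro add_mono mult_left_mono) auto
  also have "\<dots> = ennreal (\<bar>c\<bar> * (2 * d))" using d by (simp flip: ennreal_mult ennreal_plus)
  also have "\<dots> \<le> ennreal e" by (intro ennreal_leI dc)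
  finally have "(\<integral>\<^sup>+y. ennreal \<bar>indicator A y *\<^sub>R c - g y * c\<bar> \<partial>lebesgue) \<le> ennreal e" .
  then show "\<exists>g. g \<in> borel_measurable lebesgue \<and> (AE x in lebesgue. lebesgue_point g x) \<and>
      (\<integral>\<^sup>+y. ennreal \<bar>indicator A y *\<^sub>R c - g y\<bar> \<partial>lebesgue) \<le> ennreal e"
    using gc lebesgue_point_continuous[OF gc]
    by (intro exI[of _ "\<lambda>x. g x * c"]) (auto intro: measurable_lebesgue_if_borel borel_measurable_continuous_onI)
qed

lemma AE_lebesgue_point_integrable:
  fixes f :: "'a::euclidean_space \<Rightarrow> real"
  assumes "integrable lebesgue f"
  shows "AE x in lebesgue. lebesgue_point f x"
  using assms
proof (induction rule: integrable_induct)
  case (base A c)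
  then show ?case by (intro AE_lebesgue_point_indicator)
next
  case (add f g)
  from add(3,4) show ?case
    by eventually_elim (use add(1,2) in \<open>auto intro: lebesgue_point_add\<close>)
next
  case (lim f s)
  have "(\<lambda>i. \<integral>\<^sup>+y. ennreal (norm (f y - s i y)) \<partial>lebesgue) \<longlonglongrightarrow> 0"
  proof (rule nn_integral_dominated_convergence_norm[where w="\<lambda>y. 2 * norm (f y)"])
    show "AE y in lebesgue. norm (s i y) \<le> 2 * norm (f y)" for i using lim(3) by auto
    show "AE y in lebesgue. (\<lambda>i. s i y) \<longlonglongrightarrow> f y" using lim(2) by auto
    show "(\<integral>\<^sup>+y. ennreal (2 * norm (f y)) \<partial>lebesgue) < \<infinity>"
      using lim(4) integrable_iff_bounded[of lebesgue "\<lambda>y. 2 * norm (f y)"] by auto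
  qed (use lim in auto)
  note conv = this
  show ?case
  proof (rule AE_lebesgue_point_approx)
    fix e :: real assume e: "e > 0"
    have "eventually (\<lambda>i. (\<integral>\<^sup>+y. ennreal (norm (f y - s i y)) \<partial>lebesgue) < ennreal e) sequentially"
      using e by (intro order_tendstoD(2)[OF conv]) auto
    then obtain i where "(\<integral>\<^sup>+y. ennreal (norm (f y - s i y)) \<partial>lebesgue) < ennreal e"
      by (auto simp: eventually_sequentially)
    then have "(\<integral>\<^sup>+y. ennreal \<bar>f y - s i y\<bar> \<partial>lebesgue) \<le> ennreal e"
      by simp
    then show "\<exists>g. g \<in> borel_measurable lebesgue \<and> (AE x in lebesgue. lebesgue_point g x) \<and>
      (\<integral>\<^sup>+y. ennreal \<bar>f y - g y\<bar> \<partial>lebesgue) \<le> ennreal e"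
      using lim by (intro exI[of _ "s i"]) auto
  qed (use lim in auto)
qed

text \<open>Being a Lebesgue point is a local property: near x, f agrees with its cut-off to a large
  ball, which is integrable.\<close>

lemma AE_lebesgue_point_locint:
  assumes "locint f"
  shows "AE x in lebesgue. lebesgue_point f x"
proof -
  have "AE x in lebesgue. \<forall>n::nat. lebesgue_point (\<lambda>x. indicator (cball 0 (real n)) x *\<^sub>R f x) x"
    unfolding AE_all_countable
  proof
    fix n :: nat
    have "integrable lebesgue (\<lambda>x. indicator (cball 0 (real n)) x *\<^sub>R f x)"
      using assms[unfolded locint_def, rule_format, OF compact_cball] by (simp only: set_integrable_def)
    then show "AE x in lebesgue. lebesgue_point (\<lambda>x. indicator (cball 0 (real n)) x *\<^sub>R f x) x"
      by (rule AE_lebesgue_point_integrable)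
  qed
  then show ?thesis
  proof eventually_elim
    fix x assume x: "\<forall>n::nat. lebesgue_point (\<lambda>x. indicator (cball 0 (real n)) x *\<^sub>R f x) x"
    obtain n :: nat where n: "norm x + 1 \<le> real n" using real_arch_simple by blast
    let ?g = "\<lambda>x. indicator (cball 0 (real n)) x *\<^sub>R f x"
    have eq: "osc ?g x r = osc f x r" if "r < 1" for r
    proof -
      have "norm y \<le> real n" if "y \<in> cball x r" for y
      proof -
        have "norm y \<le> norm x + norm (y - x)" by (rule norm_triangle_sub)
        also have "norm (y - x) \<le> r" using that by (simp add: dist_norm norm_minus_commute)
        finally show ?thesis using n \<open>r < 1\<close> by simp
      qed
      moreover have "norm x \<le> real n" using n by simp
      ultimately have "ennreal \<bar>?g y - ?g x\<bar> * indicator (cball x r) y = ennreal \<bar>f y - f x\<bar> * indicator (cball x r) y" for y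
        by (auto simp: indicator_def)
      then show ?thesis unfolding osc_def by simp
    qed
    show "lebesgue_point f x"
      unfolding lebesgue_point_def
    proof (intro allI impI)
      fix e :: real assume "e > 0"
      then obtain \<delta> where "\<delta> > 0" "\<And>r. 0 < r \<and> r < \<delta> \<Longrightarrow> osc ?g x r \<le> ennreal e"
        using x unfolding lebesgue_point_def by blast
      then show "\<exists>\<delta>>0. \<forall>r. 0 < r \<and> r < \<delta> \<longrightarrow> osc f x r \<le> ennreal e"
        by (intro exI[of _ "min \<delta> 1"]) (simp add: eq[symmetric])
    qed
  qed
qed

section \<open>Kernels with vanishing moments\<close>

definition smooth :: "(real \<Rightarrow> real) \<Rightarrow> bool" where
  "smooth f \<longleftrightarrow> (\<forall>n x. (deriv ^^ n) f differentiable (at x))"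

text \<open>Guessing the whole tower of derivatives proves smoothness and identifies the iterated
  derivatives at once; the closed formulas for affine substitutions and linear combinations arise
  this way.\<close>

lemma smooth_family:
  assumes "\<And>n x. (F n has_real_derivative F (Suc n) x) (at x)"
  shows "smooth (F 0)" and "(deriv ^^ n) (F 0) = F n"
proof -
  have d: "deriv (F n) = F (Suc n)" for n
    using assms by (intro ext DERIV_imp_deriv)
  show *: "(deriv ^^ n) (F 0) = F n" for n
    by (induction n) (simp_all add: d)
  show "smooth (F 0)"
    unfolding smooth_def * using assms real_differentiable_def by blast
qed

lemma smooth_DERIV:
  assumes "smooth f"
  shows "((deriv ^^ n) f has_real_derivative (deriv ^^ Suc n) f x) (at x)"
  using assms DERIV_deriv_iff_real_differentiable unfolding smooth_def by auto

lemma smooth_DERIV0: "smooth f \<Longrightarrow> (f has_real_derivative deriv f x) (at x)"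
  using smooth_DERIV[of f 0] by simp

lemma smooth_funpow_deriv: "smooth f \<Longrightarrow> smooth ((deriv ^^ m) f)"
  unfolding smooth_def by (metis comp_apply funpow_add)

lemma smooth_if_deriv:
  assumes g: "smooth g" and D: "\<And>x. (f has_real_derivative g x) (at x)"
  shows "smooth f" and "deriv f = g"
proof -
  show d: "deriv f = g" using D by (intro ext DERIV_imp_deriv)
  have "((case n of 0 \<Rightarrow> f | Suc k \<Rightarrow> (deriv ^^ k) g) has_real_derivative (case Suc n of 0 \<Rightarrow> f | Suc k \<Rightarrow> (deriv ^^ k) g) x) (at x)" for n x
    using D smooth_DERIV[OF g] by (cases n) auto
  from smooth_family(1)[of "\<lambda>n. case n of 0 \<Rightarrow> f | Suc k \<Rightarrow> (deriv ^^ k) g", OF this]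
  show "smooth f" by simp
qed

lemma smooth_affine:
  assumes f: "smooth f"
  shows "smooth (\<lambda>s. c * f (a * s + b))"
    and "(deriv ^^ n) (\<lambda>s. c * f (a * s + b)) = (\<lambda>s. c * a ^ n * (deriv ^^ n) f (a * s + b))"
proof -
  define F where "F n s = c * a ^ n * (deriv ^^ n) f (a * s + b)" for n s
  have D: "(F n has_real_derivative F (Suc n) x) (at x)" for n x
    unfolding F_def
    by (rule DERIV_cong[OF DERIV_cmult[OF DERIV_chain2[OF smooth_DERIV[OF f]]]])
      (auto intro!: derivative_eq_intros simp: mult_ac)
  have F0: "F 0 = (\<lambda>s. c * f (a * s + b))" by (simp add: F_def fun_eq_iff)
  show "smooth (\<lambda>s. c * f (a * s + b))" using smooth_family(1)[of F, OF D] by (simp only: F0)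
  show "(deriv ^^ n) (\<lambda>s. c * f (a * s + b)) = (\<lambda>s. c * a ^ n * (deriv ^^ n) f (a * s + b))"
    using smooth_family(2)[of F n, OF D] by (simp only: F0) (simp add: F_def fun_eq_iff)
qed

lemma smooth_lincomb:
  assumes f: "smooth f" and g: "smooth g"
  shows "smooth (\<lambda>s. a * f s + b * g s)"
    and "(deriv ^^ n) (\<lambda>s. a * f s + b * g s) = (\<lambda>s. a * (deriv ^^ n) f s + b * (deriv ^^ n) g s)"
proof -
  define F where "F n s = a * (deriv ^^ n) f s + b * (deriv ^^ n) g s" for n s
  have D: "(F n has_real_derivative F (Suc n) x) (at x)" for n x
    unfolding F_def by (intro DERIV_add DERIV_cmult smooth_DERIV f g)
  have F0: "F 0 = (\<lambda>s. a * f s + b * g s)" by (simp add: F_def fun_eq_iff)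
  show "smooth (\<lambda>s. a * f s + b * g s)" using smooth_family(1)[of F, OF D] by (simp only: F0)
  show "(deriv ^^ n) (\<lambda>s. a * f s + b * g s) = (\<lambda>s. a * (deriv ^^ n) f s + b * (deriv ^^ n) g s)"
    using smooth_family(2)[of F n, OF D] by (simp only: F0) (simp add: F_def fun_eq_iff)
qed

lemma smooth_continuous: "smooth f \<Longrightarrow> continuous_on A ((deriv ^^ n) f)"
  by (meson smooth_DERIV DERIV_isCont continuous_at_imp_continuous_on)

lemma smooth_coinduct:
  assumes f: "f \<in> A" and A: "\<And>g. g \<in> A \<Longrightarrow> \<exists>g'\<in>A. \<forall>x. (g has_real_derivative g' x) (at x)"
  shows "smooth f"
proof -
  have "(deriv ^^ n) f \<in> A" for n
  proof (induction n)
    case (Suc n)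
    from A[OF Suc] obtain g' where "g' \<in> A" "\<And>x. ((deriv ^^ n) f has_real_derivative g' x) (at x)" by blast
    moreover from this have "deriv ((deriv ^^ n) f) = g'" by (intro ext DERIV_imp_deriv)
    ultimately show ?case by simp
  qed (use f in simp)
  with A show ?thesis unfolding smooth_def real_differentiable_def by blast
qed

text \<open>Closed under differentiation by the product rule, so smoothness of a product follows
  from \<open>smooth_coinduct\<close> in place of Leibniz' formula.\<close>

inductive_set prod_sums :: "(real \<Rightarrow> real) set" where
  prod: "smooth f \<Longrightarrow> smooth g \<Longrightarrow> (\<lambda>x. f x * g x) \<in> prod_sums"
| add: "f \<in> prod_sums \<Longrightarrow> g \<in> prod_sums \<Longrightarrow> (\<lambda>x. f x + g x) \<in> prod_sums"

lemma smooth_mult: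
  assumes f: "smooth f" and g: "smooth g"
  shows "smooth (\<lambda>x. f x * g x)"
proof (rule smooth_coinduct[where A=prod_sums])
  show "\<exists>h'\<in>prod_sums. \<forall>x. (h has_real_derivative h' x) (at x)" if "h \<in> prod_sums" for h
    using that
  proof induction
    case (prod f g)
    have "(\<lambda>x. deriv f x * g x + deriv g x * f x) \<in> prod_sums"
      using prod smooth_funpow_deriv[of f 1] smooth_funpow_deriv[of g 1]
      by (intro prod_sums.intros) auto
    moreover have "((\<lambda>x. f x * g x) has_real_derivative (deriv f x * g x + deriv g x * f x)) (at x)" for x
      by (intro DERIV_mult smooth_DERIV0 prod)
    ultimately show ?case by (intro bexI[of _ "\<lambda>x. deriv f x * g x + deriv g x * f x"]) auto
  next
    case (add f g)
    then obtain f' g' where "f' \<in> prod_sums" "g' \<in> prod_sums"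
      "\<And>x. (f has_real_derivative f' x) (at x)" "\<And>x. (g has_real_derivative g' x) (at x)" by blast
    then show ?case by (intro bexI[of _ "\<lambda>x. f' x + g' x"]) (auto intro: DERIV_add prod_sums.intros)
  qed
qed (intro prod_sums.intros f g)

section \<open>Smooth bump functions on the line\<close>

definition flat_exp :: "real poly \<Rightarrow> real \<Rightarrow> real" where
  "flat_exp p t = (if t \<le> 0 then 0 else poly p (1 / t) * exp (- (1 / t)))"

text \<open>The free exponent k carries the induction over the coefficients. With k = 1 and x = 1/h
  this is the right-hand difference quotient of \<open>flat_exp p\<close> at 0.\<close>

lemma poly_over_exp_tendsto_0: "((\<lambda>x::real. x ^ k * poly p x / exp x) \<longlongrightarrow> 0) at_top"
proof (induction p arbitrary: k)
  case (pCons a p)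
  have "((\<lambda>x::real. a * (x ^ k / exp x) + x ^ Suc k * poly p x / exp x) \<longlongrightarrow> a * 0 + 0) at_top"
    by (intro tendsto_intros tendsto_power_div_exp_0 pCons)
  then show ?case by (simp add: field_simps)
qed simp

text \<open>For t > 0 the derivative of p(1/t) exp(-1/t) is t^(-2) (p - p')(1/t) exp(-1/t), which
  has the same form with the polynomial X^2 (p - p'). So the range of \<open>flat_exp\<close> is
  closed under differentiation.\<close>

lemma flat_exp_DERIV:
  "(flat_exp p has_real_derivative flat_exp ([:0, 0, 1:] * (p - pderiv p)) t) (at t)"
proof -
  consider "t < 0" | "t = 0" | "t > 0" by linarith
  then show ?thesis
  proof cases
    case 1
    have "((\<lambda>_. 0) has_real_derivative 0) (at t)" by simp
    moreover have "eventually (\<lambda>s. (0::real) = flat_exp p s) (nhds t)"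
      using eventually_nhds_in_open[of "{..<0}" t] 1 by (auto elim!: eventually_mono simp: flat_exp_def)
    ultimately have "(flat_exp p has_real_derivative 0) (at t)"
      using DERIV_cong_ev[OF refl, of "\<lambda>_. 0" "flat_exp p" t 0 0] by simp
    then show ?thesis using 1 by (simp add: flat_exp_def)
  next
    case 3
    have "((\<lambda>t. poly p (1 / t) * exp (- (1 / t))) has_real_derivative
        flat_exp ([:0, 0, 1:] * (p - pderiv p)) t) (at t)"
    proof -
      have i: "((\<lambda>t. 1 / t) has_real_derivative - (1 / t\<^sup>2)) (at t)"
        using DERIV_inverse[of t] 3 by (simp add: inverse_eq_divide power2_eq_square)
      show ?thesis
        by (rule DERIV_cong[OF DERIV_mult[OF DERIV_chain2[OF poly_DERIV i] DERIV_fun_exp[OF DERIV_minus[OF i]]]])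
          (use 3 in \<open>simp add: flat_exp_def field_simps power2_eq_square\<close>)
    qed
    moreover have "eventually (\<lambda>s. poly p (1 / s) * exp (- (1 / s)) = flat_exp p s) (nhds t)"
      using eventually_nhds_in_open[of "{0<..}" t] 3 by (auto elim!: eventually_mono simp: flat_exp_def)
    ultimately show ?thesis
      using DERIV_cong_ev[OF refl, of "\<lambda>t. poly p (1 / t) * exp (- (1 / t))" "flat_exp p" t] by simp
  next
    case 2
    have "((\<lambda>x::real. x ^ 1 * poly p x / exp x) \<longlongrightarrow> 0) at_top" by (rule poly_over_exp_tendsto_0)
    then have "((\<lambda>h::real. inverse h ^ 1 * poly p (inverse h) / exp (inverse h)) \<longlongrightarrow> 0) (at_right 0)"
      by (rule filterlim_compose[OF _ filterlim_inverse_at_top_right])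
    moreover have "eventually (\<lambda>h::real. inverse h ^ 1 * poly p (inverse h) / exp (inverse h) = flat_exp p h / h) (at_right 0)"
      using eventually_at_right_less[of 0]
      by eventually_elim (simp add: flat_exp_def exp_minus field_simps)
    ultimately have right: "((\<lambda>h. flat_exp p h / h) \<longlongrightarrow> 0) (at_right 0)"
      by (rule Lim_transform_eventually)
    have "eventually (\<lambda>h::real. 0 = flat_exp p h / h) (at_left 0)"
      unfolding eventually_at_filter by (simp add: flat_exp_def)
    then have left: "((\<lambda>h. flat_exp p h / h) \<longlongrightarrow> 0) (at_left 0)"
      by (rule Lim_transform_eventually[OF tendsto_const])
    have "((\<lambda>h. flat_exp p h / h) \<longlongrightarrow> 0) (at 0)"
      using left right by (simp add: filterlim_split_at)
    then have "(flat_exp p has_real_derivative 0) (at 0)"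
      unfolding DERIV_def by (simp add: flat_exp_def[of p 0])
    then show ?thesis using 2 by (simp add: flat_exp_def)
  qed
qed

lemma smooth_flat_exp: "smooth (flat_exp p)"
proof (rule smooth_coinduct[where A="range flat_exp"])
  fix g assume "g \<in> range flat_exp"
  then obtain p where "g = flat_exp p" by blast
  then show "\<exists>g'\<in>range flat_exp. \<forall>x. (g has_real_derivative g' x) (at x)"
    by (intro bexI[of _ "flat_exp ([:0, 0, 1:] * (p - pderiv p))"] allI) (simp_all only: flat_exp_DERIV rangeI)
qed simp

text \<open>No sign or normalisation is imposed, so that differences, contractions and derivatives
  of bumps stay bumps; a nonzero integral is asked for separately.\<close>

definition unit_bump :: "(real \<Rightarrow> real) \<Rightarrow> bool" where
  "unit_bump f \<longleftrightarrow> smooth f \<and> (\<forall>x. \<bar>x\<bar> > 1 \<longrightarrow> f x = 0)"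

lemma smooth_outside_0_deriv:
  assumes "smooth h" "\<And>s. \<bar>c - s\<bar> > r \<Longrightarrow> h s = 0" "\<bar>c - s\<bar> > r"
  shows "(deriv ^^ n) h s = 0"
  using assms(3)
proof (induction n arbitrary: s)
  case (Suc n)
  have "open {y::real. \<bar>c - y\<bar> > r}" by (intro open_Collect_less continuous_intros)
  then have ev: "eventually (\<lambda>y. (deriv ^^ n) h y = 0) (nhds s)"
    using eventually_nhds_in_open[of "{y. \<bar>c - y\<bar> > r}" s] Suc by (auto elim!: eventually_mono)
  have "deriv ((deriv ^^ n) h) s = deriv (\<lambda>_. 0) s" by (rule deriv_cong_ev[OF ev refl])
  then show ?case by simp
qed (use assms(2) in simp)

lemma unit_bump_outside_0: "unit_bump f \<Longrightarrow> \<bar>x\<bar> > 1 \<Longrightarrow> (deriv ^^ n) f x = 0"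
  using smooth_outside_0_deriv[of f 1 0 x n] by (simp add: unit_bump_def)

lemma unit_bump_lincomb: "unit_bump f \<Longrightarrow> unit_bump g \<Longrightarrow> unit_bump (\<lambda>x. a * f x + b * g x)"
  unfolding unit_bump_def by (auto intro: smooth_lincomb)

lemma unit_bump_contract: "unit_bump f \<Longrightarrow> unit_bump (\<lambda>x. c * f (2 * x))"
  using smooth_affine(1)[of f c 2 0] unfolding unit_bump_def by auto

lemma unit_bump_deriv: "unit_bump f \<Longrightarrow> unit_bump ((deriv ^^ n) f)"
  using unit_bump_outside_0 smooth_funpow_deriv unfolding unit_bump_def by blast

lemma unit_bump_bounded:
  assumes "unit_bump f"
  obtains B where "B \<ge> 1" "\<And>x. \<bar>f x\<bar> \<le> B"
proof -
  have "continuous_on {-1..1} f" using assms smooth_continuous[of f _ 0] by (simp add: unit_bump_def)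
  then have "bounded (f ` {-1..1})" by (intro compact_imp_bounded compact_continuous_image) auto
  then obtain B where B: "\<And>x. x \<in> {-1..1} \<Longrightarrow> \<bar>f x\<bar> \<le> B" 
    by (metis bounded_iff imageI real_norm_def)
  show thesis
  proof (rule that[of "max 1 B"])
    fix x show "\<bar>f x\<bar> \<le> max 1 B"
      using B[of x] assms by (cases "x \<in> {-1..1}") (auto simp: unit_bump_def abs_if split: if_splits)
  qed simp
qed

lemma unit_bump_integrable:
  assumes "unit_bump f"
  shows "integrable lborel f"
proof -
  have "set_integrable lborel {-1..1} f"
    using assms smooth_continuous[of f _ 0] by (intro borel_integrable_atLeastAtMost') (auto simp: unit_bump_def)
  moreover have "(\<lambda>x. indicator {-1..1} x *\<^sub>R f x) = f"
  proof
    fix x show "indicator {-1..1} x *\<^sub>R f x = f x"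
      using assms by (cases "\<bar>x\<bar> > 1") (auto simp: unit_bump_def indicator_def)
  qed
  ultimately show ?thesis by (simp add: set_integrable_def)
qed

lemma unit_bump_exists:
  obtains f where "unit_bump f" "integral\<^sup>L lborel f \<noteq> 0"
proof -
  \<comment> \<open>Positive exactly on (-1,1). The factors 1 and -1 fit the shape of
    \<open>smooth_affine\<close>.\<close>
  define f where "f x = flat_exp 1 (1 * x + 1) * flat_exp 1 (- 1 * x + 1)" for x
  have "smooth (\<lambda>x. flat_exp 1 (1 * x + 1) * flat_exp 1 (- 1 * x + 1))"
    using smooth_affine(1)[OF smooth_flat_exp, of 1 1 1 1] smooth_affine(1)[OF smooth_flat_exp, of 1 1 "-1" 1]
    by (intro smooth_mult) simp_all
  then have f: "unit_bump f"
    unfolding unit_bump_def f_def by (auto simp: flat_exp_def)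
  have nn: "f x \<ge> 0" for x unfolding f_def by (simp add: flat_exp_def)
  have "integral\<^sup>L lborel f \<noteq> 0"
  proof
    assume "integral\<^sup>L lborel f = 0"
    then have "AE x in lborel. f x = 0"
      using unit_bump_integrable[OF f] nn by (subst (asm) integral_nonneg_eq_0_iff_AE) auto
    then have "AE x in lborel. x \<notin> {-1<..<1::real}"
      by eventually_elim (auto simp: f_def flat_exp_def)
    then have "{-1<..<1::real} \<in> null_sets lborel"
      by (subst AE_iff_null_sets) auto
    then have "emeasure lborel {-1<..<1::real} = 0" by auto
    then show False by simp
  qed
  with f show thesis by (rule that)
qed

text \<open>If \<open>\<Phi>\<close> is an antiderivative of a function supported in \<open>[-1,1]\<close>, then \<open>\<Phi>(2x) - \<Phi>(x)\<close>
  is again supported there, whatever the integral of that function.\<close>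

lemma unit_bump_antiderivative:
  assumes f: "unit_bump f"
  obtains g where "unit_bump g" "deriv g = (\<lambda>x. 2 * f (2 * x) - f x)"
proof -
  have sm: "smooth f" and out: "\<And>x. \<bar>x\<bar> > 1 \<Longrightarrow> f x = 0" using f by (auto simp: unit_bump_def)
  have cont: "continuous_on A f" for A using smooth_continuous[OF sm, of A 0] by simp
  \<comment> \<open>Starting at -2, left of the support, makes every x \<ge> -1 an interior point of
    [-2,x+1], so the fundamental theorem on that interval yields a two-sided derivative.\<close>
  define \<Phi> where "\<Phi> x = integral {-2..x} f" for x
  have left: "\<Phi> x = 0" if "x < - 1" for x
  proof -
    have "integral {-2..x} f = integral {-2..x} (\<lambda>_. 0)"
      using that by (intro Henstock_Kurzweil_Integration.integral_cong out) auto
    then show ?thesis by (simp add: \<Phi>_def)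
  qed
  have D: "(\<Phi> has_real_derivative f x) (at x)" for x
  proof (cases "x < -1")
    case True
    have ev: "eventually (\<lambda>s. 0 = \<Phi> s) (nhds x)"
      using eventually_nhds_in_open[of "{..<-1}" x] True by (auto elim!: eventually_mono simp: left)
    have "((\<lambda>_. 0) has_real_derivative 0) (at x)" by simp
    then have "(\<Phi> has_real_derivative 0) (at x)"
      using DERIV_cong_ev[OF refl ev, of 0 0] by simp
    then show ?thesis using out True by simp
  next
    case False
    have "((\<lambda>x. integral {-2..x} f) has_real_derivative f x) (at x within {-2..x+1})"
      by (rule integral_has_real_derivative[OF cont]) (use False in auto)
    then show ?thesis
      unfolding \<Phi>_def using False by (simp add: at_within_Icc_at)
  qed
  \<comment> \<open>Right of the support \<Phi> is constant but in general not 0; the constant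
    cancels in \<Phi>(2x) - \<Phi>(x).\<close>
  obtain c where right: "\<And>x. x > 1 \<Longrightarrow> \<Phi> x = c"
  proof -
    have "(\<Phi> has_field_derivative 0) (at x within {1<..})" if "x \<in> {1<..}" for x
      using D[of x] out[of x] that by (auto intro: has_field_derivative_at_within)
    then have "\<exists>c. \<forall>x\<in>{1<..}. \<Phi> x = c"
      by (intro has_field_derivative_zero_constant) auto
    then show thesis using that by blast
  qed
  define g where "g x = \<Phi> (2 * x) - \<Phi> x" for x
  have Dg: "(g has_real_derivative (2 * f (2 * x) - f x)) (at x)" for x
    unfolding g_def by (rule derivative_eq_intros DERIV_chain2[OF D] D refl)+ simp
  have s: "smooth (\<lambda>x. 2 * f (2 * x) - f x)"
    using smooth_lincomb(1)[OF smooth_affine(1)[OF sm, of 2 2 0] sm, of 1 "-1"] by simp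
  show thesis
  proof (rule that)
    show "unit_bump g"
      unfolding unit_bump_def
    proof (intro conjI allI impI)
      show "smooth g" by (rule smooth_if_deriv(1)[OF s Dg])
      fix x :: real assume "1 < \<bar>x\<bar>"
      then consider "x > 1" | "x < -1" by linarith
      then show "g x = 0" by cases (auto simp: g_def left right)
    qed
    show "deriv g = (\<lambda>x. 2 * f (2 * x) - f x)" by (rule smooth_if_deriv(2)[OF s Dg])
  qed
qed

text \<open>The two-scale difference of \<open>\<psi>\<close> has \<open>m\<close> vanishing moments. In the induction step \<open>\<psi>\<close> is replaced by
  \<open>E \<psi> - 2\<^sup>-\<^sup>m \<psi>\<close>, where \<open>E f(x) = 2 f(2x)\<close>; this annihilates the moment of order \<open>m\<close>.\<close>

lemma two_scale_kernel:
  assumes "m \<ge> 1"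
  shows "\<exists>\<psi> \<eta>. unit_bump \<psi> \<and> unit_bump \<eta> \<and> integral\<^sup>L lborel \<psi> \<noteq> 0 \<and>
    (\<forall>x. 2 * \<psi> (2 * x) - \<psi> x = (deriv ^^ m) \<eta> x)"
  using assms
proof (induction m rule: dec_induct)
  case base
  obtain \<psi> where \<psi>: "unit_bump \<psi>" "integral\<^sup>L lborel \<psi> \<noteq> 0" by (rule unit_bump_exists)
  from unit_bump_antiderivative[OF \<psi>(1)] obtain \<eta> where \<eta>: "unit_bump \<eta>" "deriv \<eta> = (\<lambda>x. 2 * \<psi> (2 * x) - \<psi> x)" .
  with \<psi> show ?case by (intro exI[of _ \<psi>] exI[of _ \<eta>]) simp
next
  case (step m)
  then obtain \<psi> \<eta> where \<psi>: "unit_bump \<psi>" "integral\<^sup>L lborel \<psi> \<noteq> 0" and \<eta>: "unit_bump \<eta>"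
    and eq: "\<And>x. 2 * \<psi> (2 * x) - \<psi> x = (deriv ^^ m) \<eta> x" by blast
  define a where "a = (1/2::real) ^ m"
  \<comment> \<open>m \<ge> 1 makes a at most 1/2, so the factor 1 - a of the new integral is not
    0.\<close>
  have "a \<le> (1/2) ^ 1" using step.hyps(1) unfolding a_def by (intro power_decreasing) auto
  then have a: "a < 1" by simp
  define \<psi>' where "\<psi>' x = 1 * (2 * \<psi> (2 * x)) + (- a) * \<psi> x" for x
  have \<psi>': "unit_bump \<psi>'"
    unfolding \<psi>'_def by (intro unit_bump_lincomb unit_bump_contract \<psi>)
  have sc: "(\<integral>x. 2 * \<psi> (2 * x) \<partial>lborel) = integral\<^sup>L lborel \<psi>"
    using lborel_integral_real_affine[of 2 \<psi> 0] by simp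
  have "integral\<^sup>L lborel \<psi>' = (\<integral>x. 2 * \<psi> (2 * x) \<partial>lborel) + (- a) * integral\<^sup>L lborel \<psi>"
    unfolding \<psi>'_def using unit_bump_integrable[OF unit_bump_contract[OF \<psi>(1), of 2]] unit_bump_integrable[OF \<psi>(1)]
    by (subst Bochner_Integration.integral_add) auto
  also have "\<dots> = (1 - a) * integral\<^sup>L lborel \<psi>" unfolding sc by (simp add: algebra_simps)
  finally have nz: "integral\<^sup>L lborel \<psi>' \<noteq> 0" using a \<psi>(2) by simp
  from unit_bump_antiderivative[OF \<eta>] obtain g where g: "unit_bump g" "deriv g = (\<lambda>x. 2 * \<eta> (2 * x) - \<eta> x)" .
  have sm: "smooth \<eta>" "smooth g" using \<eta> g by (auto simp: unit_bump_def)
  define \<eta>' where "\<eta>' x = a * g (1 * x + 0)" for x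
  have \<eta>': "unit_bump \<eta>'" using unit_bump_lincomb[OF g(1) g(1), of a 0] by (simp add: \<eta>'_def[abs_def])
  \<comment> \<open>The operators E - 1 and E - a commute, so the left side is E - a applied to the
    m-th derivative of \<eta>. Differentiating E \<eta> m times brings out 2^m, which the factor a
    in \<eta>' cancels.\<close>
  have "2 * \<psi>' (2 * x) - \<psi>' x = (deriv ^^ Suc m) \<eta>' x" for x
  proof -
    have "(deriv ^^ Suc m) \<eta>' x = a * (deriv ^^ Suc m) g x"
      unfolding \<eta>'_def[abs_def] by (subst smooth_affine(2)[OF sm(2)]) simp
    also have "(deriv ^^ Suc m) g = (deriv ^^ m) (\<lambda>x. 1 * (2 * \<eta> (2 * x + 0)) + (- 1) * \<eta> x)"
      unfolding funpow_Suc_right by (simp add: g(2))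
    also have "\<dots> x = 2 * 2 ^ m * (deriv ^^ m) \<eta> (2 * x) - (deriv ^^ m) \<eta> x"
      by (subst smooth_lincomb(2)[OF smooth_affine(1)[OF sm(1)] sm(1)], subst smooth_affine(2)[OF sm(1)]) simp
    also have "a * \<dots> = 2 * (deriv ^^ m) \<eta> (2 * x) - a * (deriv ^^ m) \<eta> x"
      by (simp add: a_def field_simps)
    also have "\<dots> = 2 * \<psi>' (2 * x) - \<psi>' x"
      unfolding eq[symmetric] \<psi>'_def by (simp add: algebra_simps)
    finally show ?thesis by simp
  qed
  with \<psi>' nz \<eta>' show ?case by blast
qed

section \<open>Tensor products as test functions\<close>

definition tens :: "('d::finite \<Rightarrow> real \<Rightarrow> real) \<Rightarrow> real^'d \<Rightarrow> real" where
  "tens h x = (\<Prod>i\<in>UNIV. h i (x $ i))"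

lemma tens_upd: "tens (h(i := g)) x = g (x $ i) * (\<Prod>k\<in>UNIV - {i}. h k (x $ k))"
  unfolding tens_def by (subst prod.remove[of _ i]) (auto intro!: prod.cong)

lemma pd_tens:
  assumes "\<And>i. smooth (h i)"
  shows "pd i (tens h) = tens (h(i := deriv (h i)))"
proof
  fix x
  have "tens h (x + t *\<^sub>R axis i 1) = h i (x $ i + t) * (\<Prod>k\<in>UNIV - {i}. h k (x $ k))" for t
    using tens_upd[of h i "h i" "x + t *\<^sub>R axis i 1"] by (simp add: axis_def)
  moreover have "((\<lambda>t. h i (x $ i + t) * (\<Prod>k\<in>UNIV - {i}. h k (x $ k))) has_real_derivative
      deriv (h i) (x $ i) * (\<Prod>k\<in>UNIV - {i}. h k (x $ k))) (at 0)"
  proof (rule DERIV_cmult_right)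
    show "((\<lambda>t. h i (x $ i + t)) has_real_derivative deriv (h i) (x $ i)) (at 0)"
      using DERIV_shift[of "h i" "deriv (h i) (x $ i)" 0 "x $ i"] smooth_DERIV0[OF assms, of i "x $ i"]
      by (simp add: add.commute)
  qed
  ultimately show "pd i (tens h) x = tens (h(i := deriv (h i))) x"
    unfolding pd_def tens_upd by (simp add: DERIV_imp_deriv)
qed

text \<open>Each partial derivative acts on a single factor, so only the number of occurrences of a
  direction matters and not their order.\<close>

lemma pds_tens:
  assumes "\<And>i. smooth (h i)"
  shows "pds ds (tens h) = tens (\<lambda>i. (deriv ^^ count_list ds i) (h i))"
proof (induction ds)
  case (Cons d ds)
  have "pds (d # ds) (tens h) = pd d (tens (\<lambda>i. (deriv ^^ count_list ds i) (h i)))"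
    using Cons by (simp add: pds_def)
  also have "\<dots> = tens ((\<lambda>i. (deriv ^^ count_list ds i) (h i))(d := deriv ((deriv ^^ count_list ds d) (h d))))"
    by (rule pd_tens) (rule smooth_funpow_deriv[OF assms])
  also have "(\<lambda>i. (deriv ^^ count_list ds i) (h i))(d := deriv ((deriv ^^ count_list ds d) (h d))) =
      (\<lambda>i. (deriv ^^ count_list (d # ds) i) (h i))"
    by (auto simp: fun_eq_iff)
  finally show ?case .
qed (simp add: pds_def)

lemma tens_differentiable:
  assumes "\<And>i. smooth (h i)"
  shows "tens h differentiable (at x)"
proof -
  have "((\<lambda>x. h i (x $ i)) has_derivative (\<lambda>y. deriv (h i) (x $ i) * (y $ i))) (at x)" for i
  proof -
    have "(h i has_derivative (*) (deriv (h i) (x $ i))) (at (x $ i))"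
      using smooth_DERIV0[OF assms, of i "x $ i"] by (simp add: has_field_derivative_def)
    moreover have "((\<lambda>x. x $ i) has_derivative (\<lambda>y. y $ i)) (at x)"
      by (rule bounded_linear_imp_has_derivative[OF bounded_linear_vec_nth])
    ultimately show ?thesis by (rule has_derivative_compose[rotated])
  qed
  then have "((\<lambda>x. \<Prod>i\<in>UNIV. h i (x $ i)) has_derivative
      (\<lambda>y. \<Sum>i\<in>UNIV. deriv (h i) (x $ i) * (y $ i) * (\<Prod>j\<in>UNIV - {i}. h j (x $ j)))) (at x)"
    by (rule has_derivative_prod)
  then show ?thesis unfolding tens_def[abs_def] differentiable_def by blast
qed

text \<open>The cube of half side r about x lies in the ball of radius d r, by comparison with the
  l1 norm; balls are what the maximal function averages over.\<close>

lemma tens_outside_0: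
  fixes x y :: "real^'d::finite"
  assumes out: "\<And>i s. \<bar>x $ i - s\<bar> > r \<Longrightarrow> h i s = 0" and y: "y \<notin> cball x (real CARD('d) * r)"
  shows "tens h y = 0"
proof (rule ccontr)
  assume "tens h y \<noteq> 0"
  then have "\<bar>(x - y) $ i\<bar> \<le> r" for i using out[of i "y $ i"] unfolding tens_def by force
  then have "norm (x - y) \<le> real CARD('d) * r"
    using norm_le_l1_cart[of "x - y"] sum_bounded_above[of UNIV "\<lambda>i. \<bar>(x - y) $ i\<bar>" r] by simp
  with y show False by (simp add: dist_norm)
qed

lemma test_fun_tens:
  fixes x :: "real^'d::finite"
  assumes sm: "\<And>i. smooth (h i)" and out: "\<And>i s. \<bar>x $ i - s\<bar> > r \<Longrightarrow> h i s = 0"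
  shows "test_fun (tens h)"
  unfolding test_fun_def
proof (intro conjI allI)
  show "pds ds (tens h) differentiable at y" for ds y
    unfolding pds_tens[OF sm] by (rule tens_differentiable) (rule smooth_funpow_deriv[OF sm])
  have "{y. tens h y \<noteq> 0} \<subseteq> cball x (real CARD('d) * r)"
    using tens_outside_0[where h=h and x=x and r=r, OF out] by blast
  then show "bounded {y. tens h y \<noteq> 0}" using bounded_cball bounded_subset by blast
qed

lemma tens_continuous: "(\<And>i. smooth (h i)) \<Longrightarrow> continuous_on A (tens h)"
  by (meson tens_differentiable differentiable_imp_continuous_within continuous_at_imp_continuous_on)

lemma tens_measurable: "(\<And>i. smooth (h i)) \<Longrightarrow> tens h \<in> borel_measurable borel"
  by (intro borel_measurable_continuous_onI tens_continuous)

lemma tens_bound: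
  fixes x y :: "real^'d::finite"
  assumes out: "\<And>i s. \<bar>x $ i - s\<bar> > r \<Longrightarrow> h i s = 0" and B: "\<And>i s. \<bar>h i s\<bar> \<le> B"
  shows "\<bar>tens h y\<bar> \<le> B ^ CARD('d) * indicator (cball x (real CARD('d) * r)) y"
proof (cases "y \<in> cball x (real CARD('d) * r)")
  case True
  have "\<bar>tens h y\<bar> \<le> (\<Prod>i\<in>(UNIV::'d set). B)"
    unfolding tens_def abs_prod by (intro prod_mono) (simp add: B)
  then show ?thesis using True by simp
next
  case False
  with tens_outside_0[where h=h and x=x and r=r, OF out] show ?thesis by simp
qed

lemma locint_measurable:
  fixes v :: "real^'d::finite \<Rightarrow> real"
  assumes "locint v"
  shows "v \<in> borel_measurable lebesgue"
proof (rule borel_measurable_LIMSEQ_real)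
  show "(\<lambda>x. indicator (cball 0 (real n)) x *\<^sub>R v x) \<in> borel_measurable lebesgue" for n
    using assms[unfolded locint_def, rule_format, OF compact_cball, of 0 "real n"]
    unfolding set_integrable_def by (rule borel_measurable_integrable)
  fix x :: "real^'d"
  obtain N :: nat where N: "norm x \<le> real N" using real_arch_simple by blast
  have "eventually (\<lambda>n. indicator (cball 0 (real n)) x *\<^sub>R v x = v x) sequentially"
    using eventually_ge_at_top[of N] by eventually_elim (use N in \<open>auto simp: indicator_def\<close>)
  then show "(\<lambda>n. indicator (cball 0 (real n)) x *\<^sub>R v x) \<longlonglongrightarrow> v x"
    by (rule tendsto_eventually)
qed

lemma integrable_locint_tens:
  fixes x :: "real^'d::finite"
  assumes v: "locint v" and sm: "\<And>i. smooth (h i)"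
    and out: "\<And>i s. \<bar>x $ i - s\<bar> > r \<Longrightarrow> h i s = 0" and B: "\<And>i s. \<bar>h i s\<bar> \<le> B"
  shows "integrable lebesgue (\<lambda>y. v y * tens h y)"
proof -
  let ?K = "cball x (real CARD('d) * r)"
  have i: "integrable lebesgue (\<lambda>y. indicator ?K y *\<^sub>R v y)"
    using v[unfolded locint_def, rule_format, OF compact_cball] by (simp only: set_integrable_def)
  have eq: "v y * tens h y = (indicator ?K y *\<^sub>R v y) * tens h y" for y
    using tens_outside_0[where h=h and x=x and r=r and y=y, OF out] by (auto simp: indicator_def)
  have "B ^ CARD('d) \<ge> 0" using B[of undefined 0] by simp
  then have "integrable lebesgue (\<lambda>y. (indicator ?K y *\<^sub>R v y) * tens h y)"
  proof (intro Bochner_Integration.integrable_bound[OF integrable_mult_right[OF integrable_norm[OF i], of "B ^ CARD('d)"]])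
    show "(\<lambda>y. (indicator ?K y *\<^sub>R v y) * tens h y) \<in> borel_measurable lebesgue"
      using i tens_measurable[of h, OF sm] by (intro borel_measurable_times) (auto intro: measurable_lebesgue_if_borel)
    show "AE y in lebesgue. norm (indicator ?K y *\<^sub>R v y * tens h y) \<le> norm (B ^ CARD('d) * norm (indicator ?K y *\<^sub>R v y))"
    proof (intro always_eventually allI)
      fix y
      have "\<bar>tens h y\<bar> \<le> B ^ CARD('d) * indicator ?K y" by (rule tens_bound[OF out B])
      also have "\<dots> \<le> \<bar>B ^ CARD('d)\<bar>" by (auto simp: indicator_def)
      finally have "\<bar>indicator ?K y *\<^sub>R v y\<bar> * \<bar>tens h y\<bar> \<le> \<bar>indicator ?K y *\<^sub>R v y\<bar> * \<bar>B ^ CARD('d)\<bar>"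
        by (rule mult_left_mono) simp
      then show "norm (indicator ?K y *\<^sub>R v y * tens h y) \<le> norm (B ^ CARD('d) * norm (indicator ?K y *\<^sub>R v y))"
        by (simp add: abs_mult mult.commute)
    qed
  qed
  then show ?thesis by (simp only: eq)
qed

lemma integral_tens_le:
  fixes x :: "real^'d::finite"
  assumes w: "w \<in> borel_measurable lebesgue"
    and out: "\<And>i s. \<bar>x $ i - s\<bar> > r \<Longrightarrow> h i s = 0" and B: "\<And>i s. \<bar>h i s\<bar> \<le> B"
  shows "ennreal \<bar>\<integral>y. w y * tens h y \<partial>lebesgue\<bar> \<le>
    ennreal (B ^ CARD('d)) * (\<integral>\<^sup>+y\<in>cball x (real CARD('d) * r). ennreal \<bar>w y\<bar> \<partial>lebesgue)"
\<comment> \<open>A non-integrable integrand has integral 0 by convention, which settles the other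
  case.\<close>
proof (cases "integrable lebesgue (\<lambda>y. w y * tens h y)")
  case True
  let ?K = "cball x (real CARD('d) * r)"
  have B0: "B \<ge> 0" using B[of undefined 0] by simp
  have "ennreal \<bar>\<integral>y. w y * tens h y \<partial>lebesgue\<bar> \<le> (\<integral>\<^sup>+y. ennreal (norm (w y * tens h y)) \<partial>lebesgue)"
    using integral_norm_bound_ennreal[OF True] by simp
  also have "\<dots> \<le> (\<integral>\<^sup>+y. ennreal (B ^ CARD('d)) * (ennreal \<bar>w y\<bar> * indicator ?K y) \<partial>lebesgue)"
  proof (intro nn_integral_mono)
    fix y
    have t: "\<bar>tens h y\<bar> \<le> B ^ CARD('d) * indicator ?K y" by (rule tens_bound[OF out B])
    then have "\<bar>w y\<bar> * \<bar>tens h y\<bar> \<le> \<bar>w y\<bar> * (B ^ CARD('d) * indicator ?K y)" by (rule mult_left_mono) simp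
    then show "ennreal (norm (w y * tens h y)) \<le> ennreal (B ^ CARD('d)) * (ennreal \<bar>w y\<bar> * indicator ?K y)"
      using B0 t by (cases "y \<in> ?K") (auto simp: abs_mult mult_ac simp flip: ennreal_mult intro!: ennreal_leI)
  qed
  also have "\<dots> \<le> ennreal (B ^ CARD('d)) * (\<integral>\<^sup>+y\<in>?K. ennreal \<bar>w y\<bar> \<partial>lebesgue)"
    using w by (subst nn_integral_cmult) (auto intro!: borel_measurable_times_ennreal borel_measurable_indicator)
  finally show ?thesis .
qed (simp add: not_integrable_integral_eq)


text \<open>Fubini: Lebesgue measure is the image of a product measure indexed by the basis vectors,
  and G re-indexes the factors from coordinates to basis vectors.\<close>

lemma integral_tens:
  fixes h :: "'d::finite \<Rightarrow> real \<Rightarrow> real"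
  assumes int: "\<And>i. integrable lborel (h i)" and meas: "tens h \<in> borel_measurable borel"
  shows "integral\<^sup>L lebesgue (tens h) = (\<Prod>i\<in>UNIV. integral\<^sup>L lborel (h i))"
proof -
  interpret product_sigma_finite "\<lambda>_::real^'d. lborel :: real measure" by standard
  let ?e = "\<lambda>i::'d. axis i (1::real) :: real^'d"
  have inj: "inj ?e" by (auto simp: inj_on_def axis_eq_axis)
  have B: "Basis = range ?e" by (auto simp: Basis_vec_def)
  define G where "G b = h (the_inv ?e b)" for b
  have G: "G (?e i) = h i" for i unfolding G_def by (simp add: the_inv_f_f[OF inj])
  have "integral\<^sup>L lebesgue (tens h) = integral\<^sup>L lborel (tens h)"
    using meas by (intro integral_completion) simp
  also have "\<dots> = (\<integral>f. tens h (\<Sum>b\<in>Basis. f b *\<^sub>R b) \<partial>(\<Pi>\<^sub>M b\<in>(Basis::(real^'d) set). lborel))"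
    using meas by (subst lborel_eq) (subst integral_distr, auto)
  also have "\<dots> = (\<integral>f. (\<Prod>b\<in>Basis. G b (f b)) \<partial>(\<Pi>\<^sub>M b\<in>(Basis::(real^'d) set). lborel))"
  proof (intro Bochner_Integration.integral_cong refl)
    fix f :: "real^'d \<Rightarrow> real"
    have comp: "(\<Sum>b\<in>Basis. f b *\<^sub>R b) $ i = f (?e i)" for i
    proof -
      have "(\<Sum>b\<in>Basis. f b *\<^sub>R b) $ i = (\<Sum>b\<in>Basis. f b *\<^sub>R b) \<bullet> ?e i" by (simp add: cart_eq_inner_axis)
      also have "\<dots> = f (?e i)" by (rule inner_sum_left_Basis) (simp add: B)
      finally show ?thesis .
    qed
    show "tens h (\<Sum>b\<in>Basis. f b *\<^sub>R b) = (\<Prod>b\<in>Basis. G b (f b))"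
      unfolding tens_def comp unfolding B by (subst prod.reindex[OF inj]) (simp add: G)
  qed
  also have "\<dots> = (\<Prod>b\<in>Basis. integral\<^sup>L lborel (G b))"
    by (rule product_integral_prod) (auto simp: B G int)
  also have "\<dots> = (\<Prod>i\<in>UNIV. integral\<^sup>L lborel (h i))"
    unfolding B by (subst prod.reindex[OF inj]) (simp add: G)
  finally show ?thesis .
qed

text \<open>As a function of s this is the rescaled kernel at c - s, so integrating against it is
  convolution, evaluated at c. Division by r preserves the integral; the reflection is the source of
  the signs in (-1/r)^n.\<close>

definition dilate :: "(real \<Rightarrow> real) \<Rightarrow> real \<Rightarrow> real \<Rightarrow> real \<Rightarrow> real" where
  "dilate g c r s = g ((c - s) / r) / r"

lemma dilate_affine: "dilate g c r = (\<lambda>s. (1 / r) * g ((- 1 / r) * s + c / r))"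
  by (simp add: dilate_def fun_eq_iff diff_divide_distrib)

lemma smooth_dilate: "smooth g \<Longrightarrow> smooth (dilate g c r)"
  unfolding dilate_affine by (rule smooth_affine)

lemma funpow_deriv_dilate:
  "smooth g \<Longrightarrow> (deriv ^^ n) (dilate g c r) = (\<lambda>s. (- 1 / r) ^ n * dilate ((deriv ^^ n) g) c r s)"
  unfolding dilate_affine by (subst smooth_affine(2)) (auto simp: fun_eq_iff)

lemma dilate_outside_0: "unit_bump g \<Longrightarrow> r > 0 \<Longrightarrow> \<bar>c - s\<bar> > r \<Longrightarrow> dilate g c r s = 0"
  unfolding dilate_def unit_bump_def by (simp add: field_simps)

lemma dilate_bound: "(\<And>x. \<bar>g x\<bar> \<le> K) \<Longrightarrow> r > 0 \<Longrightarrow> \<bar>dilate g c r s\<bar> \<le> K / r"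
  unfolding dilate_def by (simp add: divide_right_mono)

lemma integral_dilate:
  assumes g: "unit_bump g" and r: "r > 0"
  shows "integrable lborel (dilate g c r)" "integral\<^sup>L lborel (dilate g c r) = integral\<^sup>L lborel g"
proof -
  have "integrable lborel (\<lambda>s. g (c / r + (- 1 / r) * s))"
    using unit_bump_integrable[OF g] r by (intro lborel_integrable_real_affine) auto
  then show "integrable lborel (dilate g c r)"
    unfolding dilate_affine by (intro integrable_mult_right) (simp add: add.commute)
  have "integral\<^sup>L lborel g = \<bar>- 1 / r\<bar> *\<^sub>R (\<integral>s. g (c / r + (- 1 / r) * s) \<partial>lborel)"
    using r by (intro lborel_integral_real_affine) auto
  then show "integral\<^sup>L lborel (dilate g c r) = integral\<^sup>L lborel g"
    unfolding dilate_affine using r by (simp add: add.commute)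
qed

lemma HLmax_mono: "(\<And>y. f y \<le> g y) \<Longrightarrow> HLmax f x \<le> HLmax g x"
  unfolding HLmax_def by (intro SUP_mono' mult_left_mono nn_integral_mono mult_right_mono) auto

text \<open>The height (K/r)^d of the tensor product and the factor (d r)^d from the ball
  compensate, so the bound does not depend on the scale r.\<close>

lemma integral_tens_le_HLmax:
  fixes x :: "real^'d::finite"
  assumes w: "w \<in> borel_measurable lebesgue" and r: "r > 0"
    and out: "\<And>i s. \<bar>x $ i - s\<bar> > r \<Longrightarrow> h i s = 0" and K: "\<And>i s. \<bar>h i s\<bar> \<le> K / r"
    and a: "HLmax (\<lambda>y. ennreal \<bar>w y\<bar>) x \<le> ennreal a" "a \<ge> 0"
  shows "\<bar>\<integral>y. w y * tens h y \<partial>lebesgue\<bar> \<le> (K * real CARD('d)) ^ CARD('d) * a"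
proof -
  have K0: "K \<ge> 0" using order_trans[OF abs_ge_zero K[of undefined 0]] r by (simp add: zero_le_divide_iff)
  have "ennreal \<bar>\<integral>y. w y * tens h y \<partial>lebesgue\<bar> \<le>
      ennreal ((K / r) ^ CARD('d)) * (\<integral>\<^sup>+y\<in>cball x (real CARD('d) * r). ennreal \<bar>w y\<bar> \<partial>lebesgue)"
    by (rule integral_tens_le[OF w out K])
  also have "\<dots> \<le> ennreal ((K / r) ^ CARD('d)) * (ennreal ((real CARD('d) * r) ^ CARD('d)) * ennreal a)"
    using HLmax_upper[of "real CARD('d) * r" "\<lambda>y. ennreal \<bar>w y\<bar>" x] r a
    by (intro mult_left_mono) (auto elim!: order_trans intro: mult_left_mono)
  also have "\<dots> = ennreal ((K / r) ^ CARD('d) * ((real CARD('d) * r) ^ CARD('d) * a))"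
    using K0 r a by (simp flip: ennreal_mult)
  also have "(K / r) ^ CARD('d) * ((real CARD('d) * r) ^ CARD('d) * a) = (K * real CARD('d)) ^ CARD('d) * a"
    using r by (simp add: power_mult_distrib power_divide)
  finally show ?thesis using K0 a by simp
qed

text \<open>An approximate identity at a Lebesgue point. As g has no prescribed mass, the limit
  carries the d-th power of its integral.\<close>

lemma tens_dilate_Lebesgue_point:
  fixes x :: "real^'d::finite"
  assumes v: "locint v" and g: "unit_bump g" and lp: "lebesgue_point v x" and e: "e > 0"
  obtains \<delta> where "\<delta> > 0" "\<And>r. 0 < r \<Longrightarrow> r < \<delta> \<Longrightarrow>
    \<bar>(\<integral>y. v y * tens (\<lambda>i. dilate g (x $ i) r) y \<partial>lebesgue) - v x * integral\<^sup>L lborel g ^ CARD('d)\<bar> \<le> e"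
proof -
  obtain K where K: "K \<ge> 1" "\<And>s. \<bar>g s\<bar> \<le> K" using unit_bump_bounded[OF g] by blast
  define A where "A = (K * real CARD('d)) ^ CARD('d)"
  have A: "A > 0" unfolding A_def using K by simp
  have sm: "smooth g" using g by (simp add: unit_bump_def)
  have vm: "v \<in> borel_measurable lebesgue" by (rule locint_measurable[OF v])
  from lp e A obtain \<delta> where \<delta>: "\<delta> > 0" "\<And>r. 0 < r \<Longrightarrow> r < \<delta> \<Longrightarrow> osc v x r \<le> ennreal (e / A)"
    unfolding lebesgue_point_def by (metis divide_pos_pos)
  show thesis
  proof (rule that[of "\<delta> / CARD('d)"])
    show "\<delta> / CARD('d) > 0" using \<delta>(1) by simp
    fix r :: real assume r: "0 < r" "r < \<delta> / CARD('d)"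
    let ?h = "\<lambda>i. dilate g (x $ i) r" and ?R = "real CARD('d) * r"
    have R: "0 < ?R" "?R < \<delta>" using r by (auto simp: field_simps)
    have out: "\<And>i s. \<bar>x $ i - s\<bar> > r \<Longrightarrow> ?h i s = 0" using dilate_outside_0[OF g r(1)] by blast
    have B: "\<And>i s. \<bar>?h i s\<bar> \<le> K / r" using dilate_bound[of g, OF K(2) r(1)] by blast
    have c: "locint (\<lambda>_. v x)"
      unfolding locint_def set_integrable_def
      using lmeasurable_compact by (force simp: fmeasurable_def intro!: integrable_real_indicator)
    have "(\<integral>y. v x * tens ?h y \<partial>lebesgue) = v x * integral\<^sup>L lborel g ^ CARD('d)"
      using integral_tens[of ?h, OF integral_dilate(1)[OF g r(1)] tens_measurable[OF smooth_dilate[OF sm]]]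
      by (simp add: integral_dilate(2)[OF g r(1)])
    moreover have "(\<integral>y. (v y - v x) * tens ?h y \<partial>lebesgue) = (\<integral>y. v y * tens ?h y \<partial>lebesgue) - (\<integral>y. v x * tens ?h y \<partial>lebesgue)"
      unfolding left_diff_distrib
      by (intro Bochner_Integration.integral_diff integrable_locint_tens[where x=x and r=r and B="K / r"] v c smooth_dilate sm out B)
    moreover have "ennreal \<bar>\<integral>y. (v y - v x) * tens ?h y \<partial>lebesgue\<bar> \<le> ennreal e"
    proof -
      have "ennreal \<bar>\<integral>y. (v y - v x) * tens ?h y \<partial>lebesgue\<bar> \<le>
          ennreal ((K / r) ^ CARD('d)) * (\<integral>\<^sup>+y\<in>cball x ?R. ennreal \<bar>v y - v x\<bar> \<partial>lebesgue)"
        using vm by (intro integral_tens_le[OF _ out B]) auto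
      also have "(\<integral>\<^sup>+y\<in>cball x ?R. ennreal \<bar>v y - v x\<bar> \<partial>lebesgue) = ennreal (?R ^ CARD('d)) * osc v x ?R"
        unfolding osc_def mult.assoc[symmetric] using R by (simp add: power_divide flip: ennreal_mult)
      also have "ennreal ((K / r) ^ CARD('d)) * (ennreal (?R ^ CARD('d)) * osc v x ?R) \<le>
          ennreal ((K / r) ^ CARD('d)) * (ennreal (?R ^ CARD('d)) * ennreal (e / A))"
        by (intro mult_left_mono \<delta>(2) R) auto
      also have "\<dots> = ennreal ((K / r) ^ CARD('d) * (?R ^ CARD('d) * (e / A)))"
        using K r A e by (simp flip: ennreal_mult)
      also have "(K / r) ^ CARD('d) * (?R ^ CARD('d) * (e / A)) = A * (e / A)"
        unfolding A_def using r by (simp add: power_mult_distrib power_divide)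
      finally show ?thesis using A by simp
    qed
    then have "\<bar>\<integral>y. (v y - v x) * tens ?h y \<partial>lebesgue\<bar> \<le> e" using e by simp
    ultimately show "\<bar>(\<integral>y. v y * tens ?h y \<partial>lebesgue) - v x * integral\<^sup>L lborel g ^ CARD('d)\<bar> \<le> e"
      by argo
  qed
qed

section \<open>The pointwise estimate\<close>

text \<open>\<open>weak_deriv\<close> tests along lists of directions realising \<alpha>; it yields
  information only once such a list is known to exist.\<close>

lemma ex_list_count: "\<exists>ds. \<forall>i::'d::finite. count_list ds i = \<alpha> i"
proof -
  have "\<exists>ds. \<forall>i. count_list ds i = (if i \<in> A then \<alpha> i else 0)" if "finite A" for A :: "'d set"
    using that
  proof induction
    case (insert a A)
    then obtain ds where "\<forall>i. count_list ds i = (if i \<in> A then \<alpha> i else 0)" by blast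
    moreover have "count_list (replicate n b) i = (if i = b then n else 0)" for n :: nat and b i :: 'd
      by (induction n) auto
    ultimately show ?case using insert(2) by (intro exI[of _ "replicate (\<alpha> a) a @ ds"]) auto
  qed (auto intro: exI[of _ "[]"])
  from this[of UNIV] show ?thesis by simp
qed

lemma weak_deriv_wd:
  assumes "W_loc k u" "sum \<alpha> UNIV \<le> k"
  shows "weak_deriv \<alpha> u (wd \<alpha> u)"
  using assms someI_ex[of "weak_deriv \<alpha> u"] unfolding wd_def W_loc_def by blast

text \<open>Absolute values discard the sign (-1)^|\<alpha>|; the later estimates concern sizes
  only.\<close>

lemma weak_deriv_abs:
  assumes "weak_deriv \<alpha> u v" "test_fun \<phi>" "\<And>i. count_list ds i = \<alpha> i"
  shows "\<bar>\<integral>x. v x * \<phi> x \<partial>lebesgue\<bar> = \<bar>\<integral>x. u x * pds ds \<phi> x \<partial>lebesgue\<bar>"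
  using assms unfolding weak_deriv_def by (auto simp: abs_mult)

lemma weak_deriv_tens:
  fixes x :: "real^'d::finite"
  assumes wd: "weak_deriv \<alpha> u v"
    and sm: "\<And>i. smooth (h i)" and out: "\<And>i s. \<bar>x $ i - s\<bar> > r \<Longrightarrow> h i s = 0"
  shows "\<bar>\<integral>y. v y * tens h y \<partial>lebesgue\<bar> = \<bar>\<integral>y. u y * tens (\<lambda>i. (deriv ^^ \<alpha> i) (h i)) y \<partial>lebesgue\<bar>"
proof -
  obtain ds where ds: "\<And>i. count_list ds i = \<alpha> i" using ex_list_count by blast
  have "\<bar>\<integral>y. v y * tens h y \<partial>lebesgue\<bar> = \<bar>\<integral>y. u y * pds ds (tens h) y \<partial>lebesgue\<bar>"
    by (rule weak_deriv_abs[OF wd test_fun_tens[of h, OF sm out] ds])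
  then show ?thesis by (simp add: pds_tens[of h, OF sm] ds)
qed

text \<open>Up to sign, both sides are the integral of u against the same derivative of
  \<open>tens h\<close>. Thus v and w are compared through u, without making w a weak derivative of
  v.\<close>

lemma weak_deriv_tens_shift:
  fixes x :: "real^'d::finite"
  assumes v: "weak_deriv \<alpha> u v" and w: "weak_deriv (\<alpha>(i := \<alpha> i + m)) u w"
    and sm: "\<And>i. smooth (h i)" and out: "\<And>i s. \<bar>x $ i - s\<bar> > r \<Longrightarrow> h i s = 0"
  shows "\<bar>\<integral>y. v y * tens (h(i := (deriv ^^ m) (h i))) y \<partial>lebesgue\<bar> = \<bar>\<integral>y. w y * tens h y \<partial>lebesgue\<bar>"
proof -
  let ?h = "h(i := (deriv ^^ m) (h i))"
  have "\<bar>\<integral>y. v y * tens ?h y \<partial>lebesgue\<bar> = \<bar>\<integral>y. u y * tens (\<lambda>l. (deriv ^^ \<alpha> l) (?h l)) y \<partial>lebesgue\<bar>"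
    using sm out smooth_outside_0_deriv[of "h i" r "x $ i"]
    by (intro weak_deriv_tens[OF v, where x=x and r=r]) (auto intro: smooth_funpow_deriv)
  also have "(\<lambda>l. (deriv ^^ \<alpha> l) (?h l)) = (\<lambda>l. (deriv ^^ (\<alpha>(i := \<alpha> i + m)) l) (h l))"
    by (auto simp: fun_eq_iff funpow_add)
  also have "\<bar>\<integral>y. u y * tens \<dots> y \<partial>lebesgue\<bar> = \<bar>\<integral>y. w y * tens h y \<partial>lebesgue\<bar>"
    by (rule weak_deriv_tens[OF w sm out, symmetric])
  finally show ?thesis .
qed

lemma finite_multi_indices: "finite {\<alpha>::'d::finite \<Rightarrow> nat. sum \<alpha> UNIV = k}"
proof (rule finite_subset)
  show "{\<alpha>::'d \<Rightarrow> nat. sum \<alpha> UNIV = k} \<subseteq> PiE UNIV (\<lambda>_. {..k})"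
  proof
    fix \<alpha> :: "'d \<Rightarrow> nat" assume "\<alpha> \<in> {\<alpha>. sum \<alpha> UNIV = k}"
    then have "\<alpha> i \<le> k" for i using member_le_sum[of i UNIV \<alpha>] by simp
    then show "\<alpha> \<in> PiE UNIV (\<lambda>_. {..k})" by auto
  qed
  show "finite (PiE (UNIV::'d set) (\<lambda>_. {..k}))" by (intro finite_PiE) auto
qed

lemma wd_le_grad_abs:
  fixes \<alpha> :: "'d::finite \<Rightarrow> nat"
  assumes "sum \<alpha> UNIV = k"
  shows "\<bar>wd \<alpha> u y\<bar> \<le> grad_abs k u y"
  unfolding grad_abs_def using assms finite_multi_indices
  by (intro member_le_sum[where f="\<lambda>\<alpha>. \<bar>wd \<alpha> u y\<bar>"]) auto

lemma grad_abs_measurable: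
  fixes u :: "real^'d::finite \<Rightarrow> real"
  assumes "W_loc k u" "l \<le> k"
  shows "grad_abs l u \<in> borel_measurable lebesgue"
proof -
  have "wd \<alpha> u \<in> borel_measurable lebesgue" if "sum \<alpha> UNIV = l" for \<alpha>
    using weak_deriv_wd[OF assms(1), of \<alpha>] assms(2) that locint_measurable by (auto simp: weak_deriv_def)
  then show ?thesis unfolding grad_abs_def[abs_def] by (intro borel_measurable_sum) auto
qed

text \<open>One step of the telescoping: passing from scale \<open>r\<close> to scale \<open>r/2\<close> coordinate by coordinate, every
  single change is an \<open>m\<close>-th derivative in one direction, which is moved onto \<open>v\<close>.\<close>

lemma two_scale_difference:
  fixes x :: "real^'d::finite" and a r K :: real and P :: "real \<Rightarrow> real"
  assumes \<psi>: "unit_bump \<psi>" and \<eta>: "unit_bump \<eta>" and eq: "\<And>x. 2 * \<psi> (2 * x) - \<psi> x = (deriv ^^ m) \<eta> x"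
    and K: "\<And>x. \<bar>\<psi> x\<bar> \<le> K" "\<And>x. \<bar>\<eta> x\<bar> \<le> K"
    and v: "weak_deriv \<alpha> u v" and w: "\<And>i. weak_deriv (\<alpha>(i := \<alpha> i + m)) u (w i)"
    and a: "\<And>i. HLmax (\<lambda>y. ennreal \<bar>w i y\<bar>) x \<le> ennreal a" "a \<ge> 0" and r: "r > 0"
  defines "P \<equiv> \<lambda>r. \<integral>y. v y * tens (\<lambda>i. dilate \<psi> (x $ i) r) y \<partial>lebesgue"
  shows "\<bar>P (r / 2) - P r\<bar> \<le> real CARD('d) * (r ^ m * ((2 * K * real CARD('d)) ^ CARD('d) * a))"
proof -
  let ?c = "r ^ m * ((2 * K * real CARD('d)) ^ CARD('d) * a)"
  \<comment> \<open>S collects the coordinates already at scale r/2; the empty set gives P r and the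
    full set P (r/2).\<close>
  define h where "h S i = (if i \<in> S then dilate \<psi> (x $ i) (r/2) else dilate \<psi> (x $ i) r)" for S i
  define I where "I S = (\<integral>y. v y * tens (h S) y \<partial>lebesgue)" for S
  have K0: "K \<ge> 0" using order_trans[OF abs_ge_zero K(1)] by blast
  have s: "smooth \<psi>" "smooth \<eta>" using \<psi> \<eta> by (auto simp: unit_bump_def)
  have sm: "smooth (h S i)" for S i unfolding h_def by (auto intro: smooth_dilate s)
  have out: "h S i s = 0" if "\<bar>x $ i - s\<bar> > r" for S i s
    unfolding h_def using that r dilate_outside_0[OF \<psi>, of r "x $ i" s] dilate_outside_0[OF \<psi>, of "r/2" "x $ i" s] by auto
  have bd: "\<bar>h S i s\<bar> \<le> 2 * K / r" for S i s
  proof -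
    have "\<bar>dilate \<psi> (x $ i) r s\<bar> \<le> K / r" "\<bar>dilate \<psi> (x $ i) (r/2) s\<bar> \<le> K / (r/2)"
      using dilate_bound[of \<psi> K r "x $ i" s, OF K(1)] dilate_bound[of \<psi> K "r/2" "x $ i" s, OF K(1)] r
      by simp_all
    moreover have "K / r \<le> 2 * K / r" using r K0 by (intro divide_right_mono) auto
    ultimately show ?thesis unfolding h_def by (auto simp: mult.commute)
  qed
  have vl: "locint v" using v by (simp add: weak_deriv_def)
  have wl: "w i \<in> borel_measurable lebesgue" for i
    using w[of i] locint_measurable by (auto simp: weak_deriv_def)
  have int: "integrable lebesgue (\<lambda>y. v y * tens (h S) y)" for S
    by (rule integrable_locint_tens[where x=x and r=r and B="2 * K / r", OF vl sm out bd])
  have step: "\<bar>I (insert i S) - I S\<bar> \<le> ?c" if i: "i \<notin> S" for i S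
  proof -
    define g where "g = (h S)(i := dilate \<eta> (x $ i) r)"
    have gs: "smooth (g l)" for l unfolding g_def using sm s by (auto intro: smooth_dilate)
    have gout: "g l s = 0" if "\<bar>x $ l - s\<bar> > r" for l s
      unfolding g_def using that out dilate_outside_0[OF \<eta> r] by auto
    have gbd: "\<bar>g l s\<bar> \<le> 2 * K / r" for l s
    proof -
      have "\<bar>dilate \<eta> (x $ i) r s\<bar> \<le> K / r" using dilate_bound[of \<eta> K, OF K(2) r] .
      also have "K / r \<le> 2 * K / r" using r K0 by (intro divide_right_mono) auto
      finally show ?thesis using bd by (auto simp: g_def)
    qed
    \<comment> \<open>Only factor i changes. There the two-scale relation gives the m-th derivative
      of \<eta>, dilated to scale r, which is (-r)^m times the m-th derivative of the dilated
      \<eta>.\<close>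
    have diff: "tens (h (insert i S)) y - tens (h S) y = (- r) ^ m * tens (g(i := (deriv ^^ m) (g i))) y" for y
    proof -
      have h1: "h (insert i S) = (h S)(i := dilate \<psi> (x $ i) (r/2))" by (auto simp: h_def fun_eq_iff)
      have h2: "h S = (h S)(i := dilate \<psi> (x $ i) r)" using i by (auto simp: h_def fun_eq_iff)
      have g: "g(i := (deriv ^^ m) (g i)) = (h S)(i := (deriv ^^ m) (dilate \<eta> (x $ i) r))"
        by (auto simp: g_def fun_eq_iff)
      have "dilate \<psi> c (r/2) s - dilate \<psi> c r s = (- r) ^ m * (deriv ^^ m) (dilate \<eta> c r) s" for c s
      proof -
        have "dilate \<psi> c (r/2) s - dilate \<psi> c r s = (2 * \<psi> (2 * ((c - s) / r)) - \<psi> ((c - s) / r)) / r"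
          by (simp add: dilate_def diff_divide_distrib mult.commute)
        also have "\<dots> = dilate ((deriv ^^ m) \<eta>) c r s" unfolding eq by (simp add: dilate_def)
        also have "\<dots> = (- r) ^ m * ((- 1 / r) ^ m * dilate ((deriv ^^ m) \<eta>) c r s)"
          using r by (simp add: mult.assoc[symmetric] flip: power_mult_distrib)
        finally show ?thesis by (simp add: funpow_deriv_dilate[OF s(2)])
      qed
      then show ?thesis
        unfolding h1 g by (subst (2) h2) (simp only: tens_upd left_diff_distrib[symmetric] mult.assoc[symmetric])
    qed
    have "I (insert i S) - I S = (\<integral>y. v y * tens (h (insert i S)) y - v y * tens (h S) y \<partial>lebesgue)"
      unfolding I_def by (rule Bochner_Integration.integral_diff[symmetric, OF int int])
    also have "\<dots> = (\<integral>y. (- r) ^ m * (v y * tens (g(i := (deriv ^^ m) (g i))) y) \<partial>lebesgue)"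
      unfolding right_diff_distrib[symmetric] diff by (simp add: mult.left_commute)
    also have "\<dots> = (- r) ^ m * (\<integral>y. v y * tens (g(i := (deriv ^^ m) (g i))) y \<partial>lebesgue)" by simp
    finally have "\<bar>I (insert i S) - I S\<bar> = r ^ m * \<bar>\<integral>y. v y * tens (g(i := (deriv ^^ m) (g i))) y \<partial>lebesgue\<bar>"
      using r by (simp add: abs_mult power_abs)
    also have "\<bar>\<integral>y. v y * tens (g(i := (deriv ^^ m) (g i))) y \<partial>lebesgue\<bar> = \<bar>\<integral>y. w i y * tens g y \<partial>lebesgue\<bar>"
      by (rule weak_deriv_tens_shift[OF v w gs gout])
    also have "\<dots> \<le> (2 * K * real CARD('d)) ^ CARD('d) * a"
      by (rule integral_tens_le_HLmax[OF wl r gout gbd a])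
    finally show ?thesis using r by (simp add: mult_left_mono)
  qed
  have "\<bar>I S - I {}\<bar> \<le> real (card S) * ?c" if "finite S" for S
    using that
  proof induction
    case (insert i S)
    then show ?case using step[of i S] by (simp add: algebra_simps)
  qed simp
  from this[of UNIV] have "\<bar>I UNIV - I {}\<bar> \<le> real CARD('d) * ?c" by simp
  then show ?thesis unfolding I_def h_def P_def by simp
qed

text \<open>The exceptional set consists of the points that are not Lebesgue points of the
  derivative. It does not depend on a, b, R, so R can later be adapted to the sizes of the maximal
  functions. In C, the part 2 C1 comes from the telescoping series, C2 from the average of u at
  scale R, and I is the mass of the kernel.\<close>

lemma weak_deriv_pointwise_bound:
  fixes j k :: nat
  assumes "j < k"
  shows "\<exists>C>0. \<forall>u \<alpha>. W_loc k (u :: real^'d::finite \<Rightarrow> real) \<longrightarrow> sum \<alpha> UNIV = j \<longrightarrow>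
    (AE x in lebesgue. \<forall>a b R. 0 \<le> a \<longrightarrow> 0 \<le> b \<longrightarrow> 0 < R \<longrightarrow>
      HLmax (\<lambda>y. ennreal \<bar>grad_abs k u y\<bar>) x \<le> ennreal a \<longrightarrow> HLmax (\<lambda>y. ennreal \<bar>u y\<bar>) x \<le> ennreal b \<longrightarrow>
      \<bar>wd \<alpha> u x\<bar> \<le> C * (R ^ (k - j) * a + b / R ^ j))"
proof -
  let ?d = "CARD('d)"
  define m where "m = k - j"
  have m: "m \<ge> 1" "j + m = k" using assms by (auto simp: m_def)
  obtain \<psi> \<eta> where \<psi>: "unit_bump \<psi>" and \<eta>: "unit_bump \<eta>" and nz: "integral\<^sup>L lborel \<psi> \<noteq> 0"
    and eq: "\<And>x. 2 * \<psi> (2 * x) - \<psi> x = (deriv ^^ m) \<eta> x"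
    using two_scale_kernel[OF m(1)] by blast
  have s: "smooth \<psi>" using \<psi> by (simp add: unit_bump_def)
  obtain K1 where K1: "K1 \<ge> 1" "\<And>x. \<bar>\<eta> x\<bar> \<le> K1" using unit_bump_bounded[OF \<eta>] by blast
  have "\<exists>B. \<forall>x. \<bar>(deriv ^^ n) \<psi> x\<bar> \<le> B" for n using unit_bump_bounded[OF unit_bump_deriv[OF \<psi>]] by metis
  then obtain B where B: "\<And>n x. \<bar>(deriv ^^ n) \<psi> x\<bar> \<le> B n" by metis
  have B0: "B n \<ge> 0" for n using order_trans[OF abs_ge_zero B] by blast
  \<comment> \<open>One bound for \<eta> and for the derivatives of \<psi> up to order j; the latter
    occur when the weak derivative is moved to the kernel at scale R.\<close>
  define K where "K = K1 + (\<Sum>n\<le>j. B n)"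
  have K: "\<bar>(deriv ^^ n) \<psi> x\<bar> \<le> K" if "n \<le> j" for n x
    using B[of n x] member_le_sum[of n "{..j}" B] that B0 K1(1) unfolding K_def by auto
  have K\<eta>: "\<bar>\<eta> x\<bar> \<le> K" for x using K1(2)[of x] sum_nonneg[of "{..j}" B] B0 unfolding K_def by auto
  have Kpos: "K > 0" using K1(1) sum_nonneg[of "{..j}" B] B0 unfolding K_def by auto
  define I where "I = \<bar>integral\<^sup>L lborel \<psi>\<bar> ^ ?d"
  have I: "I > 0" using nz by (simp add: I_def)
  define C1 where "C1 = real ?d * (2 * K * real ?d) ^ ?d"
  define C2 where "C2 = (K * real ?d) ^ ?d"
  have C1: "C1 > 0" and C2: "C2 > 0" using Kpos by (auto simp: C1_def C2_def)
  define C where "C = (2 * C1 + C2) / I"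
  have C: "C > 0" unfolding C_def using C1 C2 I by simp
  show ?thesis
  proof (intro exI[of _ C] conjI C allI impI)
    fix u :: "real^'d \<Rightarrow> real" and \<alpha> :: "'d \<Rightarrow> nat"
    assume u: "W_loc k u" and \<alpha>: "sum \<alpha> UNIV = j"
    define v where "v = wd \<alpha> u"
    have v: "weak_deriv \<alpha> u v" unfolding v_def by (rule weak_deriv_wd[OF u]) (use \<alpha> assms in simp)
    then have vl: "locint v" by (simp add: weak_deriv_def)
    define w where "w i = wd (\<alpha>(i := \<alpha> i + m)) u" for i
    have sw: "sum (\<alpha>(i := \<alpha> i + m)) UNIV = k" for i
    proof -
      have "sum (\<alpha>(i := \<alpha> i + m)) UNIV = (\<alpha> i + m) + sum \<alpha> (UNIV - {i})"
        by (subst sum.remove[of _ i]) (auto intro!: sum.cong)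
      also have "\<dots> = sum \<alpha> UNIV + m" by (subst (2) sum.remove[of _ i]) auto
      finally show ?thesis using \<alpha> m by simp
    qed
    have w: "weak_deriv (\<alpha>(i := \<alpha> i + m)) u (w i)" for i
      unfolding w_def by (rule weak_deriv_wd[OF u]) (simp only: sw)
    have um: "u \<in> borel_measurable lebesgue" using u locint_measurable by (auto simp: W_loc_def)
    show "AE x in lebesgue. \<forall>a b R. 0 \<le> a \<longrightarrow> 0 \<le> b \<longrightarrow> 0 < R \<longrightarrow>
      HLmax (\<lambda>y. ennreal \<bar>grad_abs k u y\<bar>) x \<le> ennreal a \<longrightarrow> HLmax (\<lambda>y. ennreal \<bar>u y\<bar>) x \<le> ennreal b \<longrightarrow>
      \<bar>wd \<alpha> u x\<bar> \<le> C * (R ^ (k - j) * a + b / R ^ j)"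
      using AE_lebesgue_point_locint[OF vl]
    proof (eventually_elim, intro allI impI)
      fix x :: "real^'d" and a b R :: real
      assume lp: "lebesgue_point v x" and a: "0 \<le> a" and b: "0 \<le> b" and R: "0 < R"
        and Ma: "HLmax (\<lambda>y. ennreal \<bar>grad_abs k u y\<bar>) x \<le> ennreal a"
        and Mb: "HLmax (\<lambda>y. ennreal \<bar>u y\<bar>) x \<le> ennreal b"
      define P where "P r = (\<integral>y. v y * tens (\<lambda>i. dilate \<psi> (x $ i) r) y \<partial>lebesgue)" for r
      have Mw: "HLmax (\<lambda>y. ennreal \<bar>w i y\<bar>) x \<le> ennreal a" for i
        using Ma wd_le_grad_abs[OF sw, of _ u]
        by (auto elim!: order_trans[rotated] intro!: HLmax_mono ennreal_leI intro: order_trans[OF _ abs_ge_self] simp: w_def)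
      have step: "\<bar>P (r / 2) - P r\<bar> \<le> C1 * a * r ^ m" if "r > 0" for r
        using two_scale_difference[of \<psi> \<eta> m K \<alpha> u v w x a r, OF \<psi> \<eta> eq K[of 0, simplified] K\<eta> v w Mw a that]
        unfolding P_def C1_def by (simp add: mult_ac)
      \<comment> \<open>The factor 2 - 2 (1/2)^n is the sum of (1/2)^i over i < n. The step at scale
        R/2^n carries (1/2)^(n m), at most (1/2)^n because m \<ge> 1.\<close>
      have tele: "\<bar>P (R / 2 ^ n) - P R\<bar> \<le> C1 * a * R ^ m * (2 - 2 * (1/2) ^ n)" for n
      proof (induction n)
        case (Suc n)
        have "(1 / 2 ^ n) ^ m \<le> (1 / 2 ^ n :: real) ^ 1"
          using m(1) by (intro power_decreasing) auto
        then have "C1 * a * R ^ m * (1 / 2 ^ n) ^ m \<le> C1 * a * R ^ m * (1/2) ^ n"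
          using C1 a R by (intro mult_left_mono) (auto simp: power_one_over)
        then have "\<bar>P (R / 2 ^ n / 2) - P (R / 2 ^ n)\<bar> \<le> C1 * a * R ^ m * (1/2) ^ n"
          using step[of "R / 2 ^ n"] R by (simp add: power_divide power_one_over)
        moreover have "P (R / 2 ^ n / 2) = P (R / 2 ^ Suc n)" by (simp add: mult.commute)
        ultimately have "\<bar>P (R / 2 ^ Suc n) - P R\<bar> \<le> C1 * a * R ^ m * (1/2) ^ n + C1 * a * R ^ m * (2 - 2 * (1/2) ^ n)"
          using Suc by linarith
        also have "\<dots> = C1 * a * R ^ m * (2 - 2 * (1/2) ^ Suc n)" by (simp add: algebra_simps)
        finally show ?case .
      qed simp
      \<comment> \<open>At the coarsest scale all j derivatives go to the kernel, and each costs a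
        factor 1/R.\<close>
      have PR: "\<bar>P R\<bar> \<le> C2 * (b / R ^ j)"
      proof -
        have "\<bar>P R\<bar> = \<bar>\<integral>y. u y * tens (\<lambda>i. (deriv ^^ \<alpha> i) (dilate \<psi> (x $ i) R)) y \<partial>lebesgue\<bar>"
          unfolding P_def
          by (rule weak_deriv_tens[OF v, where x=x and r=R]) (auto intro: smooth_dilate s dilate_outside_0[OF \<psi> R])
        also have "(\<lambda>y. u y * tens (\<lambda>i. (deriv ^^ \<alpha> i) (dilate \<psi> (x $ i) R)) y) =
            (\<lambda>y. (- 1 / R) ^ j * (u y * tens (\<lambda>i. dilate ((deriv ^^ \<alpha> i) \<psi>) (x $ i) R) y))"
          by (simp add: funpow_deriv_dilate[OF s] tens_def prod.distrib power_sum[symmetric] \<alpha> mult_ac)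
        also have "\<bar>\<integral>y. (- 1 / R) ^ j * (u y * tens (\<lambda>i. dilate ((deriv ^^ \<alpha> i) \<psi>) (x $ i) R) y) \<partial>lebesgue\<bar> =
            (1 / R) ^ j * \<bar>\<integral>y. u y * tens (\<lambda>i. dilate ((deriv ^^ \<alpha> i) \<psi>) (x $ i) R) y \<partial>lebesgue\<bar>"
          using R by (simp add: abs_mult power_abs)
        also have "\<dots> \<le> (1 / R) ^ j * (C2 * b)"
        proof (intro mult_left_mono)
          have "\<alpha> i \<le> j" for i using member_le_sum[of i UNIV \<alpha>] \<alpha> by simp
          then have "\<bar>dilate ((deriv ^^ \<alpha> i) \<psi>) (x $ i) R s\<bar> \<le> K / R" for i s
            by (intro dilate_bound K R)
          moreover have "dilate ((deriv ^^ \<alpha> i) \<psi>) (x $ i) R s = 0" if "R < \<bar>x $ i - s\<bar>" for i s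
            by (rule dilate_outside_0[OF unit_bump_deriv[OF \<psi>] R that])
          ultimately show "\<bar>\<integral>y. u y * tens (\<lambda>i. dilate ((deriv ^^ \<alpha> i) \<psi>) (x $ i) R) y \<partial>lebesgue\<bar> \<le> C2 * b"
            unfolding C2_def by (intro integral_tens_le_HLmax[OF um R _ _ Mb b])
        qed (use R in simp)
        finally show ?thesis by (simp add: power_divide mult_ac)
      qed
      have "\<bar>v x\<bar> * I \<le> 2 * C1 * a * R ^ m + C2 * (b / R ^ j)"
      \<comment> \<open>The error e is the distance of the average at the finest scale R/2^n, n
        large, from its limit at the Lebesgue point.\<close>
      proof (rule field_le_epsilon)
        fix e :: real assume e: "e > 0"
        obtain \<delta> where \<delta>: "\<delta> > 0" "\<And>r. 0 < r \<Longrightarrow> r < \<delta> \<Longrightarrow> \<bar>P r - v x * integral\<^sup>L lborel \<psi> ^ ?d\<bar> \<le> e"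
          using tens_dilate_Lebesgue_point[OF vl \<psi> lp e] unfolding P_def by blast
        have "(\<lambda>n. R * (1/2) ^ n) \<longlonglongrightarrow> R * 0" by (intro tendsto_intros LIMSEQ_realpow_zero) auto
        then have "eventually (\<lambda>n. R * (1/2) ^ n < \<delta>) sequentially" using \<delta>(1) by (intro order_tendstoD(2)) auto
        then obtain n where "R * (1/2) ^ n < \<delta>" by (auto simp: eventually_sequentially)
        then have "\<bar>P (R / 2 ^ n) - v x * integral\<^sup>L lborel \<psi> ^ ?d\<bar> \<le> e"
          using R by (intro \<delta>(2)) (auto simp: power_one_over)
        moreover have "\<bar>v x * integral\<^sup>L lborel \<psi> ^ ?d\<bar> = \<bar>v x\<bar> * I" by (simp add: I_def abs_mult power_abs)
        moreover have "C1 * a * R ^ m * (2 - 2 * (1/2) ^ n) \<le> C1 * a * R ^ m * 2"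
          using C1 a R by (intro mult_left_mono) auto
        ultimately show "\<bar>v x\<bar> * I \<le> 2 * C1 * a * R ^ m + C2 * (b / R ^ j) + e"
          using tele[of n] PR by linarith
      qed
      also have "\<dots> \<le> (2 * C1 + C2) * (R ^ m * a + b / R ^ j)"
        using C1 C2 a b R by (simp add: algebra_simps)
      finally show "\<bar>wd \<alpha> u x\<bar> \<le> C * (R ^ (k - j) * a + b / R ^ j)"
        using I unfolding C_def v_def m_def by (simp add: field_simps)
    qed
  qed
qed

section \<open>The interpolation inequality\<close>

text \<open>Averages of the weak derivative against small kernels are, up to sign, integrals of u
  against smooth functions and vanish; at Lebesgue points they approximate its value. This handles
  the degenerate case where u has norm 0.\<close>

lemma wd_AE_zero:
  fixes u :: "real^'d::finite \<Rightarrow> real"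
  assumes u: "W_loc k u" and \<alpha>: "sum \<alpha> UNIV \<le> k" and z: "AE x in lebesgue. u x = 0"
  shows "AE x in lebesgue. wd \<alpha> u x = 0"
proof -
  have v: "weak_deriv \<alpha> u (wd \<alpha> u)" by (rule weak_deriv_wd[OF u \<alpha>])
  then have vl: "locint (wd \<alpha> u)" by (simp add: weak_deriv_def)
  obtain \<psi> where \<psi>: "unit_bump \<psi>" and nz: "integral\<^sup>L lborel \<psi> \<noteq> 0" by (rule unit_bump_exists)
  then have s: "smooth \<psi>" by (simp add: unit_bump_def)
  show ?thesis
    using AE_lebesgue_point_locint[OF vl]
  proof eventually_elim
    fix x assume lp: "lebesgue_point (wd \<alpha> u) x"
    have "\<bar>wd \<alpha> u x * integral\<^sup>L lborel \<psi> ^ CARD('d)\<bar> \<le> 0 + e" if e: "e > 0" for e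
    proof -
      obtain \<delta> where \<delta>: "\<delta> > 0" "\<And>r. 0 < r \<Longrightarrow> r < \<delta> \<Longrightarrow>
        \<bar>(\<integral>y. wd \<alpha> u y * tens (\<lambda>i. dilate \<psi> (x $ i) r) y \<partial>lebesgue) - wd \<alpha> u x * integral\<^sup>L lborel \<psi> ^ CARD('d)\<bar> \<le> e"
        using tens_dilate_Lebesgue_point[OF vl \<psi> lp e] by blast
      let ?h = "\<lambda>i. dilate \<psi> (x $ i) (\<delta> / 2)"
      have "\<bar>\<integral>y. wd \<alpha> u y * tens ?h y \<partial>lebesgue\<bar> = \<bar>\<integral>y. u y * tens (\<lambda>i. (deriv ^^ \<alpha> i) (?h i)) y \<partial>lebesgue\<bar>"
        using \<delta>(1) by (intro weak_deriv_tens[OF v, where x=x and r="\<delta> / 2"])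
          (auto intro: smooth_dilate s dilate_outside_0[OF \<psi>])
      also have "(\<integral>y. u y * tens (\<lambda>i. (deriv ^^ \<alpha> i) (?h i)) y \<partial>lebesgue) = 0"
        using z by (intro integral_eq_zero_AE) (auto elim!: eventually_mono)
      finally show ?thesis using \<delta>(2)[of "\<delta> / 2"] \<delta>(1) by simp
    qed
    then have "\<bar>wd \<alpha> u x * integral\<^sup>L lborel \<psi> ^ CARD('d)\<bar> \<le> 0" by (rule field_le_epsilon)
    then show "wd \<alpha> u x = 0" using nz by simp
  qed
qed

lemma nrearr_AE_zero:
  fixes f :: "'a::euclidean_space \<Rightarrow> ennreal"
  assumes f: "f \<in> borel_measurable lebesgue" and z: "AE x in lebesgue. f x = 0"
  shows "nrearr f t = 0"
proof -
  have "emeasure lebesgue {x. 0 < f x} = 0"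
    using AE_iff_measurable[OF sets_lebesgue_superlevel[OF f, of 0], of "\<lambda>x. f x = 0"] z
    by (simp only: zero_less_iff_neq_zero space_completion space_lborel space_borel UNIV_I simp_thms)
  then have "nrearr f t \<le> 0" by (intro nrearr_leI) simp
  then show ?thesis by simp
qed

text \<open>The rearrangement has zeros at arbitrarily small t > 0, and each of them bounds the
  measure of {f > 0} by t.\<close>

lemma AE_zero_if_nrearr:
  fixes f :: "'a::euclidean_space \<Rightarrow> ennreal"
  assumes f: "f \<in> borel_measurable lebesgue" and z: "ae_pos (\<lambda>t. nrearr f t = 0)"
  shows "AE x in lebesgue. f x = 0"
proof -
  have "emeasure lebesgue {x. 0 < f x} \<le> 0"
  proof (rule ennreal_le_epsilon)
    fix e :: real assume e: "e > 0"
    have "\<exists>t\<in>{0<..<e}. nrearr f t = 0"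
    proof (rule ccontr)
      assume "\<not> ?thesis"
      then have "AE t in lebesgue. t \<notin> {0<..<e}"
        using z unfolding ae_pos_def by (auto elim!: eventually_mono)
      then have "{0<..<e} \<in> null_sets lebesgue" by (subst AE_iff_null_sets) auto
      then have "emeasure lebesgue {0<..<e} = 0" by blast
      then show False using e by simp
    qed
    then obtain t where t: "0 < t" "t < e" "nrearr f t = 0" by auto
    have "emeasure lebesgue {x. 0 < f x} \<le> ennreal t"
      using emeasure_nrearr_level[OF f, of t] t by simp
    also have "\<dots> \<le> ennreal e" using t by (intro ennreal_leI) simp
    finally show "emeasure lebesgue {x. 0 < f x} \<le> 0 + ennreal e" by simp
  qed
  then have "{x. 0 < f x} \<in> null_sets lebesgue" using sets_lebesgue_superlevel[OF f] by auto
  then show ?thesis by (rule AE_I') (auto simp: zero_less_iff_neq_zero)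
qed

section \<open>The Calderon-Lozanovskii norm and the choice of the radius\<close>

lemma CL_space_le:
  assumes "g \<in> borel_measurable lebesgue" "h \<in> borel_measurable lebesgue"
    and "ae_pos (\<lambda>t. f t \<le> epowr (g t) \<theta> * epowr (h t) (1 - \<theta>))"
  shows "CL_space \<rho>Y \<rho>Z \<theta> f \<le> max (\<rho>Y g) (\<rho>Z h)"
  unfolding CL_space_def by (rule INF_lower2[of "(g, h)"]) (use assms in auto)

lemma CL_space_zero:
  assumes Y: "BFS \<rho>Y" and Z: "BFS \<rho>Z" and z: "ae_pos (\<lambda>t. f t = 0)"
  shows "CL_space \<rho>Y \<rho>Z \<theta> f = 0"
proof -
  have "CL_space \<rho>Y \<rho>Z \<theta> f \<le> max (\<rho>Y (\<lambda>_. 0)) (\<rho>Z (\<lambda>_. 0))"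
    using z by (intro CL_space_le) (auto simp: ae_pos_def elim!: eventually_mono)
  also have "\<dots> = 0"
    using BFS_zero_iff[OF Y, of "\<lambda>_. 0"] BFS_zero_iff[OF Z, of "\<lambda>_. 0"] by (simp add: ae_pos_def)
  finally show ?thesis by simp
qed

lemma epowr_scale:
  assumes "s > 0"
  shows "epowr (ennreal s * x) \<theta> = ennreal (s powr \<theta>) * epowr x \<theta>"
proof (cases x)
  case (real r)
  then show ?thesis using assms
    by (simp add: epowr_def powr_mult flip: ennreal_mult)
next
  case top
  then show ?thesis using assms by (simp add: epowr_def ennreal_mult_top)
qed

lemma epowr_ennreal: "r \<ge> 0 \<Longrightarrow> epowr (ennreal r) \<theta> = ennreal (r powr \<theta>)"
  by (simp add: epowr_def)

text \<open>Turns a maximum into a product: with M = A^\<theta> B^(1-\<theta>), the factors s1 = L M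
  / A for g and s2 = L M / B for h make both norms at most c L M, while s1^\<theta> s2^(1-\<theta>)
  = L preserves the factorisation of the bound for f.\<close>

lemma CL_space_product_le:
  assumes Y: "BFS \<rho>Y" and Z: "BFS \<rho>Z" and \<theta>: "0 < \<theta>" "\<theta> < 1"
    and g: "g \<in> borel_measurable lebesgue" and h: "h \<in> borel_measurable lebesgue"
    and gA: "\<rho>Y g \<le> ennreal (c * A)" and hB: "\<rho>Z h \<le> ennreal (c * B)"
    and pos: "A > 0" "B > 0" "c > 0" "L > 0"
    and f: "ae_pos (\<lambda>t. f t \<le> ennreal L * epowr (g t) \<theta> * epowr (h t) (1 - \<theta>))"
  shows "CL_space \<rho>Y \<rho>Z \<theta> f \<le> ennreal (c * L * (A powr \<theta> * B powr (1 - \<theta>)))"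
proof -
  define M where "M = A powr \<theta> * B powr (1 - \<theta>)"
  have M: "M > 0" unfolding M_def using pos by simp
  define s1 where "s1 = L * M / A"
  define s2 where "s2 = L * M / B"
  have s: "s1 > 0" "s2 > 0" unfolding s1_def s2_def using pos M by auto
  have LM: "(L * M) powr \<theta> * (L * M) powr (1 - \<theta>) = L * M"
    using pos M by (simp flip: powr_add)
  have "s1 powr \<theta> * s2 powr (1 - \<theta>) = ((L * M) powr \<theta> * (L * M) powr (1 - \<theta>)) / M"
    unfolding s1_def s2_def using pos M by (simp add: powr_divide M_def[symmetric])
  also have "\<dots> = L" unfolding LM using M by simp
  finally have sL: "s1 powr \<theta> * s2 powr (1 - \<theta>) = L" .
  have "CL_space \<rho>Y \<rho>Z \<theta> f \<le> max (\<rho>Y (\<lambda>t. ennreal s1 * g t)) (\<rho>Z (\<lambda>t. ennreal s2 * h t))"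
  proof (rule CL_space_le)
    have "ennreal L * epowr (g t) \<theta> * epowr (h t) (1 - \<theta>) =
        epowr (ennreal s1 * g t) \<theta> * epowr (ennreal s2 * h t) (1 - \<theta>)" for t
      unfolding sL[symmetric] epowr_scale[OF s(1)] epowr_scale[OF s(2)] by (simp add: ennreal_mult mult_ac)
    then show "ae_pos (\<lambda>t. f t \<le> epowr (ennreal s1 * g t) \<theta> * epowr (ennreal s2 * h t) (1 - \<theta>))"
      using f by simp
  qed (use g h in auto)
  also have "\<dots> \<le> ennreal (c * L * M)"
  proof (rule max.boundedI)
    have "\<rho>Y (\<lambda>t. ennreal s1 * g t) = ennreal s1 * \<rho>Y g" using s by (intro BFS_scale[OF Y g]) auto
    also have "\<dots> \<le> ennreal s1 * ennreal (c * A)" by (intro mult_left_mono gA) simp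
    also have "\<dots> = ennreal (c * L * M)" unfolding s1_def using pos M by (simp add: mult_ac flip: ennreal_mult)
    finally show "\<rho>Y (\<lambda>t. ennreal s1 * g t) \<le> ennreal (c * L * M)" .
    have "\<rho>Z (\<lambda>t. ennreal s2 * h t) = ennreal s2 * \<rho>Z h" using s by (intro BFS_scale[OF Z h]) auto
    also have "\<dots> \<le> ennreal s2 * ennreal (c * B)" by (intro mult_left_mono hB) simp
    also have "\<dots> = ennreal (c * L * M)" unfolding s2_def using pos M by (simp add: mult_ac flip: ennreal_mult)
    finally show "\<rho>Z (\<lambda>t. ennreal s2 * h t) \<le> ennreal (c * L * M)" .
  qed
  finally show ?thesis unfolding M_def .
qed

text \<open>This R balances the two terms: each of them equals the product of powers on the
  right.\<close>

lemma optimal_radius: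
  fixes a b :: real and j k :: nat
  assumes "a > 0" "b > 0" "0 < j" "j < k"
  defines "R \<equiv> (b / a) powr (1 / k)"
  shows "R ^ (k - j) * a + b / R ^ j = 2 * (a powr (real j / real k) * b powr (1 - real j / real k))"
proof -
  let ?\<theta> = "real j / real k"
  have R: "R > 0" unfolding R_def using assms by simp
  have pw: "R ^ n = b powr (real n / real k) / a powr (real n / real k)" for n
  proof -
    have "R ^ n = R powr real n" using R by (simp add: powr_realpow)
    also have "\<dots> = (b / a) powr (real n / real k)" unfolding R_def by (simp add: powr_powr)
    finally show ?thesis using assms by (simp add: powr_divide)
  qed
  have e: "real (k - j) / real k = 1 - ?\<theta>" using assms by (simp add: of_nat_diff diff_divide_distrib)
  have split: "x = x powr ?\<theta> * x powr (1 - ?\<theta>)" if "x > 0" for x :: real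
    using that by (simp flip: powr_add)
  have "R ^ (k - j) * a = b powr (1 - ?\<theta>) / a powr (1 - ?\<theta>) * (a powr ?\<theta> * a powr (1 - ?\<theta>))"
    unfolding pw e using split[OF assms(1)] by simp
  also have "\<dots> = a powr ?\<theta> * b powr (1 - ?\<theta>)" using assms by simp
  finally have 1: "R ^ (k - j) * a = a powr ?\<theta> * b powr (1 - ?\<theta>)" .
  have "b / R ^ j = (b powr ?\<theta> * b powr (1 - ?\<theta>)) / (b powr ?\<theta> / a powr ?\<theta>)"
    unfolding pw using split[OF assms(2)] by simp
  also have "\<dots> = a powr ?\<theta> * b powr (1 - ?\<theta>)" using assms by simp
  finally show ?thesis using 1 by simp
qed

text \<open>Let a and b be the two Hardy sums at t/2. Up to an arbitrary e > 0, the maximal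
  functions are at most \<open>HLconst\<close> times a and b outside two sets of measure t/2. Hence
  the pointwise bound with the optimal radius controls the j-th gradient outside a set of measure t,
  which bounds its rearrangement at t.\<close>

lemma rearr_grad_abs_le:
  fixes j k :: nat
  assumes j: "1 \<le> j" "j < k" and q: "q > 1" "q' > 1"
  shows "\<exists>L>0. \<forall>u :: real^'d::finite \<Rightarrow> real. W_loc k u \<longrightarrow> (\<forall>t>0.
    hardy_sum q (rearr (grad_abs k u)) (1/2 * t) < top \<longrightarrow> hardy_sum q' (rearr u) (1/2 * t) < top \<longrightarrow>
    rearr (grad_abs j u) t \<le> ennreal L *
      epowr (hardy_sum q (rearr (grad_abs k u)) (1/2 * t)) (real j / real k) *
      epowr (hardy_sum q' (rearr u) (1/2 * t)) (1 - real j / real k))"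
proof -
  let ?\<theta> = "real j / real k"
  let ?\<kappa> = "HLconst TYPE(real^'d)"
  let ?A = "{\<alpha>::'d \<Rightarrow> nat. sum \<alpha> UNIV = j}"
  have \<theta>: "0 < ?\<theta>" "?\<theta> < 1" using j by auto
  have \<kappa>: "?\<kappa> > 0" by (rule HLconst_pos)
  obtain C where C: "C > 0" and pw: "\<And>u \<alpha>. W_loc k (u :: real^'d \<Rightarrow> real) \<Longrightarrow> sum \<alpha> UNIV = j \<Longrightarrow>
    (AE x in lebesgue. \<forall>a b R. 0 \<le> a \<longrightarrow> 0 \<le> b \<longrightarrow> 0 < R \<longrightarrow>
      HLmax (\<lambda>y. ennreal \<bar>grad_abs k u y\<bar>) x \<le> ennreal a \<longrightarrow> HLmax (\<lambda>y. ennreal \<bar>u y\<bar>) x \<le> ennreal b \<longrightarrow>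
      \<bar>wd \<alpha> u x\<bar> \<le> C * (R ^ (k - j) * a + b / R ^ j))"
    using weak_deriv_pointwise_bound[OF j(2), where 'd='d] by blast
  \<comment> \<open>The factor 2 comes from \<open>optimal_radius\<close>, \<open>?\<kappa>\<close>
    from the bounds of the maximal functions, the cardinality from summing over the multi-indices;
    the added 1 makes positivity immediate.\<close>
  define L where "L = (real (card ?A) + 1) * (C * (2 * ?\<kappa>))"
  have L: "L > 0" unfolding L_def using C \<kappa> by (intro mult_pos_pos) auto
  show ?thesis
  proof (intro exI[of _ L] conjI L allI impI)
    fix u :: "real^'d \<Rightarrow> real" and t :: real
    assume u: "W_loc k u" and t: "t > 0"
      and fin: "hardy_sum q (rearr (grad_abs k u)) (1/2 * t) < top" "hardy_sum q' (rearr u) (1/2 * t) < top"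
    define a where "a = enn2real (hardy_sum q (rearr (grad_abs k u)) (1/2 * t))"
    define b where "b = enn2real (hardy_sum q' (rearr u) (1/2 * t))"
    have a: "hardy_sum q (rearr (grad_abs k u)) (1/2 * t) = ennreal a" "a \<ge> 0" using fin(1) by (auto simp: a_def)
    have b: "hardy_sum q' (rearr u) (1/2 * t) = ennreal b" "b \<ge> 0" using fin(2) by (auto simp: b_def)
    have Fm: "(\<lambda>y. ennreal \<bar>grad_abs k u y\<bar>) \<in> borel_measurable lebesgue" using grad_abs_measurable[OF u, of k] by simp
    have "u \<in> borel_measurable lebesgue" using u locint_measurable by (auto simp: W_loc_def)
    then have Um: "(\<lambda>y. ennreal \<bar>u y\<bar>) \<in> borel_measurable lebesgue" by simp
    have "AE x in lebesgue. \<forall>\<alpha>\<in>?A. \<forall>a b R. 0 \<le> a \<longrightarrow> 0 \<le> b \<longrightarrow> 0 < R \<longrightarrow>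
      HLmax (\<lambda>y. ennreal \<bar>grad_abs k u y\<bar>) x \<le> ennreal a \<longrightarrow> HLmax (\<lambda>y. ennreal \<bar>u y\<bar>) x \<le> ennreal b \<longrightarrow>
      \<bar>wd \<alpha> u x\<bar> \<le> C * (R ^ (k - j) * a + b / R ^ j)"
      by (rule AE_finite_allI[OF finite_multi_indices], rule pw[OF u]) simp
    then obtain N0 where N0: "N0 \<in> null_sets lebesgue" and sub0: "{x. \<not> (\<forall>\<alpha>\<in>?A. \<forall>a b R. 0 \<le> a \<longrightarrow> 0 \<le> b \<longrightarrow> 0 < R \<longrightarrow>
      HLmax (\<lambda>y. ennreal \<bar>grad_abs k u y\<bar>) x \<le> ennreal a \<longrightarrow> HLmax (\<lambda>y. ennreal \<bar>u y\<bar>) x \<le> ennreal b \<longrightarrow>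
      \<bar>wd \<alpha> u x\<bar> \<le> C * (R ^ (k - j) * a + b / R ^ j))} \<subseteq> N0"
      unfolding eventually_ae_filter by auto
    have pw': "\<bar>wd \<alpha> u x\<bar> \<le> C * (R ^ (k - j) * a + b / R ^ j)"
      if "x \<notin> N0" "sum \<alpha> UNIV = j" "0 \<le> a" "0 \<le> b" "0 < R"
        "HLmax (\<lambda>y. ennreal \<bar>grad_abs k u y\<bar>) x \<le> ennreal a" "HLmax (\<lambda>y. ennreal \<bar>u y\<bar>) x \<le> ennreal b" for x \<alpha> a b R
    proof -
      have "\<forall>\<alpha>\<in>?A. \<forall>a b R. 0 \<le> a \<longrightarrow> 0 \<le> b \<longrightarrow> 0 < R \<longrightarrow>
        HLmax (\<lambda>y. ennreal \<bar>grad_abs k u y\<bar>) x \<le> ennreal a \<longrightarrow> HLmax (\<lambda>y. ennreal \<bar>u y\<bar>) x \<le> ennreal b \<longrightarrow>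
        \<bar>wd \<alpha> u x\<bar> \<le> C * (R ^ (k - j) * a + b / R ^ j)"
        using subsetD[OF sub0, of x] that(1) by fast
      then show ?thesis using that(2-) by simp
    qed
    \<comment> \<open>Enlarging a and b by e gives the strict inequality required by
      \<open>HLmax_nrearr\<close> and positive values for the radius, since a or b may be 0.
      Afterwards e tends to 0.\<close>
    have eps: "rearr (grad_abs j u) t \<le> ennreal (L * ((a + e) powr ?\<theta> * (b + e) powr (1 - ?\<theta>)))" if e: "e > 0" for e
    proof -
      let ?a = "?\<kappa> * (a + e)" and ?b = "?\<kappa> * (b + e)"
      have pos: "?a > 0" "?b > 0" using \<kappa> a b e by auto
      have "hardy_sum q (nrearr (\<lambda>y. ennreal \<bar>grad_abs k u y\<bar>)) (1/2 * t) < ennreal (a + e)"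
        using a e by (simp add: rearr_eq_nrearr[symmetric] ennreal_less_iff)
      from HLmax_nrearr[OF Fm q(1) _ this] t obtain N1 where N1: "N1 \<in> sets lebesgue"
        "{x. ennreal ?a < HLmax (\<lambda>y. ennreal \<bar>grad_abs k u y\<bar>) x} \<subseteq> N1" "emeasure lebesgue N1 \<le> ennreal (1/2 * t)"
        by auto
      have "hardy_sum q' (nrearr (\<lambda>y. ennreal \<bar>u y\<bar>)) (1/2 * t) < ennreal (b + e)"
        using b e by (simp add: rearr_eq_nrearr[symmetric] ennreal_less_iff)
      from HLmax_nrearr[OF Um q(2) _ this] t obtain N2 where N2: "N2 \<in> sets lebesgue"
        "{x. ennreal ?b < HLmax (\<lambda>y. ennreal \<bar>u y\<bar>) x} \<subseteq> N2" "emeasure lebesgue N2 \<le> ennreal (1/2 * t)"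
        by auto
      define c where "c = L * ((a + e) powr ?\<theta> * (b + e) powr (1 - ?\<theta>))"
      have sub: "{x. ennreal c < ennreal \<bar>grad_abs j u x\<bar>} \<subseteq> N0 \<union> (N1 \<union> N2)"
      proof (rule subsetI, rule ccontr)
        fix x assume x: "x \<in> {x. ennreal c < ennreal \<bar>grad_abs j u x\<bar>}" "x \<notin> N0 \<union> (N1 \<union> N2)"
        then have M: "HLmax (\<lambda>y. ennreal \<bar>grad_abs k u y\<bar>) x \<le> ennreal ?a" "HLmax (\<lambda>y. ennreal \<bar>u y\<bar>) x \<le> ennreal ?b"
          using N1(2) N2(2) by (auto simp: subset_eq not_less)
        have "\<bar>wd \<alpha> u x\<bar> \<le> C * (2 * (?a powr ?\<theta> * ?b powr (1 - ?\<theta>)))" if "sum \<alpha> UNIV = j" for \<alpha>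
        proof -
          have "\<bar>wd \<alpha> u x\<bar> \<le> C * (((?b / ?a) powr (1 / k)) ^ (k - j) * ?a + ?b / ((?b / ?a) powr (1 / k)) ^ j)"
            using x pos that M by (intro pw') auto
          then show ?thesis using optimal_radius[of ?a ?b j k] pos j by simp
        qed
        moreover have "?a powr ?\<theta> * ?b powr (1 - ?\<theta>) = ?\<kappa> * ((a + e) powr ?\<theta> * (b + e) powr (1 - ?\<theta>))"
        proof -
          have "?\<kappa> powr ?\<theta> * ?\<kappa> powr (1 - ?\<theta>) = ?\<kappa>" using \<kappa> by (simp flip: powr_add)
          then show ?thesis using \<kappa> a b e by (simp add: powr_mult mult_ac)
        qed
        ultimately have "\<bar>wd \<alpha> u x\<bar> \<le> C * (2 * ?\<kappa>) * ((a + e) powr ?\<theta> * (b + e) powr (1 - ?\<theta>))" if "sum \<alpha> UNIV = j" for \<alpha>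
          using that by (simp add: mult_ac)
        then have "grad_abs j u x \<le> real (card ?A) * (C * (2 * ?\<kappa>) * ((a + e) powr ?\<theta> * (b + e) powr (1 - ?\<theta>)))"
          unfolding grad_abs_def by (intro sum_bounded_above) auto
        also have "\<dots> \<le> c"
          unfolding c_def L_def mult.assoc using C \<kappa> by (intro mult_right_mono) auto
        finally have "grad_abs j u x \<le> c" .
        moreover have "grad_abs j u x \<ge> 0" unfolding grad_abs_def by (intro sum_nonneg) auto
        ultimately show False using x by (simp add: ennreal_less_iff)
      qed
      have "emeasure lebesgue {x. ennreal c < ennreal \<bar>grad_abs j u x\<bar>} \<le> emeasure lebesgue (N0 \<union> (N1 \<union> N2))"
        using N0 N1(1) N2(1) by (intro emeasure_mono sub) auto
      also have "\<dots> \<le> emeasure lebesgue N0 + (emeasure lebesgue N1 + emeasure lebesgue N2)"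
        using N0 N1(1) N2(1) by (intro order_trans[OF emeasure_subadditive] add_left_mono emeasure_subadditive) auto
      also have "\<dots> \<le> 0 + (ennreal (1/2 * t) + ennreal (1/2 * t))"
        using N0 N1(3) N2(3) by (intro add_mono) auto
      also have "\<dots> = ennreal t" using t by (simp flip: ennreal_plus)
      finally show ?thesis unfolding c_def[symmetric] rearr_eq_nrearr by (rule nrearr_leI)
    qed
    have "((\<lambda>e. L * ((a + e) powr ?\<theta> * (b + e) powr (1 - ?\<theta>))) \<longlongrightarrow> L * ((a + 0) powr ?\<theta> * (b + 0) powr (1 - ?\<theta>))) (at_right 0)"
    proof (intro tendsto_mult tendsto_const tendsto_powr2 tendsto_add tendsto_ident_at)
      show "\<forall>\<^sub>F e in at_right 0. 0 \<le> a + e" "\<forall>\<^sub>F e in at_right 0. 0 \<le> b + e"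
        using eventually_at_right_less[of 0] by (eventually_elim, use a b in simp)+
    qed (use \<theta> in auto)
    then have "((\<lambda>e. ennreal (L * ((a + e) powr ?\<theta> * (b + e) powr (1 - ?\<theta>)))) \<longlongrightarrow> ennreal (L * (a powr ?\<theta> * b powr (1 - ?\<theta>)))) (at_right 0)"
      by (intro tendsto_ennrealI) simp
    then have "rearr (grad_abs j u) t \<le> ennreal (L * (a powr ?\<theta> * b powr (1 - ?\<theta>)))"
    proof (rule tendsto_lowerbound)
      show "\<forall>\<^sub>F e in at_right 0. rearr (grad_abs j u) t \<le> ennreal (L * ((a + e) powr ?\<theta> * (b + e) powr (1 - ?\<theta>)))"
        using eventually_at_right_less[of 0] by eventually_elim (rule eps)
    qed simp
    also have "\<dots> = ennreal L * epowr (ennreal a) ?\<theta> * epowr (ennreal b) (1 - ?\<theta>)"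
      using L a b by (simp add: epowr_ennreal ennreal_mult mult.assoc)
    finally show "rearr (grad_abs j u) t \<le> ennreal L *
      epowr (hardy_sum q (rearr (grad_abs k u)) (1/2 * t)) ?\<theta> * epowr (hardy_sum q' (rearr u) (1/2 * t)) (1 - ?\<theta>)"
      unfolding a b .
  qed
qed

theorem theorem2p1:
  fixes \<rho>Y \<rho>Z :: "(real \<Rightarrow> ennreal) \<Rightarrow> ennreal" and j k :: nat
  assumes "RIBFS \<rho>Y" and "RIBFS \<rho>Z"
    and "upper_boyd \<rho>Y < 1" and "upper_boyd \<rho>Z < 1"
    and "1 \<le> j" and "j < k"
  shows "\<exists>C::real. C > 0 \<and> (\<forall>u :: real ^ 'd \<Rightarrow> real. W_loc k u \<longrightarrow> memR \<rho>Z u \<longrightarrow>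
     normR (CL_space \<rho>Y \<rho>Z (real j / real k)) (grad_abs j u)
       \<le> ennreal C * epowr (normR \<rho>Y (grad_abs k u)) (real j / real k)
                   * epowr (normR \<rho>Z u) (1 - real j / real k))"
proof -
  let ?\<theta> = "real j / real k"
  have \<theta>: "0 < ?\<theta>" "?\<theta> < 1" using assms(5,6) by auto
  note Y = RIBFS_BFS[OF assms(1)] and Z = RIBFS_BFS[OF assms(2)]
  obtain q where q: "q > 1" "dil_norm \<rho>Y (1 / q) < ennreal q" by (rule upper_boyd_less_one[OF assms(1,3)])
  obtain q' where q': "q' > 1" "dil_norm \<rho>Z (1 / q') < ennreal q'" by (rule upper_boyd_less_one[OF assms(2,4)])
  obtain CY where CY: "CY > 0" "\<And>\<phi>. \<phi> \<in> borel_measurable borel \<Longrightarrow> \<rho>Y (hardy_sum q \<phi>) \<le> ennreal CY * \<rho>Y \<phi>"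
    using BFS_hardy_sum[OF Y q] by blast
  obtain CZ where CZ: "CZ > 0" "\<And>\<phi>. \<phi> \<in> borel_measurable borel \<Longrightarrow> \<rho>Z (hardy_sum q' \<phi>) \<le> ennreal CZ * \<rho>Z \<phi>"
    using BFS_hardy_sum[OF Z q'] by blast
  obtain L where L: "L > 0" and grad: "\<And>(u :: real^'d \<Rightarrow> real) t. W_loc k u \<Longrightarrow> t > 0 \<Longrightarrow>
    hardy_sum q (rearr (grad_abs k u)) (1/2 * t) < top \<Longrightarrow> hardy_sum q' (rearr u) (1/2 * t) < top \<Longrightarrow>
    rearr (grad_abs j u) t \<le> ennreal L *
      epowr (hardy_sum q (rearr (grad_abs k u)) (1/2 * t)) ?\<theta> * epowr (hardy_sum q' (rearr u) (1/2 * t)) (1 - ?\<theta>)"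
    using rearr_grad_abs_le[OF assms(5,6) q(1) q'(1), where 'd='d] by blast
  \<comment> \<open>The 2 pays for the dilation by 1/2, and the sum gives both spaces a common
    constant.\<close>
  define c where "c = 2 * (CY + CZ)"
  have c: "c > 0" unfolding c_def using CY(1) CZ(1) by simp
  show ?thesis
  proof (intro exI[of _ "c * L"] conjI allI impI)
    show "c * L > 0" using c L by simp
    fix u :: "real^'d \<Rightarrow> real"
    assume u: "W_loc k u" and uZ: "memR \<rho>Z u"
    define A where "A = normR \<rho>Y (grad_abs k u)"
    define B where "B = normR \<rho>Z u"
    define g where "g t = hardy_sum q (rearr (grad_abs k u)) (1/2 * t)" for t
    define h where "h t = hardy_sum q' (rearr u) (1/2 * t)" for t
    have rm: "rearr w \<in> borel_measurable borel" for w :: "real^'d \<Rightarrow> real"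
      unfolding rearr_eq_nrearr by (rule borel_measurable_nrearr)
    have g: "g \<in> borel_measurable lebesgue" and h: "h \<in> borel_measurable lebesgue"
      unfolding g_def[abs_def] h_def[abs_def]
      by (intro measurable_lebesgue_scale measurable_lebesgue_if_borel measurable_hardy_sum rm, simp)+
    have gA: "\<rho>Y g \<le> ennreal c * A"
    proof -
      have "\<rho>Y g \<le> 2 * \<rho>Y (hardy_sum q (rearr (grad_abs k u)))"
        unfolding g_def[abs_def] by (intro RIBFS_double_borel assms(1) measurable_hardy_sum rm)
      also have "\<dots> \<le> 2 * (ennreal CY * A)"
        unfolding A_def normR_def by (intro mult_left_mono CY(2) rm) simp
      also have "\<dots> = ennreal (2 * CY) * A" using CY by (simp add: ennreal_mult mult.assoc)
      also have "\<dots> \<le> ennreal c * A" unfolding c_def using CZ(1) by (intro mult_right_mono ennreal_leI) auto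
      finally show ?thesis .
    qed
    have hB: "\<rho>Z h \<le> ennreal c * B"
    proof -
      have "\<rho>Z h \<le> 2 * \<rho>Z (hardy_sum q' (rearr u))"
        unfolding h_def[abs_def] by (intro RIBFS_double_borel assms(2) measurable_hardy_sum rm)
      also have "\<dots> \<le> 2 * (ennreal CZ * B)"
        unfolding B_def normR_def by (intro mult_left_mono CZ(2) rm) simp
      also have "\<dots> = ennreal (2 * CZ) * B" using CZ by (simp add: ennreal_mult mult.assoc)
      also have "\<dots> \<le> ennreal c * B" unfolding c_def using CY(1) by (intro mult_right_mono ennreal_leI) auto
      finally show ?thesis .
    qed
    have Bfin: "B < top" using uZ by (simp add: B_def normR_def memR_def)
    \<comment> \<open>For B = 0 the right-hand side of the goal is 0 even if A is infinite, so the
      vanishing of u has to be passed on to its k-th gradient.\<close>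
    have zero: "B = 0 \<Longrightarrow> A = 0"
    proof -
      assume "B = 0"
      then have "ae_pos (\<lambda>t. rearr u t = 0)"
        using BFS_zero_iff[OF Z measurable_lebesgue_if_borel[OF rm]] by (simp add: B_def normR_def)
      moreover have um: "u \<in> borel_measurable lebesgue" using uZ by (simp add: memR_def)
      then have "(\<lambda>x. ennreal \<bar>u x\<bar>) \<in> borel_measurable lebesgue" using um by simp
      ultimately have "AE x in lebesgue. ennreal \<bar>u x\<bar> = 0"
        unfolding rearr_eq_nrearr by (intro AE_zero_if_nrearr)
      then have u0: "AE x in lebesgue. u x = 0" by (auto elim!: eventually_mono)
      have "AE x in lebesgue. \<forall>\<alpha>\<in>{\<alpha>. sum \<alpha> UNIV = k}. wd \<alpha> u x = 0"
        by (rule AE_finite_allI[OF finite_multi_indices]) (rule wd_AE_zero[OF u _ u0], simp)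
      then have "AE x in lebesgue. ennreal \<bar>grad_abs k u x\<bar> = 0"
        by eventually_elim (simp add: grad_abs_def)
      then have "rearr (grad_abs k u) t = 0" for t
        unfolding rearr_eq_nrearr by (intro nrearr_AE_zero) (use grad_abs_measurable[OF u, of k] in auto)
      then show "A = 0"
        using BFS_zero_iff[OF Y measurable_lebesgue_if_borel[OF rm]] by (simp add: A_def normR_def ae_pos_def)
    qed
    show "normR (CL_space \<rho>Y \<rho>Z ?\<theta>) (grad_abs j u) \<le> ennreal (c * L) * epowr A ?\<theta> * epowr B (1 - ?\<theta>)"
    proof (cases "A = top")
      case True
      with zero have "B \<noteq> 0" by auto
      then obtain b where "B = ennreal b" "b > 0" using Bfin by (cases B) (auto simp: less_le)
      then have "epowr B (1 - ?\<theta>) \<noteq> 0" by (simp add: epowr_ennreal)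
      then show ?thesis using True c L by (simp add: epowr_def ennreal_mult_top ennreal_top_mult)
    next
      case Afin: False
      \<comment> \<open>Finite norms make both Hardy sums finite at almost every t, as
        \<open>grad\<close> demands.\<close>
      have "\<rho>Y g < \<infinity>" "\<rho>Z h < \<infinity>"
        using gA hB Afin Bfin by (auto intro: le_less_trans simp: ennreal_mult_less_top less_top)
      then have "ae_pos (\<lambda>t. g t < \<infinity>)" "ae_pos (\<lambda>t. h t < \<infinity>)"
        using BFS_finite[OF Y g] BFS_finite[OF Z h] by auto
      then have le: "ae_pos (\<lambda>t. rearr (grad_abs j u) t \<le> ennreal L * epowr (g t) ?\<theta> * epowr (h t) (1 - ?\<theta>))"
        unfolding ae_pos_def
      proof eventually_elim
        case (elim t)
        then show ?case using grad[OF u, of t] unfolding g_def h_def by simp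
      qed
      show ?thesis
      \<comment> \<open>The rescaling in \<open>CL_space_product_le\<close> divides by A and B. If
        one of them is 0, then A = 0, and g together with the bound \<open>le\<close> vanishes
        almost everywhere.\<close>
      proof (cases "A = 0 \<or> B = 0")
        case True
        then have A0: "A = 0" using zero by auto
        then have "\<rho>Y g = 0" using gA by simp
        then have "ae_pos (\<lambda>t. g t = 0)" using BFS_zero_iff[OF Y g] by simp
        with le have "ae_pos (\<lambda>t. rearr (grad_abs j u) t = 0)"
          unfolding ae_pos_def by eventually_elim (auto simp: epowr_def)
        then show ?thesis
          unfolding normR_def using CL_space_zero[OF Y Z] by simp
      next
        case False
        obtain x where x: "A = ennreal x" "x > 0" using False Afin by (cases A) (auto simp: less_le)
        obtain y where y: "B = ennreal y" "y > 0" using False Bfin by (cases B) (auto simp: less_le)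
        have "CL_space \<rho>Y \<rho>Z ?\<theta> (rearr (grad_abs j u)) \<le> ennreal (c * L * (x powr ?\<theta> * y powr (1 - ?\<theta>)))"
          using gA hB x y c by (intro CL_space_product_le[OF Y Z \<theta> g h _ _ x(2) y(2) c L le]) (auto simp: ennreal_mult)
        also have "\<dots> = ennreal (c * L) * epowr A ?\<theta> * epowr B (1 - ?\<theta>)"
          using x y c L by (simp add: epowr_ennreal ennreal_mult mult.assoc)
        finally show ?thesis unfolding normR_def .
      qed
    qed
  qed
qed

end
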